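(* Consider a non-degenerate helicoidal surface in $\mathbf{E}_1^3$ (axis $L$, pitch $h\neq0$) with constant Gauss curvature $K$. 1. If the generating curve is the graph of a polynomial $f(s)=\sum_{n=0}^m a_n s^n$, then $m\le 1$. If the axis is timelike, the surface is the Lorentzian cylinder $x^2+y^2=r^2$ ($K=0$) or the surface $X(s,t)=(s\cos t,\ s\sin t,\ \pm s+a_0+ht)$ with $K=1/h^2$; if the axis is spacelike, the surface is $X(s,t)=(ht,\ (\pm s+a_0)\sinh t+s\cosh t,\ (\pm s+a_0)\cosh t+s\sinh t)$, $a_0\neq0$ ($K=0$); if the axis is lightlike, the surface is the parabolic null cylinder ($K=0$). 2. If the generating curve is a (Lorentzian) circle, then the axis is spacelike, $K=0$, the center of the circle lies in the axis, and the surface is one of the hyperbolic cylinders $y^2-z^2=\pm r^2$.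
   Context: $\mathbf{E}_1^3$ is $\mathbb{R}^3$ with the metric $\langle(x,y,z),(x',y',z')\rangle=xx'+yy'-zz'$. A vector $v$ is spacelike if $\langle v,v\rangle>0$ or $v=0$, timelike if $\langle v,v\rangle<0$, lightlike if $\langle v,v\rangle=0$, $v\ne0$; a line is called timelike, spacelike or lightlike according to its direction vector. Helicoidal motions. A helicoidal motion group $G_{L,h}=\{\phi_t : t\in\mathbb{R}\}$ with axis $L$ and pitch $h\neq0$ is, after a change of coordinates, one of the following, and coordinates are always chosen so: - $L=\langle(0,0,1)\rangle$ timelike: $\phi_t(a,b,c)=(a\cos t-b\sin t,\ a\sin t+b\cos t,\ c+ht)$. - $L=\langle(1,0,0)\rangle$ spacelike: $\phi_t(a,b,c)=(a+ht,\ b\cosh t+c\sinh t,\ b\sinh t+c\cosh t)$. - $L=\langle(1,0,1)\rangle$ lightlike: $\phi_t(a,b,c)=\big((1-\tfrac{t^2}{2})a+tb+\tfrac{t^2}{2}c,\ -ta+b+tc,\ -\tfrac{t^2}{2}a+tb+(1+\tfrac{t^2}{2})c\big)+h\big(\tfrac{t^3}{3}-t,\ t^2,\ \tfrac{t^3}{3}+t\big)$. Setting $h=0$ in these formulas gives the group of rotations about $L$. Helicoidal surface and generating curve. A helicoidal surface is one invariant under some $G_{L,h}$, $h\ne0$; it is parametrized (locally) by $X(s,t)=\phi_t(\gamma(s))$, $s\in I\subset\mathbb{R}$, $t\in\mathbb{R}$, where the generating curve $\gamma$ is a planar curve, taken in the plane $y=0$ (timelike axis), $x=0$ (spacelike axis)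 or $x=z$ (lightlike axis). "$\gamma$ is the graph of a polynomial $f$" means: $\gamma(s)=(s,0,f(s))$ (timelike axis), $\gamma(s)=(0,s,f(s))$ (spacelike axis), $\gamma(s)=(f(s),s,f(s))$ (lightlike axis), with $a_m\neq 0$ if $m\ge1$. The straight lines that are not graphs of this form, namely $\gamma(s)=(r,0,s)$ with $r>0$, $\gamma(s)=(0,b,s)$, $\gamma(s)=(s,b,s)$ respectively, are also admitted (and counted as degree $\le 1$). Here $a_0\in\mathbb{R}$ and $r>0$ are constants. Lorentzian circles. A Lorentzian circle in $\mathbf{E}_1^3$ is the orbit of a point $p$ under a group of rotations of $\mathbf{E}_1^3$ about some axis, where $p$ is not on that axis (otherwise the orbit is a point). This axis of rotation need not be the axis of the helicoidal surface. For example, orbits about the timelike axis $\langle(0,0,1)\rangle$ are Euclidean circles in planes $z=c$; orbits of $(a,b,c)$ about the spacelike axis $\langle(1,0,0)\rangle$ lie in the plane $x=a$ and are (branches of) hyperbolas $y^2-z^2=b^2-c^2$ if $b^2\neq c^2$, and lie on the lightlike straight lines $y=\pm z$ if $b^2=c^2$; the orbit of $(a,0,c)$, $a\ne c$, about the lightlike axis $\langle(1,0,1)\rangle$ is the parabola $(a,0,c)+(c-a)t(0,1,0)+\tfrac{c-a}{2}t^2(1,0,1)$. The center of a hyperbola $(y-y_0)^2-(z-z_0)^2=\pm r^2$ in the plane $x=0$ is $(0,y_0,z_0)$. Curvature. The surface is non-degenerate: its induced metric is everywhere Riemannian (spacelike surface) or everywhere Lorentzian (timelike surface). Let $N$ be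 a (local) unit normal, $\epsilon=\langle N,N\rangle$ ($\epsilon=-1$ if spacelike, $\epsilon=1$ if timelike), and $A=-dN$. The Gauss curvature is $K=\epsilon\det(A)$. The parabolic null cylinder is the helicoidal surface with lightlike axis generated by $\gamma(s)=(s,b,s)$, that is, $\big(s+bt+h(\tfrac{t^3}{3}-t),\ b+ht^2,\ s+bt+h(\tfrac{t^3}{3}+t)\big)$, $b\in\mathbb{R}$.
   Formalization: In item 2 the circle is assumed not to lie in a straight line: orbits on lightlike lines count as circles by definition, but the claim fails for them, e.g. timelike axis with generating curve (s,0,s), s>0, has K=1/h^2. *)

theory Defs
  imports "HOL-Analysis.Analysis" "HOL-Computational_Algebra.Polynomial"
begin

section \<open>Minkowski space and its isometries\<close>

definition lorentz_inner :: "real ^ 3 \<Rightarrow> real ^ 3 \<Rightarrow> real" where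
  "lorentz_inner u v = u $ 1 * v $ 1 + u $ 2 * v $ 2 - u $ 3 * v $ 3"

definition lorentz_isometry :: "(real ^ 3 \<Rightarrow> real ^ 3) \<Rightarrow> bool" where
  "lorentz_isometry T \<longleftrightarrow>
     (\<exists>A b. linear A \<and> (\<forall>v w. lorentz_inner (A v) (A w) = lorentz_inner v w) \<and>
            T = (\<lambda>p. A p + b))"

section \<open>Helicoidal motions and Lorentzian circles\<close>

datatype axis_type = Timelike | Spacelike | Lightlike

fun axis_dir :: "axis_type \<Rightarrow> real ^ 3" where
  "axis_dir Timelike = vector [0, 0, 1]"
| "axis_dir Spacelike = vector [1, 0, 0]"
| "axis_dir Lightlike = vector [1, 0, 1]"

definition axis_line :: "axis_type \<Rightarrow> (real ^ 3) set" where
  "axis_line ax = span {axis_dir ax}"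

text \<open>The map \<open>\<phi>\<^sub>t\<close> with pitch \<open>h\<close>; for \<open>h = 0\<close> it is a rotation about \<open>axis_line ax\<close>.\<close>

fun helicoidal_motion :: "axis_type \<Rightarrow> real \<Rightarrow> real \<Rightarrow> real ^ 3 \<Rightarrow> real ^ 3" where
  "helicoidal_motion Timelike h t p =
     vector [p $ 1 * cos t - p $ 2 * sin t, p $ 1 * sin t + p $ 2 * cos t, p $ 3 + h * t]"
| "helicoidal_motion Spacelike h t p =
     vector [p $ 1 + h * t, p $ 2 * cosh t + p $ 3 * sinh t, p $ 2 * sinh t + p $ 3 * cosh t]"
| "helicoidal_motion Lightlike h t p =
     vector [(1 - t\<^sup>2 / 2) * p $ 1 + t * p $ 2 + t\<^sup>2 / 2 * p $ 3,
             - t * p $ 1 + p $ 2 + t * p $ 3,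
             - (t\<^sup>2 / 2) * p $ 1 + t * p $ 2 + (1 + t\<^sup>2 / 2) * p $ 3]
     + h *\<^sub>R vector [t ^ 3 / 3 - t, t\<^sup>2, t ^ 3 / 3 + t]"

text \<open>
  An arbitrary group of rotations is the conjugate of one of the three normal forms by an isometry
  \<open>T\<close>, so its orbits are the \<open>T\<close>-images of the orbits of the normal form. Its axis, the image
  of \<open>axis_line ax\<close>, is an affine line and need not pass through the origin.
  Orbits contained in a lightlike straight line do occur here (for instance, that of
  \<open>(0, 1, 1)\<close> about the spacelike axis).
\<close>

definition lorentz_circle :: "(real ^ 3) set \<Rightarrow> bool" where
  "lorentz_circle C \<longleftrightarrow>
     (\<exists>T ax q. lorentz_isometry T \<and> q \<notin> axis_line ax \<and>
               C = range (\<lambda>t. T (helicoidal_motion ax 0 t q)))"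

text \<open>The hyperbola in the plane \<open>x = 0\<close> with center \<open>c\<close>; \<open>\<sigma> = \<plusminus>1\<close> is the sign in its equation.\<close>

definition hyperbola :: "real ^ 3 \<Rightarrow> real \<Rightarrow> real \<Rightarrow> (real ^ 3) set" where
  "hyperbola c \<sigma> r =
     {p. p $ 1 = 0 \<and> c $ 1 = 0 \<and> (p $ 2 - c $ 2)\<^sup>2 - (p $ 3 - c $ 3)\<^sup>2 = \<sigma> * r\<^sup>2}"

section \<open>Helicoidal surfaces and their generating curves\<close>

fun generating_plane :: "axis_type \<Rightarrow> (real ^ 3) set" where
  "generating_plane Timelike = {p. p $ 2 = 0}"
| "generating_plane Spacelike = {p. p $ 1 = 0}"
| "generating_plane Lightlike = {p. p $ 1 = p $ 3}"

fun graph_curve :: "axis_type \<Rightarrow> (real \<Rightarrow> real) \<Rightarrow> real \<Rightarrow> real ^ 3" where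
  "graph_curve Timelike f s = vector [s, 0, f s]"
| "graph_curve Spacelike f s = vector [0, s, f s]"
| "graph_curve Lightlike f s = vector [f s, s, f s]"

text \<open>The straight lines of the generating plane that are not graphs.\<close>

fun vertical_line :: "axis_type \<Rightarrow> real \<Rightarrow> real \<Rightarrow> real ^ 3" where
  "vertical_line Timelike b s = vector [b, 0, s]"
| "vertical_line Spacelike b s = vector [0, b, s]"
| "vertical_line Lightlike b s = vector [s, b, s]"

definition polynomial_graph :: "axis_type \<Rightarrow> real set \<Rightarrow> (real \<Rightarrow> real ^ 3) \<Rightarrow> real poly \<Rightarrow> bool" where
  "polynomial_graph ax I \<gamma> f \<longleftrightarrow> (\<forall>s\<in>I. \<gamma> s = graph_curve ax (poly f) s)"

definition non_graph_line :: "axis_type \<Rightarrow> real set \<Rightarrow> (real \<Rightarrow> real ^ 3) \<Rightarrow> bool" where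
  "non_graph_line ax I \<gamma> \<longleftrightarrow>
     (\<exists>b. (ax = Timelike \<longrightarrow> b > 0) \<and> (\<forall>s\<in>I. \<gamma> s = vertical_line ax b s))"

definition C2_curve_on :: "real set \<Rightarrow> (real \<Rightarrow> real ^ 3) \<Rightarrow> bool" where
  "C2_curve_on I \<gamma> \<longleftrightarrow>
     (\<exists>\<gamma>' \<gamma>''. (\<forall>s\<in>I. (\<gamma> has_vector_derivative \<gamma>' s) (at s) \<and>
                     (\<gamma>' has_vector_derivative \<gamma>'' s) (at s)) \<and>
              continuous_on I \<gamma>'')"

definition generating_curve :: "axis_type \<Rightarrow> real set \<Rightarrow> (real \<Rightarrow> real ^ 3) \<Rightarrow> bool" where
  "generating_curve ax I \<gamma> \<longleftrightarrow>
     open I \<and> is_interval I \<and> I \<noteq> {} \<and> C2_curve_on I \<gamma> \<and> \<gamma> ` I \<subseteq> generating_plane ax"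

definition helicoidal_param ::
  "axis_type \<Rightarrow> real \<Rightarrow> (real \<Rightarrow> real ^ 3) \<Rightarrow> real \<Rightarrow> real \<Rightarrow> real ^ 3" where
  "helicoidal_param ax h \<gamma> s t = helicoidal_motion ax h t (\<gamma> s)"

definition helicoidal_surface ::
  "axis_type \<Rightarrow> real \<Rightarrow> (real \<Rightarrow> real ^ 3) \<Rightarrow> real set \<Rightarrow> (real ^ 3) set" where
  "helicoidal_surface ax h \<gamma> I = (\<lambda>(s, t). helicoidal_param ax h \<gamma> s t) ` (I \<times> UNIV)"

definition lorentzian_cylinder :: "real \<Rightarrow> (real ^ 3) set" where
  "lorentzian_cylinder r = {p. (p $ 1)\<^sup>2 + (p $ 2)\<^sup>2 = r\<^sup>2}"

definition hyperbolic_cylinder :: "real \<Rightarrow> real \<Rightarrow> (real ^ 3) set" where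
  "hyperbolic_cylinder \<sigma> r = {p. (p $ 2)\<^sup>2 - (p $ 3)\<^sup>2 = \<sigma> * r\<^sup>2}"

text \<open>
  A surface is parametrized only locally (by \<open>I \<times> \<real>\<close>), so "the surface is \<open>M\<close>" for an
  \<open>M\<close> given by an equation means that it is an open part of \<open>M\<close>.
\<close>

definition open_part_of :: "(real ^ 3) set \<Rightarrow> (real ^ 3) set \<Rightarrow> bool" where
  "open_part_of S M \<longleftrightarrow> openin (top_of_set M) S"

section \<open>Causal character and Gauss curvature\<close>

definition d1 :: "(real \<Rightarrow> real \<Rightarrow> real ^ 3) \<Rightarrow> real \<Rightarrow> real \<Rightarrow> real ^ 3" where
  "d1 X s t = vector_derivative (\<lambda>u. X u t) (at s)"

definition d2 :: "(real \<Rightarrow> real \<Rightarrow> real ^ 3) \<Rightarrow> real \<Rightarrow> real \<Rightarrow> real ^ 3" where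
  "d2 X s t = vector_derivative (\<lambda>u. X s u) (at t)"

text \<open>The induced metric is positive definite, respectively of signature \<open>(1, 1)\<close>.\<close>

definition riemannian_at :: "(real \<Rightarrow> real \<Rightarrow> real ^ 3) \<Rightarrow> real \<Rightarrow> real \<Rightarrow> bool" where
  "riemannian_at X s t \<longleftrightarrow>
     (\<forall>a b. (a, b) \<noteq> (0, 0) \<longrightarrow>
        (let v = a *\<^sub>R d1 X s t + b *\<^sub>R d2 X s t in lorentz_inner v v > 0))"

definition lorentzian_at :: "(real \<Rightarrow> real \<Rightarrow> real ^ 3) \<Rightarrow> real \<Rightarrow> real \<Rightarrow> bool" where
  "lorentzian_at X s t \<longleftrightarrow>
     (\<exists>v\<in>span {d1 X s t, d2 X s t}. \<exists>w\<in>span {d1 X s t, d2 X s t}.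
        lorentz_inner v v = 1 \<and> lorentz_inner w w = - 1 \<and> lorentz_inner v w = 0)"

definition non_degenerate_on :: "real set \<Rightarrow> (real \<Rightarrow> real \<Rightarrow> real ^ 3) \<Rightarrow> bool" where
  "non_degenerate_on I X \<longleftrightarrow>
     (\<forall>s\<in>I. \<forall>t. riemannian_at X s t) \<or> (\<forall>s\<in>I. \<forall>t. lorentzian_at X s t)"

definition unit_normal_on ::
  "(real \<times> real) set \<Rightarrow> (real \<Rightarrow> real \<Rightarrow> real ^ 3) \<Rightarrow> (real \<Rightarrow> real \<Rightarrow> real ^ 3) \<Rightarrow> bool" where
  "unit_normal_on U X N \<longleftrightarrow>
     (\<lambda>(s, t). N s t) differentiable_on U \<and>
     (\<forall>(s, t)\<in>U. lorentz_inner (N s t) (d1 X s t) = 0 \<and>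
                 lorentz_inner (N s t) (d2 X s t) = 0 \<and>
                 \<bar>lorentz_inner (N s t) (N s t)\<bar> = 1)"

text \<open>
  The matrix \<open>A\<close> represents the endomorphism \<open>-dN\<close> of the tangent plane in the basis
  \<open>d1 X s t\<close>, \<open>d2 X s t\<close>: its columns hold the coordinates of \<open>-d1 N s t\<close> and \<open>-d2 N s t\<close>.
  A local unit normal is unique up to sign, and \<open>K\<close> does not depend on that sign.
\<close>

definition has_gauss_curvature ::
  "(real \<Rightarrow> real \<Rightarrow> real ^ 3) \<Rightarrow> real \<Rightarrow> real \<Rightarrow> real \<Rightarrow> bool" where
  "has_gauss_curvature X s t K \<longleftrightarrow>
     (\<exists>U N. \<exists>A :: real ^ 2 ^ 2.
        open U \<and> (s, t) \<in> U \<and> unit_normal_on U X N \<and>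
        - d1 N s t = A $ 1 $ 1 *\<^sub>R d1 X s t + A $ 2 $ 1 *\<^sub>R d2 X s t \<and>
        - d2 N s t = A $ 1 $ 2 *\<^sub>R d1 X s t + A $ 2 $ 2 *\<^sub>R d2 X s t \<and>
        K = lorentz_inner (N s t) (N s t) * det A)"

end

theory Submission
  imports Defs
begin

text \<open>
  Write \<open>X\<close> for the parametrization and \<open>D\<close> for the Gram determinant of \<open>X\<^sub>s, X\<^sub>t\<close>, which does not
  vanish on a non-degenerate surface. Differentiating the orthogonality relations of the unit normal
  turns the definition of the Gauss curvature into
  \<open>K D\<^sup>2 = det (X\<^sub>s, X\<^sub>t, X\<^sub>s\<^sub>t)\<^sup>2 - det (X\<^sub>s, X\<^sub>t, X\<^sub>s\<^sub>s) det (X\<^sub>s, X\<^sub>t, X\<^sub>t\<^sub>t)\<close>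
  (\<open>gauss_curvature_equation\<close>), in which the normal no longer occurs. The helicoidal motions are
  isometries, so the equation at \<open>t = 0\<close> carries all the information: for each type of axis
  it is a second order differential equation for the two coordinates of the generating curve.

  If the curve is the graph of a polynomial \<open>f\<close>, this becomes an identity between polynomials, since
  it holds at infinitely many points. For \<open>deg f \<ge> 2\<close> the left-hand side, if \<open>K \<noteq> 0\<close>, has a larger
  degree than the right-hand side, and \<open>K = 0\<close> is impossible because the right-hand side is not zero;
  for \<open>deg f \<le> 1\<close> the identity determines \<open>K\<close> and the slope, or is contradictory (the three lemmas on
  polynomial identities). The
  lines that are not graphs are treated by substitution.

  A Lorentzian circle that is not contained in a line is an ellipse, a branch of a hyperbola, or a
  parabola, with a parametrization that is trigonometric, hyperbolic, or quadratic
  (\<open>lorentz_circle_cases\<close>). A linear functional that vanishes at infinitely many of its points vanishes on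
  all of it, so a circle that contains the generating curve lies in the generating plane
  (\<open>lorentz_circle_in_generating_plane\<close>). The metric of that plane then decides the shape. The plane
  of a lightlike axis has a degenerate metric and contains only parabolas, which are graphs of polynomials
  and already excluded. The other two planes are Lorentzian and contain only hyperbolas. On a
  hyperbola the derivatives can be eliminated from the curvature equation, which leaves an
  algebraic relation along the curve; it is contradictory for a timelike axis
  (\<open>timelike_not_hyperbola\<close>) and forces a centre on the axis and \<open>K = 0\<close> for a spacelike axis
  (\<open>spacelike_hyperbola_flat_centered\<close>).

  What remains is topological: that the surface is open in the quadric that contains it and, if the
  generating curve is the whole circle, also closed in it and connected, hence a component.
\<close>

section \<open>Calculus in coordinates\<close>

lemma has_vector_derivative_vector3:
  assumes "(f has_real_derivative f') (at x within S)" "(g has_real_derivative g') (at x within S)"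
    "(k has_real_derivative k') (at x within S)"
  shows "((\<lambda>t. vector [f t, g t, k t] :: real ^ 3) has_vector_derivative vector [f', g', k']) (at x within S)"
proof -
  have split: "(vector [a, b, c] :: real ^ 3) =
      a *\<^sub>R vector [1, 0, 0] + b *\<^sub>R vector [0, 1, 0] + c *\<^sub>R vector [0, 0, 1]" for a b c
    by (simp add: vec_eq_iff forall_3)
  show ?thesis
    using assms
    by (subst (1 2) split)
      (auto intro!: has_vector_derivative_add has_vector_derivative_scaleR[THEN has_vector_derivative_eq_rhs]
        has_vector_derivative_const)
qed

lemma has_real_derivative_vec_nth:
  assumes "(\<gamma> has_vector_derivative (v :: real ^ 3)) F"
  shows "((\<lambda>s. \<gamma> s $ i) has_real_derivative v $ i) F"
  using bounded_linear.has_vector_derivative[OF bounded_linear_vec_nth assms]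
  by (simp add: has_real_derivative_iff_has_vector_derivative)

lemma has_real_derivative_lorentz_inner:
  assumes "(f has_vector_derivative f') (at s)" "(g has_vector_derivative g') (at s)"
  shows "((\<lambda>u. lorentz_inner (f u) (g u)) has_real_derivative
           lorentz_inner f' (g s) + lorentz_inner (f s) g') (at s)"
  unfolding lorentz_inner_def
  by (auto intro!: derivative_eq_intros has_real_derivative_vec_nth assms simp: algebra_simps)

lemma lorentz_inner_commute: "lorentz_inner u v = lorentz_inner v u"
  by (simp add: lorentz_inner_def algebra_simps)

lemma lorentz_inner_add_left: "lorentz_inner (u + v) w = lorentz_inner u w + lorentz_inner v w"
  and lorentz_inner_add_right: "lorentz_inner w (u + v) = lorentz_inner w u + lorentz_inner w v"
  and lorentz_inner_scaleR_left: "lorentz_inner (a *\<^sub>R u) w = a * lorentz_inner u w"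
  and lorentz_inner_scaleR_right: "lorentz_inner w (a *\<^sub>R u) = a * lorentz_inner w u"
  and lorentz_inner_minus_left: "lorentz_inner (- u) w = - lorentz_inner u w"
  and lorentz_inner_minus_right: "lorentz_inner w (- u) = - lorentz_inner w u"
  and lorentz_inner_diff_left: "lorentz_inner (u - v) w = lorentz_inner u w - lorentz_inner v w"
  and lorentz_inner_diff_right: "lorentz_inner w (u - v) = lorentz_inner w u - lorentz_inner w v"
  by (simp_all add: lorentz_inner_def algebra_simps)

lemmas lorentz_inner_simps =
  lorentz_inner_add_left lorentz_inner_add_right lorentz_inner_scaleR_left lorentz_inner_scaleR_right
  lorentz_inner_minus_left lorentz_inner_minus_right lorentz_inner_diff_left lorentz_inner_diff_right

section \<open>The Gauss curvature of a parametrized surface\<close>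

definition triple_product :: "real ^ 3 \<Rightarrow> real ^ 3 \<Rightarrow> real ^ 3 \<Rightarrow> real" where
  "triple_product u v w =
     (u $ 2 * v $ 3 - u $ 3 * v $ 2) * w $ 1 + (u $ 3 * v $ 1 - u $ 1 * v $ 3) * w $ 2
     + (u $ 1 * v $ 2 - u $ 2 * v $ 1) * w $ 3"

definition gram :: "real ^ 3 \<Rightarrow> real ^ 3 \<Rightarrow> real" where
  "gram u v = lorentz_inner u u * lorentz_inner v v - (lorentz_inner u v)\<^sup>2"

text \<open>
  A vector \<open>n\<close> that is Lorentz orthogonal to \<open>u\<close> and \<open>v\<close> becomes, after the sign of its third
  coordinate is changed, a multiple of the Euclidean cross product \<open>c\<close> of \<open>u\<close> and \<open>v\<close>; and
  \<open>\<langle>c, c\<rangle>\<close> is minus the Gram determinant, the sign coming from the determinant of the metric.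
\<close>

lemma triple_product_normal:
  assumes "lorentz_inner n u = 0" "lorentz_inner n v = 0"
  shows "triple_product u v n * triple_product u v w = - lorentz_inner n w * gram u v"
proof -
  define c1 c2 c3 where "c1 = u $ 2 * v $ 3 - u $ 3 * v $ 2" and "c2 = u $ 3 * v $ 1 - u $ 1 * v $ 3"
    and "c3 = u $ 1 * v $ 2 - u $ 2 * v $ 1"
  define n1 n2 n3 where "n1 = n $ 1" and "n2 = n $ 2" and "n3 = - n $ 3"
  define w1 w2 w3 where "w1 = w $ 1" and "w2 = w $ 2" and "w3 = w $ 3"
  have gram: "c1 * c1 + c2 * c2 - c3 * c3 = - gram u v"
    unfolding c1_def c2_def c3_def gram_def lorentz_inner_def power2_eq_square
    by (simp add: algebra_simps)
  have orth: "n1 * u $ 1 + n2 * u $ 2 + n3 * u $ 3 = 0" "n1 * v $ 1 + n2 * v $ 2 + n3 * v $ 3 = 0"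
    using assms unfolding lorentz_inner_def n1_def n2_def n3_def by auto
  have par: "n1 * c2 = n2 * c1" "n1 * c3 = n3 * c1" "n2 * c3 = n3 * c2"
    using orth unfolding c1_def c2_def c3_def by algebra+
  have "(c1 * n1 + c2 * n2 - c3 * n3) * (c1 * w1 + c2 * w2 + c3 * w3)
      = (c1 * c1 + c2 * c2 - c3 * c3) * (n1 * w1 + n2 * w2 + n3 * w3)"
    using par by algebra
  moreover have "triple_product u v n = c1 * n1 + c2 * n2 - c3 * n3"
    "triple_product u v w = c1 * w1 + c2 * w2 + c3 * w3"
    "lorentz_inner n w = n1 * w1 + n2 * w2 + n3 * w3"
    by (simp_all add: triple_product_def lorentz_inner_def
        c1_def c2_def c3_def n1_def n2_def n3_def w1_def w2_def w3_def)
  ultimately show ?thesis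
    using gram by (metis minus_mult_commute mult.commute)
qed

lemma derivative_0_if_0_on_open:
  assumes "(f has_real_derivative d) (at (s::real))" "open S" "s \<in> S" "\<And>u. u \<in> S \<Longrightarrow> f u = 0"
  shows "d = 0"
proof -
  have "((\<lambda>u. 0) has_real_derivative d) (at s)"
    by (rule has_field_derivative_transform_within_open[OF assms(1,2,3)]) (rule assms(4))
  then show ?thesis using DERIV_unique DERIV_const by blast
qed

text \<open>
  The coefficients of the second fundamental form are \<open>e, f, g = \<langle>N, X\<^sub>s\<^sub>s\<rangle>, \<langle>N, X\<^sub>s\<^sub>t\<rangle>, \<langle>N, X\<^sub>t\<^sub>t\<rangle>\<close>, and the matrix
  of \<open>- dN\<close> multiplied by the Gram matrix has these entries, so \<open>e g - f\<^sup>2 = D det A\<close>. Replacing \<open>N\<close>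
  by the cross product of the tangent vectors rescales \<open>e, f, g\<close> by the factor \<open>- D / \<delta>\<close>,
  where \<open>\<delta> = det (X\<^sub>s, X\<^sub>t, N)\<close> satisfies \<open>\<delta>\<^sup>2 = - \<epsilon> D\<close>; this removes the normal from the formula.
\<close>

lemma gauss_curvature_equation:
  assumes K: "has_gauss_curvature X s t K"
    and ss: "((\<lambda>u. d1 X u t) has_vector_derivative Xss) (at s)"
    and ts: "((\<lambda>v. d1 X s v) has_vector_derivative Xst) (at t)"
    and st: "((\<lambda>u. d2 X u t) has_vector_derivative Xst) (at s)"
    and tt: "((\<lambda>v. d2 X s v) has_vector_derivative Xtt) (at t)"
    and D: "gram (d1 X s t) (d2 X s t) \<noteq> 0"
  shows "K * (gram (d1 X s t) (d2 X s t))\<^sup>2 =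
    (triple_product (d1 X s t) (d2 X s t) Xst)\<^sup>2
    - triple_product (d1 X s t) (d2 X s t) Xss * triple_product (d1 X s t) (d2 X s t) Xtt"
proof -
  obtain U N and A :: "real ^ 2 ^ 2" where U: "open U" "(s, t) \<in> U" and N: "unit_normal_on U X N"
    and A1: "- d1 N s t = A $ 1 $ 1 *\<^sub>R d1 X s t + A $ 2 $ 1 *\<^sub>R d2 X s t"
    and A2: "- d2 N s t = A $ 1 $ 2 *\<^sub>R d1 X s t + A $ 2 $ 2 *\<^sub>R d2 X s t"
    and Keq: "K = lorentz_inner (N s t) (N s t) * det A"
    using K unfolding has_gauss_curvature_def by blast
  let ?u = "d1 X s t" and ?v = "d2 X s t" and ?n = "N s t"
  have orth: "lorentz_inner (N a b) (d1 X a b) = 0" "lorentz_inner (N a b) (d2 X a b) = 0"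
    and unit: "\<bar>lorentz_inner (N a b) (N a b)\<bar> = 1" if "(a, b) \<in> U" for a b
    using N that unfolding unit_normal_on_def by auto
  obtain L where L: "((\<lambda>(a, b). N a b) has_derivative L) (at (s, t))"
    using N U unfolding unit_normal_on_def differentiable_on_def differentiable_def
    by (metis at_within_open)
  have linL: "linear L" using L has_derivative_linear by blast
  have Ns: "((\<lambda>a. N a t) has_vector_derivative L (1, 0)) (at s)"
  proof -
    have i: "((\<lambda>a. (a, t)) has_derivative (\<lambda>c. (c, 0))) (at s)"
      by (auto intro!: derivative_eq_intros)
    have "((\<lambda>a. N a t) has_derivative (\<lambda>c. L (c, 0))) (at s)"
      using has_derivative_compose[OF i L] by simp
    moreover have "(\<lambda>c. L (c, 0)) = (\<lambda>c. c *\<^sub>R L (1, 0))"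
    proof
      fix c :: real
      have "(c, 0) = c *\<^sub>R ((1, 0) :: real \<times> real)" by simp
      then show "L (c, 0) = c *\<^sub>R L (1, 0)" by (simp only: linear_scale[OF linL])
    qed
    ultimately show ?thesis unfolding has_vector_derivative_def by (rule back_subst)
  qed
  have Nt: "((\<lambda>b. N s b) has_vector_derivative L (0, 1)) (at t)"
  proof -
    have i: "((\<lambda>b. (s, b)) has_derivative (\<lambda>c. (0, c))) (at t)"
      by (auto intro!: derivative_eq_intros)
    have "((\<lambda>b. N s b) has_derivative (\<lambda>c. L (0, c))) (at t)"
      using has_derivative_compose[OF i L] by simp
    moreover have "(\<lambda>c. L (0, c)) = (\<lambda>c. c *\<^sub>R L (0, 1))"
    proof
      fix c :: real
      have "(0, c) = c *\<^sub>R ((0, 1) :: real \<times> real)" by simp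
      then show "L (0, c) = c *\<^sub>R L (0, 1)" by (simp only: linear_scale[OF linL])
    qed
    ultimately show ?thesis unfolding has_vector_derivative_def by (rule back_subst)
  qed
  have d1N: "d1 N s t = L (1, 0)" and d2N: "d2 N s t = L (0, 1)"
    unfolding d1_def d2_def using vector_derivative_at[OF Ns] vector_derivative_at[OF Nt] by auto
  obtain P where P: "open P" "s \<in> P" "\<And>a. a \<in> P \<Longrightarrow> (a, t) \<in> U"
  proof
    show "open ((\<lambda>a. (a, t)) -` U)" by (rule open_vimage[OF U(1)]) (auto intro!: continuous_intros)
  qed (use U in auto)
  obtain Q where Q: "open Q" "t \<in> Q" "\<And>b. b \<in> Q \<Longrightarrow> (s, b) \<in> U"
  proof
    show "open ((\<lambda>b. (s, b)) -` U)" by (rule open_vimage[OF U(1)]) (auto intro!: continuous_intros)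
  qed (use U in auto)
  have e1: "lorentz_inner (d1 N s t) ?u + lorentz_inner ?n Xss = 0"
    using derivative_0_if_0_on_open[OF has_real_derivative_lorentz_inner[OF Ns ss] P(1,2)]
      P(3) orth d1N by auto
  have e2: "lorentz_inner (d1 N s t) ?v + lorentz_inner ?n Xst = 0"
    using derivative_0_if_0_on_open[OF has_real_derivative_lorentz_inner[OF Ns st] P(1,2)]
      P(3) orth d1N by auto
  have e3: "lorentz_inner (d2 N s t) ?u + lorentz_inner ?n Xst = 0"
    using derivative_0_if_0_on_open[OF has_real_derivative_lorentz_inner[OF Nt ts] Q(1,2)]
      Q(3) orth d2N by auto
  have e4: "lorentz_inner (d2 N s t) ?v + lorentz_inner ?n Xtt = 0"
    using derivative_0_if_0_on_open[OF has_real_derivative_lorentz_inner[OF Nt tt] Q(1,2)]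
      Q(3) orth d2N by auto
  define E F G where "E = lorentz_inner ?u ?u" and "F = lorentz_inner ?u ?v" and "G = lorentz_inner ?v ?v"
  define a b c d where "a = A $ 1 $ 1" and "b = A $ 1 $ 2" and "c = A $ 2 $ 1" and "d = A $ 2 $ 2"
  define e f g where "e = lorentz_inner ?n Xss" and "f = lorentz_inner ?n Xst" and "g = lorentz_inner ?n Xtt"
  have n1: "d1 N s t = - (a *\<^sub>R ?u + c *\<^sub>R ?v)" and n2: "d2 N s t = - (b *\<^sub>R ?u + d *\<^sub>R ?v)"
    using A1 A2 unfolding a_def b_def c_def d_def by (metis minus_minus)+
  \<comment> \<open>the two expressions for \<open>f\<close> come from \<open>\<langle>N, X\<^sub>s\<rangle> = 0\<close> and from \<open>\<langle>N, X\<^sub>t\<rangle> = 0\<close>\<close>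
  have weingarten: "e = a * E + c * F" "f = a * F + c * G" "f = b * E + d * F" "g = b * F + d * G"
    using e1 e2 e3 e4 unfolding n1 n2 E_def F_def G_def e_def f_def g_def
    by (auto simp: lorentz_inner_simps lorentz_inner_commute[of ?v ?u])
  define \<epsilon> where "\<epsilon> = lorentz_inner ?n ?n"
  define \<delta> where "\<delta> = triple_product ?u ?v ?n"
  define e' f' g' where "e' = triple_product ?u ?v Xss" and "f' = triple_product ?u ?v Xst"
    and "g' = triple_product ?u ?v Xtt"
  define D where "D = gram ?u ?v"
  have D': "D = E * G - F\<^sup>2" unfolding D_def gram_def E_def F_def G_def by simp
  have "D \<noteq> 0" using D D_def by simp
  have eps: "\<epsilon>\<^sup>2 = 1"
    using unit[OF U(2)] unfolding \<epsilon>_def by (simp add: abs_square_eq_1)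
  note o = orth[OF U(2)]
  have d0: "\<delta> * \<delta> = - \<epsilon> * D" "\<delta> * e' = - e * D" "\<delta> * f' = - f * D" "\<delta> * g' = - g * D"
    unfolding \<delta>_def \<epsilon>_def D_def e_def f_def g_def e'_def f'_def g'_def
    using triple_product_normal[OF o] by blast+
  have "D\<^sup>2 * (e * g - f\<^sup>2) = (\<delta> * \<delta>) * (e' * g' - f'\<^sup>2)"
    using d0(2,3,4) by algebra
  then have "D * (D * (e * g - f\<^sup>2)) = D * (- \<epsilon> * (e' * g' - f'\<^sup>2))"
    using d0(1) by (simp add: algebra_simps power2_eq_square)
  then have II: "D * (e * g - f\<^sup>2) = - \<epsilon> * (e' * g' - f'\<^sup>2)"
    using \<open>D \<noteq> 0\<close> mult_left_cancel by blast
  have "e * g - f * f = (a * d - b * c) * D"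
    unfolding weingarten(1,4) D' using weingarten(2,3) by algebra
  then have "\<epsilon> * (a * d - b * c) * D\<^sup>2 = \<epsilon> * (D * (e * g - f\<^sup>2))"
    unfolding power2_eq_square by simp
  then have "K * D\<^sup>2 = \<epsilon> * (D * (e * g - f\<^sup>2))"
    unfolding Keq \<epsilon>_def det_2 a_def b_def c_def d_def .
  also have "\<dots> = - (\<epsilon>\<^sup>2) * (e' * g' - f'\<^sup>2)" unfolding II by algebra
  finally show ?thesis unfolding eps D_def e'_def f'_def g'_def by simp
qed

lemma non_degenerate_gram:
  assumes "non_degenerate_on I X" "s \<in> I"
  shows "gram (d1 X s t) (d2 X s t) \<noteq> 0"
proof -
  let ?u = "d1 X s t" and ?v = "d2 X s t"
  consider "riemannian_at X s t" | "lorentzian_at X s t"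
    using assms unfolding non_degenerate_on_def by blast
  then show ?thesis
  proof cases
    case 1
    have pos: "lorentz_inner (a *\<^sub>R ?u + b *\<^sub>R ?v) (a *\<^sub>R ?u + b *\<^sub>R ?v) > 0" if "(a, b) \<noteq> (0, 0)" for a b
      using 1 that unfolding riemannian_at_def Let_def by blast
    have E: "lorentz_inner ?u ?u > 0" using pos[of 1 0] by simp
    \<comment> \<open>a multiple of the component of \<open>X\<^sub>t\<close> orthogonal to \<open>X\<^sub>s\<close>\<close>
    let ?a = "- lorentz_inner ?u ?v" and ?b = "lorentz_inner ?u ?u"
    have "lorentz_inner (?a *\<^sub>R ?u + ?b *\<^sub>R ?v) (?a *\<^sub>R ?u + ?b *\<^sub>R ?v) = ?b * gram ?u ?v"
      unfolding gram_def
      by (simp add: lorentz_inner_simps lorentz_inner_commute[of ?v ?u] algebra_simps power2_eq_square)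
    with pos[of ?a ?b] E show ?thesis by auto
  next
    case 2
    then obtain p q where pq: "p \<in> span {?u, ?v}" "q \<in> span {?u, ?v}"
      and l: "lorentz_inner p p = 1" "lorentz_inner q q = - 1" "lorentz_inner p q = 0"
      unfolding lorentzian_at_def by blast
    have "\<exists>a b. p = a *\<^sub>R ?u + b *\<^sub>R ?v" if "p \<in> span {?u, ?v}" for p
      using that by (auto simp: span_breakdown_eq span_singleton algebra_simps) blast
    then obtain a b c d where p: "p = a *\<^sub>R ?u + b *\<^sub>R ?v" and q: "q = c *\<^sub>R ?u + d *\<^sub>R ?v"
      using pq by metis
    \<comment> \<open>change of basis; the Gram determinant of the orthonormal pair is \<open>- 1\<close>\<close>
    have "gram p q = (a * d - b * c)\<^sup>2 * gram ?u ?v"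
      unfolding p q gram_def
      by (simp add: lorentz_inner_simps lorentz_inner_commute[of ?v ?u] algebra_simps power2_eq_square)
    moreover have "gram p q = - 1" using l by (simp add: gram_def)
    ultimately show ?thesis by auto
  qed
qed

section \<open>The curvature equation of a generating curve\<close>

fun helicoidal_velocity :: "axis_type \<Rightarrow> real \<Rightarrow> real ^ 3 \<Rightarrow> real ^ 3" where
  "helicoidal_velocity Timelike h p = vector [- p $ 2, p $ 1, h]"
| "helicoidal_velocity Spacelike h p = vector [h, p $ 3, p $ 2]"
| "helicoidal_velocity Lightlike h p = vector [p $ 2 - h, p $ 3 - p $ 1, p $ 2 + h]"

lemma helicoidal_motion_0 [simp]: "helicoidal_motion ax h 0 p = p"
  by (cases ax) (simp_all add: vec_eq_iff forall_3)

lemma helicoidal_motion_Lightlike_vector: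
  "helicoidal_motion Lightlike h t p =
     vector [(1 - t\<^sup>2 / 2) * p $ 1 + t * p $ 2 + t\<^sup>2 / 2 * p $ 3 + h * (t ^ 3 / 3 - t),
             - t * p $ 1 + p $ 2 + t * p $ 3 + h * t\<^sup>2,
             - (t\<^sup>2 / 2) * p $ 1 + t * p $ 2 + (1 + t\<^sup>2 / 2) * p $ 3 + h * (t ^ 3 / 3 + t)]"
  by (simp add: vec_eq_iff forall_3)

text \<open>
  The motions form a one-parameter group, so the velocity at time \<open>t\<close> is the initial velocity
  carried along by the linear part of the motion, which is the motion of pitch \<open>0\<close>.
\<close>

lemma has_vector_derivative_helicoidal_motion_time:
  "((\<lambda>t. helicoidal_motion ax h t p) has_vector_derivative
      helicoidal_motion ax 0 t (helicoidal_velocity ax h p)) (at t)"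
proof (cases ax)
  case Timelike
  show ?thesis unfolding Timelike helicoidal_motion.simps
    by (rule has_vector_derivative_eq_rhs[OF has_vector_derivative_vector3])
      (auto intro!: derivative_eq_intros simp: vec_eq_iff forall_3)
next
  case Spacelike
  show ?thesis unfolding Spacelike helicoidal_motion.simps
    by (rule has_vector_derivative_eq_rhs[OF has_vector_derivative_vector3])
      (auto intro!: derivative_eq_intros simp: vec_eq_iff forall_3)
next
  case Lightlike
  show ?thesis unfolding Lightlike helicoidal_motion_Lightlike_vector
    by (rule has_vector_derivative_eq_rhs[OF has_vector_derivative_vector3])
      (auto intro!: derivative_eq_intros simp: vec_eq_iff forall_3 field_simps power2_eq_square)
qed

lemma has_vector_derivative_helicoidal_motion_point:
  assumes "(c has_vector_derivative c') (at s)"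
  shows "((\<lambda>u. helicoidal_motion ax h t (c u)) has_vector_derivative helicoidal_motion ax 0 t c') (at s)"
proof (cases ax)
  case Timelike
  show ?thesis unfolding Timelike helicoidal_motion.simps
    by (rule has_vector_derivative_eq_rhs[OF has_vector_derivative_vector3])
      (auto intro!: derivative_eq_intros has_real_derivative_vec_nth assms simp: vec_eq_iff forall_3)
next
  case Spacelike
  show ?thesis unfolding Spacelike helicoidal_motion.simps
    by (rule has_vector_derivative_eq_rhs[OF has_vector_derivative_vector3])
      (auto intro!: derivative_eq_intros has_real_derivative_vec_nth assms simp: vec_eq_iff forall_3)
next
  case Lightlike
  show ?thesis unfolding Lightlike helicoidal_motion_Lightlike_vector
    by (rule has_vector_derivative_eq_rhs[OF has_vector_derivative_vector3])
      (auto intro!: derivative_eq_intros has_real_derivative_vec_nth assms simp: vec_eq_iff forall_3)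
qed

lemma has_vector_derivative_helicoidal_velocity:
  assumes "(c has_vector_derivative c') (at s)"
  shows "((\<lambda>u. helicoidal_velocity ax h (c u)) has_vector_derivative helicoidal_velocity ax 0 c') (at s)"
  by (cases ax; simp; rule has_vector_derivative_eq_rhs[OF has_vector_derivative_vector3])
     (auto intro!: derivative_eq_intros has_real_derivative_vec_nth assms)

text \<open>
  As the motions are isometries, everything is determined at \<open>t = 0\<close>, where the first derivatives
  of the parametrization are \<open>\<gamma>'\<close> and the velocity of the motion.
\<close>

lemma profile_curvature_equation:
  assumes deriv: "\<And>u. u \<in> I \<Longrightarrow> (\<gamma> has_vector_derivative \<gamma>' u) (at u)"
    and deriv2: "(\<gamma>' has_vector_derivative \<gamma>'') (at s)"
    and I: "open I" "s \<in> I"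
    and nd: "non_degenerate_on I (helicoidal_param ax h \<gamma>)"
    and K: "has_gauss_curvature (helicoidal_param ax h \<gamma>) s 0 K"
  defines "v \<equiv> helicoidal_velocity ax h (\<gamma> s)"
  shows "gram (\<gamma>' s) v \<noteq> 0"
    and "K * (gram (\<gamma>' s) v)\<^sup>2 = (triple_product (\<gamma>' s) v (helicoidal_velocity ax 0 (\<gamma>' s)))\<^sup>2
      - triple_product (\<gamma>' s) v \<gamma>'' * triple_product (\<gamma>' s) v (helicoidal_velocity ax 0 v)"
proof -
  let ?X = "helicoidal_param ax h \<gamma>"
  have d1: "d1 ?X u t = helicoidal_motion ax 0 t (\<gamma>' u)" if "u \<in> I" for u t
    unfolding d1_def helicoidal_param_def
    using that by (intro vector_derivative_at has_vector_derivative_helicoidal_motion_point deriv)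
  have d2: "d2 ?X u t = helicoidal_motion ax 0 t (helicoidal_velocity ax h (\<gamma> u))" for u t
    unfolding d2_def helicoidal_param_def
    by (intro vector_derivative_at has_vector_derivative_helicoidal_motion_time)
  have s0: "d1 ?X s 0 = \<gamma>' s" "d2 ?X s 0 = v"
    using d1[OF I(2), of 0] d2[of s 0] by (auto simp: v_def)
  show D: "gram (\<gamma>' s) v \<noteq> 0"
    using non_degenerate_gram[OF nd I(2), of 0] unfolding s0 .
  have ss: "((\<lambda>u. d1 ?X u 0) has_vector_derivative \<gamma>'') (at s)"
    by (rule has_vector_derivative_transform_within_open[OF deriv2 I]) (simp add: d1)
  have ts: "((\<lambda>t. d1 ?X s t) has_vector_derivative helicoidal_velocity ax 0 (\<gamma>' s)) (at 0)"
    using has_vector_derivative_helicoidal_motion_time[of ax 0 "\<gamma>' s" 0] d1[OF I(2)] by simp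
  have st: "((\<lambda>u. d2 ?X u 0) has_vector_derivative helicoidal_velocity ax 0 (\<gamma>' s)) (at s)"
    using has_vector_derivative_helicoidal_velocity[OF deriv[OF I(2)], of ax h] d2 by simp
  have tt: "((\<lambda>t. d2 ?X s t) has_vector_derivative helicoidal_velocity ax 0 v) (at 0)"
    using has_vector_derivative_helicoidal_motion_time[of ax 0 v 0] d2 by (simp add: v_def)
  show "K * (gram (\<gamma>' s) v)\<^sup>2 = (triple_product (\<gamma>' s) v (helicoidal_velocity ax 0 (\<gamma>' s)))\<^sup>2
      - triple_product (\<gamma>' s) v \<gamma>'' * triple_product (\<gamma>' s) v (helicoidal_velocity ax 0 v)"
    using gauss_curvature_equation[OF K ss ts st tt] D unfolding s0 by simp
qed

text \<open>
  In the lemmas below, \<open>p\<close>, \<open>p'\<close>, \<open>p''\<close> are the position and the derivatives of the generating curve.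
\<close>

lemma timelike_gram:
  assumes "p $ 2 = 0" "p' $ 2 = 0"
  shows "gram p' (helicoidal_velocity Timelike h p) =
    (p' $ 1)\<^sup>2 * ((p $ 1)\<^sup>2 - h\<^sup>2) - (p $ 1)\<^sup>2 * (p' $ 3)\<^sup>2"
  using assms unfolding gram_def lorentz_inner_def by (simp add: power2_eq_square algebra_simps)

lemma timelike_second_form:
  fixes h :: real
  assumes "p $ 2 = 0" "p' $ 2 = 0" "p'' $ 2 = 0"
  defines "v \<equiv> helicoidal_velocity Timelike h p"
  shows "(triple_product p' v (helicoidal_velocity Timelike 0 p'))\<^sup>2
      - triple_product p' v p'' * triple_product p' v (helicoidal_velocity Timelike 0 v)
    = h\<^sup>2 * (p' $ 1) ^ 4 - (p $ 1) ^ 3 * p' $ 3 * (p' $ 1 * p'' $ 3 - p' $ 3 * p'' $ 1)"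
  using assms(1-3) unfolding v_def triple_product_def
  by (simp add: power2_eq_square power3_eq_cube power4_eq_xxxx algebra_simps)

lemma spacelike_gram:
  assumes "p $ 1 = 0" "p' $ 1 = 0"
  shows "gram p' (helicoidal_velocity Spacelike h p) =
    h\<^sup>2 * ((p' $ 2)\<^sup>2 - (p' $ 3)\<^sup>2) - (p $ 2 * p' $ 2 - p $ 3 * p' $ 3)\<^sup>2"
  using assms unfolding gram_def lorentz_inner_def by (simp add: power2_eq_square algebra_simps)

lemma spacelike_second_form:
  fixes h :: real
  assumes "p $ 1 = 0" "p' $ 1 = 0" "p'' $ 1 = 0"
  defines "v \<equiv> helicoidal_velocity Spacelike h p"
  shows "(triple_product p' v (helicoidal_velocity Spacelike 0 p'))\<^sup>2
      - triple_product p' v p'' * triple_product p' v (helicoidal_velocity Spacelike 0 v)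
    = h\<^sup>2 * (((p' $ 3)\<^sup>2 - (p' $ 2)\<^sup>2)\<^sup>2
        - (p' $ 3 * p'' $ 2 - p' $ 2 * p'' $ 3) * (p' $ 3 * p $ 2 - p' $ 2 * p $ 3))"
  using assms(1-3) unfolding v_def triple_product_def
  by (simp add: power2_eq_square power3_eq_cube power4_eq_xxxx algebra_simps)

lemma lightlike_gram:
  assumes "p $ 1 = p $ 3" "p' $ 1 = p' $ 3"
  shows "gram p' (helicoidal_velocity Lightlike h p) = - 4 * h * (p $ 2 * (p' $ 2)\<^sup>2 + h * (p' $ 1)\<^sup>2)"
  using assms unfolding gram_def lorentz_inner_def by (simp add: power2_eq_square algebra_simps)

lemma lightlike_second_form:
  fixes h :: real
  assumes "p $ 1 = p $ 3" "p' $ 1 = p' $ 3" "p'' $ 1 = p'' $ 3"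
  defines "v \<equiv> helicoidal_velocity Lightlike h p"
  shows "(triple_product p' v (helicoidal_velocity Lightlike 0 p'))\<^sup>2
      - triple_product p' v p'' * triple_product p' v (helicoidal_velocity Lightlike 0 v)
    = 4 * h\<^sup>2 * ((p' $ 2) ^ 4 + 2 * h * p' $ 1 * (p'' $ 1 * p' $ 2 - p' $ 1 * p'' $ 2))"
  using assms(1-3) unfolding v_def triple_product_def
  by (simp add: power2_eq_square power3_eq_cube power4_eq_xxxx algebra_simps)

text \<open>The derivatives of a generating curve stay in its plane because the plane is linear.\<close>

lemma generating_curve_derivatives:
  assumes "generating_curve ax I \<gamma>"
  obtains \<gamma>' \<gamma>'' where
    "\<And>s. s \<in> I \<Longrightarrow> (\<gamma> has_vector_derivative \<gamma>' s) (at s)"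
    "\<And>s. s \<in> I \<Longrightarrow> (\<gamma>' has_vector_derivative \<gamma>'' s) (at s)"
    "\<And>s. s \<in> I \<Longrightarrow> \<gamma> s \<in> generating_plane ax"
    "\<And>s. s \<in> I \<Longrightarrow> \<gamma>' s \<in> generating_plane ax"
    "\<And>s. s \<in> I \<Longrightarrow> \<gamma>'' s \<in> generating_plane ax"
proof -
  have I: "open I" and plane: "\<And>s. s \<in> I \<Longrightarrow> \<gamma> s \<in> generating_plane ax"
    and "C2_curve_on I \<gamma>"
    using assms unfolding generating_curve_def by auto
  then obtain \<gamma>' \<gamma>'' where d: "\<And>s. s \<in> I \<Longrightarrow> (\<gamma> has_vector_derivative \<gamma>' s) (at s)"
    "\<And>s. s \<in> I \<Longrightarrow> (\<gamma>' has_vector_derivative \<gamma>'' s) (at s)"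
    unfolding C2_curve_on_def by blast
  have plane': "c' s \<in> generating_plane ax"
    if c: "\<And>s. s \<in> I \<Longrightarrow> (c has_vector_derivative c' s) (at s)"
      "\<And>s. s \<in> I \<Longrightarrow> c s \<in> generating_plane ax" and s: "s \<in> I" for c c' s
  proof (cases ax)
    case Timelike
    then show ?thesis
      using derivative_0_if_0_on_open[OF has_real_derivative_vec_nth[OF c(1)[OF s], of 2] I s]
        c(2) by simp
  next
    case Spacelike
    then show ?thesis
      using derivative_0_if_0_on_open[OF has_real_derivative_vec_nth[OF c(1)[OF s], of 1] I s]
        c(2) by simp
  next
    case Lightlike
    then show ?thesis
      using derivative_0_if_0_on_open[OF DERIV_diff[OF has_real_derivative_vec_nth[OF c(1)[OF s], of 1]
        has_real_derivative_vec_nth[OF c(1)[OF s], of 3]] I s] c(2) by simp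
  qed
  show ?thesis
    using that[OF d plane] plane'[OF d(1) plane] plane'[OF d(2)] by blast
qed

lemma constant_curvature_profile:
  assumes gen: "generating_curve ax I \<gamma>"
    and nd: "non_degenerate_on I (helicoidal_param ax h \<gamma>)"
    and K: "\<forall>s\<in>I. \<forall>t. has_gauss_curvature (helicoidal_param ax h \<gamma>) s t K"
  obtains \<gamma>' \<gamma>'' where
    "\<And>s. s \<in> I \<Longrightarrow> (\<gamma> has_vector_derivative \<gamma>' s) (at s)"
    "\<And>s. s \<in> I \<Longrightarrow> (\<gamma>' has_vector_derivative \<gamma>'' s) (at s)"
    "\<And>s. s \<in> I \<Longrightarrow> \<gamma> s \<in> generating_plane ax"
    "\<And>s. s \<in> I \<Longrightarrow> \<gamma>' s \<in> generating_plane ax"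
    "\<And>s. s \<in> I \<Longrightarrow> \<gamma>'' s \<in> generating_plane ax"
    "\<And>s. s \<in> I \<Longrightarrow> gram (\<gamma>' s) (helicoidal_velocity ax h (\<gamma> s)) \<noteq> 0"
    "\<And>s. s \<in> I \<Longrightarrow> K * (gram (\<gamma>' s) (helicoidal_velocity ax h (\<gamma> s)))\<^sup>2 =
        (triple_product (\<gamma>' s) (helicoidal_velocity ax h (\<gamma> s)) (helicoidal_velocity ax 0 (\<gamma>' s)))\<^sup>2
      - triple_product (\<gamma>' s) (helicoidal_velocity ax h (\<gamma> s)) (\<gamma>'' s)
        * triple_product (\<gamma>' s) (helicoidal_velocity ax h (\<gamma> s))
            (helicoidal_velocity ax 0 (helicoidal_velocity ax h (\<gamma> s)))"
proof -
  obtain \<gamma>' \<gamma>'' where d: "\<And>s. s \<in> I \<Longrightarrow> (\<gamma> has_vector_derivative \<gamma>' s) (at s)"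
    "\<And>s. s \<in> I \<Longrightarrow> (\<gamma>' has_vector_derivative \<gamma>'' s) (at s)"
    and plane: "\<And>s. s \<in> I \<Longrightarrow> \<gamma> s \<in> generating_plane ax"
    "\<And>s. s \<in> I \<Longrightarrow> \<gamma>' s \<in> generating_plane ax"
    "\<And>s. s \<in> I \<Longrightarrow> \<gamma>'' s \<in> generating_plane ax"
    using generating_curve_derivatives[OF gen] by blast
  have "open I" using gen by (simp add: generating_curve_def)
  then show ?thesis
    using that[OF d plane] profile_curvature_equation[OF d(1) d(2) _ _ nd] K by blast
qed

text \<open>
  The curvature equation in coordinates. In the lightlike case a factor \<open>4 h\<^sup>2\<close> has been cancelled.
\<close>

lemma timelike_profile_equation:
  assumes "generating_curve Timelike I \<gamma>"
    and "non_degenerate_on I (helicoidal_param Timelike h \<gamma>)"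
    and "\<forall>s\<in>I. \<forall>t. has_gauss_curvature (helicoidal_param Timelike h \<gamma>) s t K"
  obtains x z x' z' x'' z'' where
    "\<And>s. s \<in> I \<Longrightarrow> \<gamma> s = vector [x s, 0, z s]"
    "\<And>s. s \<in> I \<Longrightarrow> (x has_real_derivative x' s) (at s)"
    "\<And>s. s \<in> I \<Longrightarrow> (z has_real_derivative z' s) (at s)"
    "\<And>s. s \<in> I \<Longrightarrow> (x' has_real_derivative x'' s) (at s)"
    "\<And>s. s \<in> I \<Longrightarrow> (z' has_real_derivative z'' s) (at s)"
    "\<And>s. s \<in> I \<Longrightarrow> (x' s)\<^sup>2 * ((x s)\<^sup>2 - h\<^sup>2) - (x s)\<^sup>2 * (z' s)\<^sup>2 \<noteq> 0"
    "\<And>s. s \<in> I \<Longrightarrow> K * ((x' s)\<^sup>2 * ((x s)\<^sup>2 - h\<^sup>2) - (x s)\<^sup>2 * (z' s)\<^sup>2)\<^sup>2 =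
       h\<^sup>2 * x' s ^ 4 - x s ^ 3 * z' s * (x' s * z'' s - z' s * x'' s)"
proof (rule constant_curvature_profile[OF assms])
  fix \<gamma>' \<gamma>''
  assume d: "\<And>s. s \<in> I \<Longrightarrow> (\<gamma> has_vector_derivative \<gamma>' s) (at s)"
    "\<And>s. s \<in> I \<Longrightarrow> (\<gamma>' has_vector_derivative \<gamma>'' s) (at s)"
    and plane: "\<And>s. s \<in> I \<Longrightarrow> \<gamma> s \<in> generating_plane Timelike"
      "\<And>s. s \<in> I \<Longrightarrow> \<gamma>' s \<in> generating_plane Timelike"
      "\<And>s. s \<in> I \<Longrightarrow> \<gamma>'' s \<in> generating_plane Timelike"
    and eqs: "\<And>s. s \<in> I \<Longrightarrow> gram (\<gamma>' s) (helicoidal_velocity Timelike h (\<gamma> s)) \<noteq> 0"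
      "\<And>s. s \<in> I \<Longrightarrow> K * (gram (\<gamma>' s) (helicoidal_velocity Timelike h (\<gamma> s)))\<^sup>2 =
        (triple_product (\<gamma>' s) (helicoidal_velocity Timelike h (\<gamma> s)) (helicoidal_velocity Timelike 0 (\<gamma>' s)))\<^sup>2
      - triple_product (\<gamma>' s) (helicoidal_velocity Timelike h (\<gamma> s)) (\<gamma>'' s)
        * triple_product (\<gamma>' s) (helicoidal_velocity Timelike h (\<gamma> s))
            (helicoidal_velocity Timelike 0 (helicoidal_velocity Timelike h (\<gamma> s)))"
  note pl = plane[simplified]
  show thesis
    by (rule that[of "\<lambda>s. \<gamma> s $ 1" "\<lambda>s. \<gamma> s $ 3" "\<lambda>s. \<gamma>' s $ 1" "\<lambda>s. \<gamma>' s $ 3" "\<lambda>s. \<gamma>'' s $ 1" "\<lambda>s. \<gamma>'' s $ 3"])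
      (use eqs timelike_gram[OF pl(1,2)] timelike_second_form[OF pl] in
        \<open>auto simp: vec_eq_iff forall_3 pl d intro!: has_real_derivative_vec_nth\<close>)
qed

lemma spacelike_profile_equation:
  assumes "generating_curve Spacelike I \<gamma>"
    and "non_degenerate_on I (helicoidal_param Spacelike h \<gamma>)"
    and "\<forall>s\<in>I. \<forall>t. has_gauss_curvature (helicoidal_param Spacelike h \<gamma>) s t K"
  obtains y z y' z' y'' z'' where
    "\<And>s. s \<in> I \<Longrightarrow> \<gamma> s = vector [0, y s, z s]"
    "\<And>s. s \<in> I \<Longrightarrow> (y has_real_derivative y' s) (at s)"
    "\<And>s. s \<in> I \<Longrightarrow> (z has_real_derivative z' s) (at s)"
    "\<And>s. s \<in> I \<Longrightarrow> (y' has_real_derivative y'' s) (at s)"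
    "\<And>s. s \<in> I \<Longrightarrow> (z' has_real_derivative z'' s) (at s)"
    "\<And>s. s \<in> I \<Longrightarrow> h\<^sup>2 * ((y' s)\<^sup>2 - (z' s)\<^sup>2) - (y s * y' s - z s * z' s)\<^sup>2 \<noteq> 0"
    "\<And>s. s \<in> I \<Longrightarrow> K * (h\<^sup>2 * ((y' s)\<^sup>2 - (z' s)\<^sup>2) - (y s * y' s - z s * z' s)\<^sup>2)\<^sup>2 =
       h\<^sup>2 * (((z' s)\<^sup>2 - (y' s)\<^sup>2)\<^sup>2 - (z' s * y'' s - y' s * z'' s) * (z' s * y s - y' s * z s))"
proof (rule constant_curvature_profile[OF assms])
  fix \<gamma>' \<gamma>''
  assume d: "\<And>s. s \<in> I \<Longrightarrow> (\<gamma> has_vector_derivative \<gamma>' s) (at s)"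
    "\<And>s. s \<in> I \<Longrightarrow> (\<gamma>' has_vector_derivative \<gamma>'' s) (at s)"
    and plane: "\<And>s. s \<in> I \<Longrightarrow> \<gamma> s \<in> generating_plane Spacelike"
      "\<And>s. s \<in> I \<Longrightarrow> \<gamma>' s \<in> generating_plane Spacelike"
      "\<And>s. s \<in> I \<Longrightarrow> \<gamma>'' s \<in> generating_plane Spacelike"
    and eqs: "\<And>s. s \<in> I \<Longrightarrow> gram (\<gamma>' s) (helicoidal_velocity Spacelike h (\<gamma> s)) \<noteq> 0"
      "\<And>s. s \<in> I \<Longrightarrow> K * (gram (\<gamma>' s) (helicoidal_velocity Spacelike h (\<gamma> s)))\<^sup>2 =
        (triple_product (\<gamma>' s) (helicoidal_velocity Spacelike h (\<gamma> s)) (helicoidal_velocity Spacelike 0 (\<gamma>' s)))\<^sup>2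
      - triple_product (\<gamma>' s) (helicoidal_velocity Spacelike h (\<gamma> s)) (\<gamma>'' s)
        * triple_product (\<gamma>' s) (helicoidal_velocity Spacelike h (\<gamma> s))
            (helicoidal_velocity Spacelike 0 (helicoidal_velocity Spacelike h (\<gamma> s)))"
  note pl = plane[simplified]
  show thesis
    by (rule that[of "\<lambda>s. \<gamma> s $ 2" "\<lambda>s. \<gamma> s $ 3" "\<lambda>s. \<gamma>' s $ 2" "\<lambda>s. \<gamma>' s $ 3" "\<lambda>s. \<gamma>'' s $ 2" "\<lambda>s. \<gamma>'' s $ 3"])
      (use eqs spacelike_gram[OF pl(1,2)] spacelike_second_form[OF pl] in
        \<open>auto simp: vec_eq_iff forall_3 pl d intro!: has_real_derivative_vec_nth\<close>)
qed

lemma lightlike_profile_equation: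
  assumes "h \<noteq> 0" "generating_curve Lightlike I \<gamma>"
    and "non_degenerate_on I (helicoidal_param Lightlike h \<gamma>)"
    and "\<forall>s\<in>I. \<forall>t. has_gauss_curvature (helicoidal_param Lightlike h \<gamma>) s t K"
  obtains x y x' y' x'' y'' where
    "\<And>s. s \<in> I \<Longrightarrow> \<gamma> s = vector [x s, y s, x s]"
    "\<And>s. s \<in> I \<Longrightarrow> (x has_real_derivative x' s) (at s)"
    "\<And>s. s \<in> I \<Longrightarrow> (y has_real_derivative y' s) (at s)"
    "\<And>s. s \<in> I \<Longrightarrow> (x' has_real_derivative x'' s) (at s)"
    "\<And>s. s \<in> I \<Longrightarrow> (y' has_real_derivative y'' s) (at s)"
    "\<And>s. s \<in> I \<Longrightarrow> y s * (y' s)\<^sup>2 + h * (x' s)\<^sup>2 \<noteq> 0"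
    "\<And>s. s \<in> I \<Longrightarrow> 4 * K * (y s * (y' s)\<^sup>2 + h * (x' s)\<^sup>2)\<^sup>2 =
       y' s ^ 4 + 2 * h * x' s * (x'' s * y' s - x' s * y'' s)"
proof (rule constant_curvature_profile[OF assms(2-)])
  fix \<gamma>' \<gamma>''
  assume d: "\<And>s. s \<in> I \<Longrightarrow> (\<gamma> has_vector_derivative \<gamma>' s) (at s)"
    "\<And>s. s \<in> I \<Longrightarrow> (\<gamma>' has_vector_derivative \<gamma>'' s) (at s)"
    and plane: "\<And>s. s \<in> I \<Longrightarrow> \<gamma> s \<in> generating_plane Lightlike"
      "\<And>s. s \<in> I \<Longrightarrow> \<gamma>' s \<in> generating_plane Lightlike"
      "\<And>s. s \<in> I \<Longrightarrow> \<gamma>'' s \<in> generating_plane Lightlike"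
    and eqs: "\<And>s. s \<in> I \<Longrightarrow> gram (\<gamma>' s) (helicoidal_velocity Lightlike h (\<gamma> s)) \<noteq> 0"
      "\<And>s. s \<in> I \<Longrightarrow> K * (gram (\<gamma>' s) (helicoidal_velocity Lightlike h (\<gamma> s)))\<^sup>2 =
        (triple_product (\<gamma>' s) (helicoidal_velocity Lightlike h (\<gamma> s)) (helicoidal_velocity Lightlike 0 (\<gamma>' s)))\<^sup>2
      - triple_product (\<gamma>' s) (helicoidal_velocity Lightlike h (\<gamma> s)) (\<gamma>'' s)
        * triple_product (\<gamma>' s) (helicoidal_velocity Lightlike h (\<gamma> s))
            (helicoidal_velocity Lightlike 0 (helicoidal_velocity Lightlike h (\<gamma> s)))"
  have pl: "\<gamma> s $ 1 = \<gamma> s $ 3" "\<gamma>' s $ 1 = \<gamma>' s $ 3" "\<gamma>'' s $ 1 = \<gamma>'' s $ 3" if "s \<in> I" for s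
    using plane[OF that] by auto
  have eq: "4 * K * (\<gamma> s $ 2 * (\<gamma>' s $ 2)\<^sup>2 + h * (\<gamma>' s $ 1)\<^sup>2)\<^sup>2 =
       \<gamma>' s $ 2 ^ 4 + 2 * h * \<gamma>' s $ 1 * (\<gamma>'' s $ 1 * \<gamma>' s $ 2 - \<gamma>' s $ 1 * \<gamma>'' s $ 2)" (is "?l = ?r")
    if s: "s \<in> I" for s
  proof -
    have scale: "(4 * h\<^sup>2) * (4 * K * d\<^sup>2) = (4 * h\<^sup>2) * r" if "K * (- 4 * h * d)\<^sup>2 = 4 * h\<^sup>2 * r" for d r
      using that by (simp add: power_mult_distrib)
    have "(4 * h\<^sup>2) * ?l = (4 * h\<^sup>2) * ?r"
      using eqs(2)[OF s] unfolding lightlike_second_form[OF pl[OF s]] lightlike_gram[OF pl(1,2)[OF s]]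
      by (rule scale)
    then show ?thesis using assms(1) mult_left_cancel[of "4 * h\<^sup>2" ?l ?r] by fastforce
  qed
  show thesis
  proof (rule that[of "\<lambda>s. \<gamma> s $ 1" "\<lambda>s. \<gamma> s $ 2" "\<lambda>s. \<gamma>' s $ 1" "\<lambda>s. \<gamma>' s $ 2" "\<lambda>s. \<gamma>'' s $ 1" "\<lambda>s. \<gamma>'' s $ 2"])
    show "\<gamma> s $ 2 * (\<gamma>' s $ 2)\<^sup>2 + h * (\<gamma>' s $ 1)\<^sup>2 \<noteq> 0" if "s \<in> I" for s
      using eqs(1)[OF that] unfolding lightlike_gram[OF pl(1,2)[OF that]] by auto
    show "\<gamma> s = vector [\<gamma> s $ 1, \<gamma> s $ 2, \<gamma> s $ 1]" if "s \<in> I" for s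
      using pl(1)[OF that] by (simp add: vec_eq_iff forall_3)
  qed (auto intro!: has_real_derivative_vec_nth d eq)
qed

section \<open>Polynomial generating curves\<close>

lemma has_real_derivative_unique_on_open:
  assumes "(f has_real_derivative d) (at (s::real))" "open I" "s \<in> I" "\<And>u. u \<in> I \<Longrightarrow> f u = g u"
    and "(g has_real_derivative d') (at s)"
  shows "d = d'"
  using has_field_derivative_transform_within_open[OF assms(1-3), of g] assms(4,5) DERIV_unique by blast

text \<open>
  A finite connected set of reals has at most one element, so the function is constant.
\<close>

lemma deriv_zero_if_finite_image:
  assumes I: "open I" "is_interval I" and d: "\<And>s. s \<in> I \<Longrightarrow> (f has_real_derivative f' s) (at (s::real))"
    and fin: "finite (f ` I)" and s: "s \<in> I"
  shows "f' s = 0"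
proof -
  have "connected (f ` I)"
    using I(2) d by (intro connected_continuous_image)
      (auto simp: is_interval_connected intro!: DERIV_isCont continuous_at_imp_continuous_on)
  then obtain c where "\<And>u. u \<in> I \<Longrightarrow> f u = c"
    using fin connected_finite_iff_sing[of "f ` I"] by blast
  then show ?thesis
    by (intro has_real_derivative_unique_on_open[OF d[OF s] I(1) s _ DERIV_const])
qed

lemma poly_eqI_on_infinite:
  fixes p q :: "'a :: idom poly"
  assumes "infinite S" "\<And>s. s \<in> S \<Longrightarrow> poly p s = poly q s"
  shows "p = q"
proof (rule ccontr)
  assume "p \<noteq> q"
  then have "finite {s. poly (p - q) s = 0}" by (intro poly_roots_finite) simp
  moreover have "S \<subseteq> {s. poly (p - q) s = 0}" using assms(2) by auto
  ultimately show False using assms(1) finite_subset by blast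
qed

lemma degree_diff_eq_larger:
  fixes p q :: "'a :: ab_group_add poly"
  shows "degree q < degree p \<Longrightarrow> degree (p - q) = degree p"
    and "degree q < degree p \<Longrightarrow> degree (q - p) = degree p"
  using degree_add_eq_left[of "- q" p] degree_add_eq_right[of q "- p"] by simp_all

lemma degree_one_minus_square:
  fixes p :: "real poly"
  assumes "degree p \<ge> 1"
  shows "degree (1 - p\<^sup>2) = 2 * degree p"
proof -
  have "degree (p\<^sup>2) = 2 * degree p" using assms by (subst degree_power_eq) auto
  then show ?thesis using assms degree_diff_eq_larger(2)[of 1 "p\<^sup>2"] by simp
qed

text \<open>
  If \<open>p\<close> is not constant, the left-hand side has degree \<open>4 deg p + 4\<close> and the right-hand side at
  most \<open>2 deg p + 2\<close>; the curvature does not vanish, by comparison of both sides at \<open>0\<close>. If \<open>p = a\<close> is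
  constant, then comparison at \<open>h\<close> gives \<open>a\<^sup>4 = 1\<close>.
\<close>

lemma timelike_polynomial_identity:
  fixes p :: "real poly"
  assumes h: "h \<noteq> 0"
    and eq: "smult K (([:0, 0, 1:] * (1 - p\<^sup>2) - [:h\<^sup>2:])\<^sup>2) = [:h\<^sup>2:] - [:0, 0, 0, 1:] * p * pderiv p"
  shows "K = 1 / h\<^sup>2 \<and> (p = [:1:] \<or> p = [:- 1:])"
proof -
  have pt: "K * (s\<^sup>2 * (1 - (poly p s)\<^sup>2) - h\<^sup>2)\<^sup>2 = h\<^sup>2 - s ^ 3 * poly p s * poly (pderiv p) s" for s
    using arg_cong[OF eq, of "\<lambda>q. poly q s"]
    by (simp add: power2_eq_square power3_eq_cube algebra_simps)
  have "K * h ^ 4 = h\<^sup>2" using pt[of 0] by (simp add: power2_eq_square power4_eq_xxxx)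
  then have K: "K = 1 / h\<^sup>2" using h by (simp add: field_simps power2_eq_square power4_eq_xxxx)
  have "degree p = 0"
  proof (rule ccontr)
    define n where "n = degree p"
    assume "degree p \<noteq> 0"
    then have n: "n \<ge> 1" and p: "p \<noteq> 0" unfolding n_def by auto
    have "1 - p\<^sup>2 \<noteq> 0" using degree_one_minus_square[of p] n n_def by force
    then have "degree ([:0, 0, 1:] * (1 - p\<^sup>2)) = 2 * n + 2"
      using degree_one_minus_square[of p] n by (subst degree_mult_eq) (auto simp: n_def)
    then have "degree ([:0, 0, 1:] * (1 - p\<^sup>2) - [:h\<^sup>2:]) = 2 * n + 2"
      using degree_diff_eq_larger(1)[of "[:h\<^sup>2:]" "[:0, 0, 1:] * (1 - p\<^sup>2)"] by simp
    then have "degree (smult K (([:0, 0, 1:] * (1 - p\<^sup>2) - [:h\<^sup>2:])\<^sup>2)) = 4 * n + 4"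
      using K h by (subst degree_smult_eq, subst degree_power_eq) auto
    moreover have "degree ([:h\<^sup>2:] - [:0, 0, 0, 1:] * p * pderiv p) \<le> 2 * n + 2"
    proof (rule degree_diff_le)
      have "degree ([:0, 0, 0, 1:] * p * pderiv p) \<le> 3 + n + (n - 1)"
        by (rule order_trans[OF degree_mult_le] add_mono order_trans[OF degree_mult_le[of _ p]])+
          (auto simp: n_def degree_pderiv)
      then show "degree ([:0, 0, 0, 1:] * p * pderiv p) \<le> 2 * n + 2" using n by simp
    qed simp
    ultimately have "4 * n + 4 \<le> 2 * n + 2" unfolding eq by (simp only:)
    then show False by simp
  qed
  then obtain a where p: "p = [:a:]" by (metis degree_eq_zeroE)
  have "h ^ 4 * a ^ 4 = h ^ 4 * 1"
    using pt[of h] h K by (simp add: p pderiv_pCons field_simps power2_eq_square power4_eq_xxxx)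
  then have "(a\<^sup>2)\<^sup>2 = 1" using h by (simp add: power2_eq_square power4_eq_xxxx)
  then have "a\<^sup>2 = 1" using power2_eq_1_iff[of "a\<^sup>2"] by (smt (verit) zero_le_power2)
  then show ?thesis using p K by (simp add: power2_eq_1_iff)
qed

text \<open>
  Let \<open>n = deg f - 1\<close>. If \<open>n \<ge> 1\<close>, then the right-hand side has degree \<open>4 n\<close>, and the left-hand side has
  degree \<open>8 n + 4\<close> or vanishes. If \<open>f = b + a s\<close> with \<open>a\<^sup>2 \<noteq> 1\<close>, then \<open>t = (1 - a\<^sup>2) s - a b\<close> takes all
  real values and \<open>K (h\<^sup>2 (1 - a\<^sup>2) - t\<^sup>2)\<^sup>2\<close> is a nonzero constant, which is impossible. So \<open>a\<^sup>2 = 1\<close>, the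
  Gram determinant is \<open>- (a b)\<^sup>2\<close>, and the identity reads \<open>K (a b)\<^sup>4 = 0\<close>.
\<close>

lemma spacelike_polynomial_identity:
  fixes f :: "real poly"
  assumes h: "h \<noteq> 0"
    and eq: "smult K (([:h\<^sup>2:] * (1 - (pderiv f)\<^sup>2) - ([:0, 1:] - f * pderiv f)\<^sup>2)\<^sup>2)
      = smult (h\<^sup>2) ((1 - (pderiv f)\<^sup>2)\<^sup>2 + pderiv (pderiv f) * ([:0, 1:] * pderiv f - f))"
    and nd: "[:h\<^sup>2:] * (1 - (pderiv f)\<^sup>2) - ([:0, 1:] - f * pderiv f)\<^sup>2 \<noteq> 0"
  shows "K = 0 \<and> (\<exists>a b. a \<in> {1, - 1} \<and> b \<noteq> 0 \<and> f = [:b, a:])"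
proof -
  define p where "p = pderiv f"
  define Q where "Q = [:h\<^sup>2:] * (1 - p\<^sup>2) - ([:0, 1:] - f * p)\<^sup>2"
  note eq' = eq[folded p_def, folded Q_def]
  have "degree f \<le> 1"
  proof (rule ccontr)
    define n where "n = degree p"
    assume "\<not> degree f \<le> 1"
    then have n: "n \<ge> 1" "degree f = n + 1" and ne: "p \<noteq> 0" "f \<noteq> 0"
      unfolding n_def p_def by (auto simp: degree_pderiv pderiv_eq_0_iff)
    have "degree (f * p) = 2 * n + 1" using ne n by (simp add: degree_mult_eq n_def)
    then have "degree ([:0, 1:] - f * p) = 2 * n + 1"
      using n degree_diff_eq_larger(2)[of "[:0, 1:]" "f * p"] by simp
    then have sq: "degree (([:0, 1:] - f * p)\<^sup>2) = 4 * n + 2"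
      by (subst degree_power_eq) auto
    have p2: "degree (1 - p\<^sup>2) = 2 * n" using degree_one_minus_square[of p] n by (simp add: n_def)
    have "degree ([:h\<^sup>2:] * (1 - p\<^sup>2)) \<le> 2 * n"
      using degree_mult_le[of "[:h\<^sup>2:]" "1 - p\<^sup>2"] p2 by simp
    then have Q: "degree Q = 4 * n + 2"
      using degree_diff_eq_larger(2)[of "[:h\<^sup>2:] * (1 - p\<^sup>2)" "([:0, 1:] - f * p)\<^sup>2"] sq n
      unfolding Q_def by simp
    have l: "degree ((1 - p\<^sup>2)\<^sup>2) = 4 * n"
      using p2 n by (subst degree_power_eq) auto
    have "degree ([:0, 1:] * p - f) \<le> n + 1"
      using n degree_mult_le[of "[:0, 1:]" p] by (intro degree_diff_le) (auto simp: n_def)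
    then have r: "degree (pderiv p * ([:0, 1:] * p - f)) \<le> 2 * n"
      using n degree_mult_le[of "pderiv p" "[:0, 1:] * p - f"] by (auto simp: n_def degree_pderiv)
    have lr: "degree ((1 - p\<^sup>2)\<^sup>2 + pderiv p * ([:0, 1:] * p - f)) = 4 * n"
      using degree_add_eq_left[of "pderiv p * ([:0, 1:] * p - f)" "(1 - p\<^sup>2)\<^sup>2"] l r n by simp
    have "degree (smult K (Q\<^sup>2)) = 4 * n"
      unfolding eq' using lr h by (simp add: degree_smult_eq)
    moreover have "degree (smult K (Q\<^sup>2)) = (if K = 0 then 0 else 8 * n + 4)"
      using Q by (subst degree_smult_eq, subst degree_power_eq) auto
    ultimately show False using n by (auto split: if_splits)
  qed
  then obtain a b where f: "f = [:b, a:]"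
    by (metis degree_pCons_eq_if degree_eq_zeroE le_SucE pCons_cases One_nat_def Suc_inject le_zero_eq pCons_0_0)
  have p: "p = [:a:]" unfolding p_def f by (simp add: pderiv_pCons)
  have pt: "K * (h\<^sup>2 * (1 - a\<^sup>2) - ((1 - a\<^sup>2) * s - a * b)\<^sup>2)\<^sup>2 = h\<^sup>2 * (1 - a\<^sup>2)\<^sup>2" for s
    using arg_cong[OF eq', of "\<lambda>q. poly q s"] unfolding Q_def p
    by (simp add: f pderiv_pCons power2_eq_square algebra_simps)
  have a: "1 - a\<^sup>2 = 0"
  proof (rule ccontr)
    assume c: "1 - a\<^sup>2 \<noteq> 0"
    have pt': "K * (h\<^sup>2 * (1 - a\<^sup>2) - t\<^sup>2)\<^sup>2 = h\<^sup>2 * (1 - a\<^sup>2)\<^sup>2" for t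
      using pt[of "(t + a * b) / (1 - a\<^sup>2)"] c by simp
    define w where "w = h\<^sup>2 * (1 - a\<^sup>2)"
    have "K \<noteq> 0" using pt'[of 0] c h by auto
    moreover have "K * (w - 1)\<^sup>2 = K * w\<^sup>2" "K * (w - 4)\<^sup>2 = K * w\<^sup>2"
      using pt'[of 0] pt'[of 1] pt'[of 2] by (auto simp: w_def)
    ultimately have "(w - 1)\<^sup>2 = w\<^sup>2" "(w - 4)\<^sup>2 = w\<^sup>2" by auto
    then show False by (simp add: power2_eq_square algebra_simps)
  qed
  have "poly Q s = - (a * b)\<^sup>2" for s
  proof -
    have "poly Q s = h\<^sup>2 * (1 - a\<^sup>2) - ((1 - a\<^sup>2) * s - a * b)\<^sup>2"
      unfolding Q_def p by (simp add: f power2_eq_square algebra_simps)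
    then show ?thesis using a by simp
  qed
  then have ab: "a * b \<noteq> 0" using nd[folded p_def, folded Q_def] poly_all_0_iff_0[of Q] by auto
  then have "K = 0" using pt[of 0] a by simp
  moreover have "a \<in> {1, - 1}" using a by (simp add: power2_eq_1_iff)
  ultimately show ?thesis using ab f by auto
qed

text \<open>
  If \<open>n = deg p \<ge> 1\<close>, then the right-hand side has degree \<open>2 n - 1\<close>, and the left-hand side has degree
  \<open>4 n\<close> or vanishes. If \<open>p = a\<close> is constant, then the left-hand side vanishes at \<open>- h a\<^sup>2\<close> and the
  right-hand side is \<open>1\<close>.
\<close>

lemma lightlike_no_polynomial_identity:
  fixes p :: "real poly"
  assumes h: "h \<noteq> 0"
    and eq: "smult (4 * K) (([:0, 1:] + smult h (p\<^sup>2))\<^sup>2) = 1 + smult (2 * h) (p * pderiv p)"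
  shows False
proof (cases "degree p = 0")
  case True
  then obtain a where p: "p = [:a:]" by (metis degree_eq_zeroE)
  show False
    using arg_cong[OF eq, of "\<lambda>q. poly q (- h * a\<^sup>2)"] by (simp add: p pderiv_pCons)
next
  case False
  define n where "n = degree p"
  have n: "n \<ge> 1" and p: "p \<noteq> 0" "pderiv p \<noteq> 0"
    using False unfolding n_def by (auto simp: pderiv_eq_0_iff)
  have "degree (smult h (p\<^sup>2)) = 2 * n" using h p by (simp add: degree_power_eq n_def)
  then have "degree ([:0, 1:] + smult h (p\<^sup>2)) = 2 * n"
    using degree_add_eq_right[of "[:0, 1:]" "smult h (p\<^sup>2)"] n by simp
  then have l: "degree (smult (4 * K) (([:0, 1:] + smult h (p\<^sup>2))\<^sup>2)) = (if K = 0 then 0 else 4 * n)"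
    using n by (subst degree_smult_eq, subst degree_power_eq) auto
  have "degree (smult (2 * h) (p * pderiv p)) = 2 * n - 1"
    using h p by (simp add: degree_mult_eq degree_pderiv n_def)
  then have "degree (1 + smult (2 * h) (p * pderiv p)) = 2 * n - 1"
    using degree_add_eq_right[of 1 "smult (2 * h) (p * pderiv p)"] n by simp
  then show False using l n unfolding eq by (auto split: if_splits)
qed

lemma infinite_interval:
  assumes "generating_curve ax I \<gamma>"
  shows "infinite I"
  using assms finite_imp_not_open[of I] unfolding generating_curve_def by blast

lemma timelike_polynomial_graph:
  assumes h: "h \<noteq> 0" and gen: "generating_curve Timelike I \<gamma>"
    and nd: "non_degenerate_on I (helicoidal_param Timelike h \<gamma>)"
    and K: "\<forall>s\<in>I. \<forall>t. has_gauss_curvature (helicoidal_param Timelike h \<gamma>) s t K"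
    and graph: "polynomial_graph Timelike I \<gamma> f"
  shows "K = 1 / h\<^sup>2 \<and> (\<exists>\<sigma> a. \<sigma> \<in> {1, - 1} \<and> f = [:a, \<sigma>:])"
proof (rule timelike_profile_equation[OF gen nd K])
  fix x z x' z' x'' z'' :: "real \<Rightarrow> real"
  assume \<gamma>: "\<And>s. s \<in> I \<Longrightarrow> \<gamma> s = vector [x s, 0, z s]"
    and d: "\<And>s. s \<in> I \<Longrightarrow> (x has_real_derivative x' s) (at s)"
    "\<And>s. s \<in> I \<Longrightarrow> (z has_real_derivative z' s) (at s)"
    "\<And>s. s \<in> I \<Longrightarrow> (x' has_real_derivative x'' s) (at s)"
    "\<And>s. s \<in> I \<Longrightarrow> (z' has_real_derivative z'' s) (at s)"
    and eq: "\<And>s. s \<in> I \<Longrightarrow> K * ((x' s)\<^sup>2 * ((x s)\<^sup>2 - h\<^sup>2) - (x s)\<^sup>2 * (z' s)\<^sup>2)\<^sup>2 =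
       h\<^sup>2 * x' s ^ 4 - x s ^ 3 * z' s * (x' s * z'' s - z' s * x'' s)"
  have I: "open I" using gen by (simp add: generating_curve_def)
  let ?p = "pderiv f"
  have 0: "x s = s" "z s = poly f s" if "s \<in> I" for s
    using graph \<gamma>[OF that] that unfolding polynomial_graph_def by (auto simp: vec_eq_iff forall_3)
  have 1: "x' s = 1" "z' s = poly ?p s" if "s \<in> I" for s
    using has_real_derivative_unique_on_open[OF d(1)[OF that] I that 0(1) DERIV_ident]
      has_real_derivative_unique_on_open[OF d(2)[OF that] I that 0(2) poly_DERIV] by auto
  have 2: "x'' s = 0" "z'' s = poly (pderiv ?p) s" if "s \<in> I" for s
    using has_real_derivative_unique_on_open[OF d(3)[OF that] I that 1(1) DERIV_const]
      has_real_derivative_unique_on_open[OF d(4)[OF that] I that 1(2) poly_DERIV] by auto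
  have "smult K (([:0, 0, 1:] * (1 - ?p\<^sup>2) - [:h\<^sup>2:])\<^sup>2) = [:h\<^sup>2:] - [:0, 0, 0, 1:] * ?p * pderiv ?p"
  proof (rule poly_eqI_on_infinite[OF infinite_interval[OF gen]])
    fix s assume s: "s \<in> I"
    show "poly (smult K (([:0, 0, 1:] * (1 - ?p\<^sup>2) - [:h\<^sup>2:])\<^sup>2)) s
        = poly ([:h\<^sup>2:] - [:0, 0, 0, 1:] * ?p * pderiv ?p) s"
      using eq[OF s] unfolding 0[OF s] 1[OF s] 2[OF s]
      by (simp add: power2_eq_square power3_eq_cube algebra_simps)
  qed
  then have Kp: "K = 1 / h\<^sup>2" "?p = [:1:] \<or> ?p = [:- 1:]"
    using timelike_polynomial_identity[OF h] by blast+
  then have "degree ?p = 0" by auto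
  then have "degree f \<le> 1" by (simp add: degree_pderiv)
  then obtain a \<sigma> where f: "f = [:a, \<sigma>:]" using degree1_coeffs[of f] le_Suc_eq degree_eq_zeroE[of f]
    by (metis One_nat_def le_zero_eq pCons_0_0)
  then have "\<sigma> \<in> {1, - 1}" using Kp(2) by (auto simp: pderiv_pCons)
  then show ?thesis using Kp f by blast
qed

lemma spacelike_polynomial_graph:
  assumes h: "h \<noteq> 0" and gen: "generating_curve Spacelike I \<gamma>"
    and nd: "non_degenerate_on I (helicoidal_param Spacelike h \<gamma>)"
    and K: "\<forall>s\<in>I. \<forall>t. has_gauss_curvature (helicoidal_param Spacelike h \<gamma>) s t K"
    and graph: "polynomial_graph Spacelike I \<gamma> f"
  shows "K = 0 \<and> (\<exists>\<sigma> a. \<sigma> \<in> {1, - 1} \<and> a \<noteq> 0 \<and> f = [:a, \<sigma>:])"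
proof (rule spacelike_profile_equation[OF gen nd K])
  fix y z y' z' y'' z'' :: "real \<Rightarrow> real"
  assume \<gamma>: "\<And>s. s \<in> I \<Longrightarrow> \<gamma> s = vector [0, y s, z s]"
    and d: "\<And>s. s \<in> I \<Longrightarrow> (y has_real_derivative y' s) (at s)"
    "\<And>s. s \<in> I \<Longrightarrow> (z has_real_derivative z' s) (at s)"
    "\<And>s. s \<in> I \<Longrightarrow> (y' has_real_derivative y'' s) (at s)"
    "\<And>s. s \<in> I \<Longrightarrow> (z' has_real_derivative z'' s) (at s)"
    and D: "\<And>s. s \<in> I \<Longrightarrow> h\<^sup>2 * ((y' s)\<^sup>2 - (z' s)\<^sup>2) - (y s * y' s - z s * z' s)\<^sup>2 \<noteq> 0"
    and eq: "\<And>s. s \<in> I \<Longrightarrow> K * (h\<^sup>2 * ((y' s)\<^sup>2 - (z' s)\<^sup>2) - (y s * y' s - z s * z' s)\<^sup>2)\<^sup>2 =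
       h\<^sup>2 * (((z' s)\<^sup>2 - (y' s)\<^sup>2)\<^sup>2 - (z' s * y'' s - y' s * z'' s) * (z' s * y s - y' s * z s))"
  have I: "open I" using gen by (simp add: generating_curve_def)
  let ?p = "pderiv f"
  have 0: "y s = s" "z s = poly f s" if "s \<in> I" for s
    using graph \<gamma>[OF that] that unfolding polynomial_graph_def by (auto simp: vec_eq_iff forall_3)
  have 1: "y' s = 1" "z' s = poly ?p s" if "s \<in> I" for s
    using has_real_derivative_unique_on_open[OF d(1)[OF that] I that 0(1) DERIV_ident]
      has_real_derivative_unique_on_open[OF d(2)[OF that] I that 0(2) poly_DERIV] by auto
  have 2: "y'' s = 0" "z'' s = poly (pderiv ?p) s" if "s \<in> I" for s
    using has_real_derivative_unique_on_open[OF d(3)[OF that] I that 1(1) DERIV_const]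
      has_real_derivative_unique_on_open[OF d(4)[OF that] I that 1(2) poly_DERIV] by auto
  let ?Q = "[:h\<^sup>2:] * (1 - ?p\<^sup>2) - ([:0, 1:] - f * ?p)\<^sup>2"
  have "smult K (?Q\<^sup>2) = smult (h\<^sup>2) ((1 - ?p\<^sup>2)\<^sup>2 + pderiv ?p * ([:0, 1:] * ?p - f))"
  proof (rule poly_eqI_on_infinite[OF infinite_interval[OF gen]])
    fix s assume s: "s \<in> I"
    show "poly (smult K (?Q\<^sup>2)) s = poly (smult (h\<^sup>2) ((1 - ?p\<^sup>2)\<^sup>2 + pderiv ?p * ([:0, 1:] * ?p - f))) s"
      using eq[OF s] unfolding 0[OF s] 1[OF s] 2[OF s]
      by (simp add: power2_eq_square power3_eq_cube algebra_simps)
  qed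
  moreover obtain s where "s \<in> I" using gen by (auto simp: generating_curve_def)
  then have "poly ?Q s \<noteq> 0" using D[of s] 0 1 by simp
  then have "?Q \<noteq> 0" by (metis poly_0)
  ultimately show ?thesis using spacelike_polynomial_identity[OF h] by blast
qed

text \<open>
  The hypothesis concerns only the trace of the curve, so that it covers parabolas with an arbitrary
  parametrization as well. The derivatives of the parametrization drop out: with \<open>x = f (y)\<close> both sides
  of the curvature equation are divisible by \<open>y'\<^sup>4\<close>, and \<open>y'\<close> does not vanish, since otherwise also
  \<open>x' = f' (y) y'\<close> and hence the Gram determinant would.
\<close>

lemma lightlike_not_polynomial_graph:
  assumes h: "h \<noteq> 0" and gen: "generating_curve Lightlike I \<gamma>"
    and nd: "non_degenerate_on I (helicoidal_param Lightlike h \<gamma>)"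
    and K: "\<forall>s\<in>I. \<forall>t. has_gauss_curvature (helicoidal_param Lightlike h \<gamma>) s t K"
    and graph: "\<And>s. s \<in> I \<Longrightarrow> \<gamma> s $ 1 = poly f (\<gamma> s $ 2)"
  shows False
proof (rule lightlike_profile_equation[OF h gen nd K])
  fix x y x' y' x'' y'' :: "real \<Rightarrow> real"
  assume \<gamma>: "\<And>s. s \<in> I \<Longrightarrow> \<gamma> s = vector [x s, y s, x s]"
    and d: "\<And>s. s \<in> I \<Longrightarrow> (x has_real_derivative x' s) (at s)"
    "\<And>s. s \<in> I \<Longrightarrow> (y has_real_derivative y' s) (at s)"
    "\<And>s. s \<in> I \<Longrightarrow> (x' has_real_derivative x'' s) (at s)"
    "\<And>s. s \<in> I \<Longrightarrow> (y' has_real_derivative y'' s) (at s)"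
    and D: "\<And>s. s \<in> I \<Longrightarrow> y s * (y' s)\<^sup>2 + h * (x' s)\<^sup>2 \<noteq> 0"
    and eq: "\<And>s. s \<in> I \<Longrightarrow> 4 * K * (y s * (y' s)\<^sup>2 + h * (x' s)\<^sup>2)\<^sup>2 =
       y' s ^ 4 + 2 * h * x' s * (x'' s * y' s - x' s * y'' s)"
  have I: "open I" using gen by (simp add: generating_curve_def)
  let ?p = "pderiv f"
  have 0: "x s = poly f (y s)" if "s \<in> I" for s
    using graph[OF that] \<gamma>[OF that] by simp
  have chain: "((\<lambda>u. poly q (y u)) has_real_derivative poly (pderiv q) (y s) * y' s) (at s)" if "s \<in> I" for s q
    using DERIV_chain2[OF poly_DERIV d(2)[OF that]] .
  have 1: "x' s = poly ?p (y s) * y' s" if "s \<in> I" for s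
    using has_real_derivative_unique_on_open[OF d(1)[OF that] I that 0 chain[OF that]] .
  have 2: "x'' s = poly (pderiv ?p) (y s) * y' s * y' s + poly ?p (y s) * y'' s" if "s \<in> I" for s
    using has_real_derivative_unique_on_open[OF d(3)[OF that] I that 1 DERIV_mult[OF chain[OF that] d(4)[OF that]]]
    by (simp add: algebra_simps)
  have y': "y' s \<noteq> 0" if "s \<in> I" for s
    using D[OF that] 1[OF that] by auto
  have "infinite (y ` I)"
  proof
    assume "finite (y ` I)"
    moreover obtain s where "s \<in> I" using gen by (auto simp: generating_curve_def)
    ultimately show False
      using deriv_zero_if_finite_image[OF I _ d(2)] y' gen by (auto simp: generating_curve_def)
  qed
  then have "smult (4 * K) (([:0, 1:] + smult h (?p\<^sup>2))\<^sup>2) = 1 + smult (2 * h) (?p * pderiv ?p)"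
  proof (rule poly_eqI_on_infinite)
    fix v assume "v \<in> y ` I"
    then obtain s where s: "s \<in> I" "v = y s" by blast
    have "y' s ^ 4 * (4 * K * (y s + h * (poly ?p (y s))\<^sup>2)\<^sup>2)
        = y' s ^ 4 * (1 + 2 * h * (poly ?p (y s) * poly (pderiv ?p) (y s)))"
      using eq[OF s(1)] unfolding 1[OF s(1)] 2[OF s(1)]
      by (simp add: power2_eq_square power4_eq_xxxx algebra_simps)
    then have "4 * K * (y s + h * (poly ?p (y s))\<^sup>2)\<^sup>2
        = 1 + 2 * h * (poly ?p (y s) * poly (pderiv ?p) (y s))"
      using y'[OF s(1)] by simp
    then show "poly (smult (4 * K) (([:0, 1:] + smult h (?p\<^sup>2))\<^sup>2)) v
        = poly (1 + smult (2 * h) (?p * pderiv ?p)) v"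
      unfolding s(2) by simp
  qed
  then show False using lightlike_no_polynomial_identity[OF h] by blast
qed

lemma mem_helicoidal_surface:
  "p \<in> helicoidal_surface ax h \<gamma> I \<longleftrightarrow> (\<exists>s\<in>I. \<exists>t. p = helicoidal_motion ax h t (\<gamma> s))"
  unfolding helicoidal_surface_def helicoidal_param_def by force

section \<open>Lines that are not graphs\<close>

lemma timelike_line_flat:
  assumes h: "h \<noteq> 0" and gen: "generating_curve Timelike I \<gamma>"
    and nd: "non_degenerate_on I (helicoidal_param Timelike h \<gamma>)"
    and K: "\<forall>s\<in>I. \<forall>t. has_gauss_curvature (helicoidal_param Timelike h \<gamma>) s t K"
    and line: "\<And>s. s \<in> I \<Longrightarrow> \<gamma> s = vertical_line Timelike b s"
  shows "K = 0"
proof (rule timelike_profile_equation[OF gen nd K])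
  fix x z x' z' x'' z'' :: "real \<Rightarrow> real"
  assume \<gamma>: "\<And>s. s \<in> I \<Longrightarrow> \<gamma> s = vector [x s, 0, z s]"
    and d: "\<And>s. s \<in> I \<Longrightarrow> (x has_real_derivative x' s) (at s)"
    "\<And>s. s \<in> I \<Longrightarrow> (x' has_real_derivative x'' s) (at s)"
    and D: "\<And>s. s \<in> I \<Longrightarrow> (x' s)\<^sup>2 * ((x s)\<^sup>2 - h\<^sup>2) - (x s)\<^sup>2 * (z' s)\<^sup>2 \<noteq> 0"
    and eq: "\<And>s. s \<in> I \<Longrightarrow> K * ((x' s)\<^sup>2 * ((x s)\<^sup>2 - h\<^sup>2) - (x s)\<^sup>2 * (z' s)\<^sup>2)\<^sup>2 =
       h\<^sup>2 * x' s ^ 4 - x s ^ 3 * z' s * (x' s * z'' s - z' s * x'' s)"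
  have I: "open I" using gen by (simp add: generating_curve_def)
  obtain s where s: "s \<in> I" using gen by (auto simp: generating_curve_def)
  have 0: "x s = b" if "s \<in> I" for s
    using \<gamma>[OF that] line[OF that] by (auto simp: vec_eq_iff forall_3)
  have 1: "x' s = 0" if "s \<in> I" for s
    using has_real_derivative_unique_on_open[OF d(1)[OF that] I that 0 DERIV_const] .
  have 2: "x'' s = 0" if "s \<in> I" for s
    using has_real_derivative_unique_on_open[OF d(2)[OF that] I that 1 DERIV_const] .
  show ?thesis using eq[OF s] D[OF s] 1[OF s] 2[OF s] by simp
qed

text \<open>
  The curvature equation reads \<open>K (h\<^sup>2 + s\<^sup>2)\<^sup>2 = h\<^sup>2\<close>.
\<close>

lemma spacelike_not_line:
  assumes h: "h \<noteq> 0" and gen: "generating_curve Spacelike I \<gamma>"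
    and nd: "non_degenerate_on I (helicoidal_param Spacelike h \<gamma>)"
    and K: "\<forall>s\<in>I. \<forall>t. has_gauss_curvature (helicoidal_param Spacelike h \<gamma>) s t K"
    and line: "\<And>s. s \<in> I \<Longrightarrow> \<gamma> s = vertical_line Spacelike b s"
  shows False
proof (rule spacelike_profile_equation[OF gen nd K])
  fix y z y' z' y'' z'' :: "real \<Rightarrow> real"
  assume \<gamma>: "\<And>s. s \<in> I \<Longrightarrow> \<gamma> s = vector [0, y s, z s]"
    and d: "\<And>s. s \<in> I \<Longrightarrow> (y has_real_derivative y' s) (at s)"
    "\<And>s. s \<in> I \<Longrightarrow> (z has_real_derivative z' s) (at s)"
    "\<And>s. s \<in> I \<Longrightarrow> (y' has_real_derivative y'' s) (at s)"
    "\<And>s. s \<in> I \<Longrightarrow> (z' has_real_derivative z'' s) (at s)"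
    and eq: "\<And>s. s \<in> I \<Longrightarrow> K * (h\<^sup>2 * ((y' s)\<^sup>2 - (z' s)\<^sup>2) - (y s * y' s - z s * z' s)\<^sup>2)\<^sup>2 =
       h\<^sup>2 * (((z' s)\<^sup>2 - (y' s)\<^sup>2)\<^sup>2 - (z' s * y'' s - y' s * z'' s) * (z' s * y s - y' s * z s))"
  have I: "open I" using gen by (simp add: generating_curve_def)
  have 0: "y s = b" "z s = s" if "s \<in> I" for s
    using \<gamma>[OF that] line[OF that] by (auto simp: vec_eq_iff forall_3)
  have 1: "y' s = 0" "z' s = 1" if "s \<in> I" for s
    using has_real_derivative_unique_on_open[OF d(1)[OF that] I that 0(1) DERIV_const]
      has_real_derivative_unique_on_open[OF d(2)[OF that] I that 0(2) DERIV_ident] by auto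
  have 2: "y'' s = 0" if "s \<in> I" for s
    using has_real_derivative_unique_on_open[OF d(3)[OF that] I that 1(1) DERIV_const] .
  have eq': "smult K ([:h\<^sup>2, 0, 1:]\<^sup>2) = [:h\<^sup>2:]"
  proof (rule poly_eqI_on_infinite[OF infinite_interval[OF gen]])
    fix s assume s: "s \<in> I"
    show "poly (smult K ([:h\<^sup>2, 0, 1:]\<^sup>2)) s = poly [:h\<^sup>2:] s"
      using eq[OF s] unfolding 0[OF s] 1[OF s] 2[OF s]
      by (simp add: power2_eq_square algebra_simps)
  qed
  then have "K \<noteq> 0" using h by auto
  then have "degree (smult K ([:h\<^sup>2, 0, 1:]\<^sup>2)) = 4"
    by (subst degree_smult_eq, subst degree_power_eq) auto
  then show False unfolding eq' by simp
qed

lemma lightlike_line_flat: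
  assumes h: "h \<noteq> 0" and gen: "generating_curve Lightlike I \<gamma>"
    and nd: "non_degenerate_on I (helicoidal_param Lightlike h \<gamma>)"
    and K: "\<forall>s\<in>I. \<forall>t. has_gauss_curvature (helicoidal_param Lightlike h \<gamma>) s t K"
    and line: "\<And>s. s \<in> I \<Longrightarrow> \<gamma> s = vertical_line Lightlike b s"
  shows "K = 0"
proof (rule lightlike_profile_equation[OF h gen nd K])
  fix x y x' y' x'' y'' :: "real \<Rightarrow> real"
  assume \<gamma>: "\<And>s. s \<in> I \<Longrightarrow> \<gamma> s = vector [x s, y s, x s]"
    and d: "\<And>s. s \<in> I \<Longrightarrow> (y has_real_derivative y' s) (at s)"
    "\<And>s. s \<in> I \<Longrightarrow> (y' has_real_derivative y'' s) (at s)"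
    and D: "\<And>s. s \<in> I \<Longrightarrow> y s * (y' s)\<^sup>2 + h * (x' s)\<^sup>2 \<noteq> 0"
    and eq: "\<And>s. s \<in> I \<Longrightarrow> 4 * K * (y s * (y' s)\<^sup>2 + h * (x' s)\<^sup>2)\<^sup>2 =
       y' s ^ 4 + 2 * h * x' s * (x'' s * y' s - x' s * y'' s)"
  have I: "open I" using gen by (simp add: generating_curve_def)
  obtain s where s: "s \<in> I" using gen by (auto simp: generating_curve_def)
  have 0: "y s = b" if "s \<in> I" for s
    using \<gamma>[OF that] line[OF that] by (auto simp: vec_eq_iff forall_3)
  have 1: "y' s = 0" if "s \<in> I" for s
    using has_real_derivative_unique_on_open[OF d(1)[OF that] I that 0 DERIV_const] .
  have 2: "y'' s = 0" if "s \<in> I" for s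
    using has_real_derivative_unique_on_open[OF d(2)[OF that] I that 1 DERIV_const] .
  show ?thesis using eq[OF s] D[OF s] 1[OF s] 2[OF s] by simp
qed

text \<open>
  Near a point \<open>(b cos t\<^sub>0, b sin t\<^sub>0, _)\<close> of the cylinder, the angle
  \<open>t\<^sub>0 + arctan (q\<^sub>2 / q\<^sub>1)\<close> depends continuously on the point; here \<open>(q\<^sub>1, q\<^sub>2)\<close> is obtained
  from the first two coordinates by the rotation through \<open>- t\<^sub>0\<close>.
\<close>

lemma timelike_line_open_part:
  assumes b: "b > 0" and I: "open I"
    and line: "\<And>s. s \<in> I \<Longrightarrow> \<gamma> s = vertical_line Timelike b s"
  shows "open_part_of (helicoidal_surface Timelike h \<gamma> I) (lorentzian_cylinder b)"
proof -
  let ?S = "helicoidal_surface Timelike h \<gamma> I" and ?M = "lorentzian_cylinder b"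
  have S: "p \<in> ?S \<longleftrightarrow> (\<exists>t. p $ 1 = b * cos t \<and> p $ 2 = b * sin t \<and> p $ 3 - h * t \<in> I)" for p
  proof
    assume "p \<in> ?S"
    then obtain s t where "s \<in> I" "p = helicoidal_motion Timelike h t (\<gamma> s)"
      using mem_helicoidal_surface by blast
    then have "p $ 1 = b * cos t \<and> p $ 2 = b * sin t \<and> p $ 3 - h * t \<in> I" using line by simp
    then show "\<exists>t. p $ 1 = b * cos t \<and> p $ 2 = b * sin t \<and> p $ 3 - h * t \<in> I" ..
  next
    assume "\<exists>t. p $ 1 = b * cos t \<and> p $ 2 = b * sin t \<and> p $ 3 - h * t \<in> I"
    then obtain t where t: "p $ 1 = b * cos t" "p $ 2 = b * sin t" "p $ 3 - h * t \<in> I" by blast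
    have "p = helicoidal_motion Timelike h t (\<gamma> (p $ 3 - h * t))"
      using t line[OF t(3)] by (simp add: vec_eq_iff forall_3)
    then show "p \<in> ?S" using t(3) mem_helicoidal_surface by blast
  qed
  have sub: "?S \<subseteq> ?M"
    using S by (auto simp: lorentzian_cylinder_def power_mult_distrib simp flip: distrib_left)
  have "\<exists>T. open T \<and> p \<in> T \<and> ?M \<inter> T \<subseteq> ?S" if p: "p \<in> ?S" for p
  proof -
    obtain t where t: "p $ 1 = b * cos t" "p $ 2 = b * sin t" "p $ 3 - h * t \<in> I" using S p by blast
    define q1 q2 where "q1 = (\<lambda>p :: real ^ 3. p $ 1 * cos t + p $ 2 * sin t)"
      and "q2 = (\<lambda>p :: real ^ 3. p $ 2 * cos t - p $ 1 * sin t)"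
    define a where "a = (\<lambda>p. arctan (q2 p / q1 p))"
    define T where "T = {p. 0 < q1 p} \<inter> (\<lambda>p. p $ 3 - h * (t + a p)) -` I"
    have "open {p. 0 < q1 p}"
      unfolding q1_def by (intro open_Collect_less continuous_intros)
    then have "open T" unfolding T_def a_def q1_def q2_def
      by (intro continuous_open_preimage I) (auto intro!: continuous_intros)
    moreover have q0: "q1 p = b" "q2 p = 0"
    proof -
      have "q1 p = b * ((sin t)\<^sup>2 + (cos t)\<^sup>2)"
        unfolding q1_def t by (simp only: power2_eq_square algebra_simps)
      then show "q1 p = b" by simp
    qed (simp add: q2_def t)
    then have "p \<in> T" using t b unfolding T_def a_def by simp
    moreover have "r \<in> ?S" if r: "r \<in> ?M" "r \<in> T" for r
    proof -
      have pos: "0 < q1 r" and mem: "r $ 3 - h * (t + a r) \<in> I" using r unfolding T_def by auto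
      have "(q1 r)\<^sup>2 + (q2 r)\<^sup>2 = ((r $ 1)\<^sup>2 + (r $ 2)\<^sup>2) * ((sin t)\<^sup>2 + (cos t)\<^sup>2)"
        unfolding q1_def q2_def by (simp only: power2_eq_square algebra_simps)
      then have b2: "(q1 r)\<^sup>2 + (q2 r)\<^sup>2 = b\<^sup>2" using r(1) by (simp add: lorentzian_cylinder_def)
      have "1 + (q2 r / q1 r)\<^sup>2 = (b / q1 r)\<^sup>2"
        using b2 pos by (simp add: field_simps)
      then have "sqrt (1 + (q2 r / q1 r)\<^sup>2) = b / q1 r" using b pos by simp
      then have cs: "q1 r = b * cos (a r)" "q2 r = b * sin (a r)"
        using b pos unfolding a_def by (simp_all add: cos_arctan sin_arctan)
      have "r $ 1 * ((sin t)\<^sup>2 + (cos t)\<^sup>2) = q1 r * cos t - q2 r * sin t"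
        "r $ 2 * ((sin t)\<^sup>2 + (cos t)\<^sup>2) = q1 r * sin t + q2 r * cos t"
        unfolding q1_def q2_def by (simp_all only: power2_eq_square algebra_simps)
      then have "r $ 1 = b * cos (t + a r)" "r $ 2 = b * sin (t + a r)"
        unfolding cs by (simp_all add: cos_add sin_add algebra_simps)
      then show ?thesis using mem S by blast
    qed
    ultimately show ?thesis by blast
  qed
  then have "\<exists>T. openin (top_of_set ?M) T \<and> p \<in> T \<and> T \<subseteq> ?S" if "p \<in> ?S" for p
    using that sub openin_open_Int[of _ ?M] by (metis IntI subsetD)
  then show ?thesis unfolding open_part_of_def by (subst openin_subopen) blast
qed

lemma timelike_line_surface:
  assumes line: "\<And>s. \<gamma> s = vertical_line Timelike b s"
  shows "helicoidal_surface Timelike h \<gamma> UNIV = lorentzian_cylinder b"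
proof (rule set_eqI)
  fix p :: "real ^ 3"
  show "p \<in> helicoidal_surface Timelike h \<gamma> UNIV \<longleftrightarrow> p \<in> lorentzian_cylinder b"
  proof
    assume "p \<in> lorentzian_cylinder b"
    then have "(p $ 1)\<^sup>2 + (p $ 2)\<^sup>2 = b\<^sup>2" by (simp add: lorentzian_cylinder_def)
    then obtain t where "p $ 1 = b * cos t" "p $ 2 = b * sin t"
      by (cases "b = 0") (use sincos_total_2pi[of "p $ 1 / b" "p $ 2 / b"] in
        \<open>auto simp: power_divide field_simps simp flip: add_divide_distrib\<close>)
    then have "p = helicoidal_motion Timelike h t (\<gamma> (p $ 3 - h * t))"
      using line by (simp add: vec_eq_iff forall_3)
    then show "p \<in> helicoidal_surface Timelike h \<gamma> UNIV"
      using mem_helicoidal_surface by blast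
  next
    assume "p \<in> helicoidal_surface Timelike h \<gamma> UNIV"
    then show "p \<in> lorentzian_cylinder b"
      using line by (auto simp: helicoidal_surface_def helicoidal_param_def lorentzian_cylinder_def
        power_mult_distrib simp flip: distrib_left)
  qed
qed

section \<open>Lorentzian circles\<close>

text \<open>
  The linear part of the isometry maps the vectors that span the plane of an orbit of the normal form to
  vectors with the same inner products. The orbits that degenerate (a point on a timelike axis, part of a
  lightlike line that meets a spacelike axis, a line or a point for a lightlike axis) are excluded by the hypotheses.
\<close>

lemma lorentz_circle_cases:
  assumes C: "lorentz_circle C" "\<not> collinear C"
  obtains
    (ellipse) c U V where "C = range (\<lambda>t. c + cos t *\<^sub>R U + sin t *\<^sub>R V)"
      "lorentz_inner U U > 0" "lorentz_inner V V > 0" "lorentz_inner U V = 0"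
  | (hyperbola) c U V m where "C = range (\<lambda>t. c + cosh t *\<^sub>R U + sinh t *\<^sub>R V)" "m \<noteq> 0"
      "lorentz_inner U U = m" "lorentz_inner V V = - m" "lorentz_inner U V = 0"
  | (parabola) c U V where "C = range (\<lambda>t. c + t *\<^sub>R U + t\<^sup>2 *\<^sub>R V)" "V \<noteq> 0"
      "lorentz_inner U U > 0" "lorentz_inner V V = 0" "lorentz_inner U V = 0"
proof -
  obtain T ax q where T: "lorentz_isometry T" and q: "q \<notin> axis_line ax"
    and CT: "C = range (\<lambda>t. T (helicoidal_motion ax 0 t q))"
    using C(1) unfolding lorentz_circle_def by blast
  obtain A b where A: "linear A" and iso: "\<And>v w. lorentz_inner (A v) (A w) = lorentz_inner v w"
    and T: "T = (\<lambda>p. A p + b)"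
    using T unfolding lorentz_isometry_def by blast
  have orbit: "C = range (\<lambda>t. (A p + b) + f t *\<^sub>R A u + g t *\<^sub>R A v)"
    if "\<And>t. helicoidal_motion ax 0 t q = p + f t *\<^sub>R u + g t *\<^sub>R v" for p u v f g
    unfolding CT T that using A by (simp add: linear_add linear_scale algebra_simps)
  have collinear: "collinear (range (\<lambda>t :: real. c + f t *\<^sub>R U))" for c f and U :: "real ^ 3"
    unfolding collinear_def by (auto intro!: exI[of _ U] simp flip: scaleR_diff_left)
  show thesis
  proof (cases ax)
    case Timelike
    let ?u = "vector [q $ 1, q $ 2, 0] :: real ^ 3" and ?v = "vector [- q $ 2, q $ 1, 0] :: real ^ 3"
    have "\<not> (q $ 1 = 0 \<and> q $ 2 = 0)"
    proof
      assume "q $ 1 = 0 \<and> q $ 2 = 0"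
      then have "q = q $ 3 *\<^sub>R vector [0, 0, 1]" by (simp add: vec_eq_iff forall_3)
      then show False using q unfolding Timelike axis_line_def by (auto simp: span_singleton)
    qed
    then have pos: "q $ 1 * q $ 1 + q $ 2 * q $ 2 > 0"
      by (metis sum_squares_gt_zero_iff)
    show thesis
    proof (rule ellipse[OF orbit])
      show "helicoidal_motion ax 0 t q = vector [0, 0, q $ 3] + cos t *\<^sub>R ?u + sin t *\<^sub>R ?v" for t
        unfolding Timelike by (simp add: vec_eq_iff forall_3)
    qed (unfold iso, use pos in \<open>auto simp: lorentz_inner_def algebra_simps\<close>)
  next
    case Spacelike
    let ?u = "vector [0, q $ 2, q $ 3] :: real ^ 3" and ?v = "vector [0, q $ 3, q $ 2] :: real ^ 3"
    have motion: "helicoidal_motion ax 0 t q = vector [q $ 1, 0, 0] + cosh t *\<^sub>R ?u + sinh t *\<^sub>R ?v" for t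
      unfolding Spacelike by (simp add: vec_eq_iff forall_3)
    have "(q $ 2)\<^sup>2 - (q $ 3)\<^sup>2 \<noteq> 0"
    proof
      assume "(q $ 2)\<^sup>2 - (q $ 3)\<^sup>2 = 0"
      then have "q $ 3 = q $ 2 \<or> q $ 3 = - q $ 2" by (auto simp: power2_eq_iff)
      then obtain e where e: "?v = e *\<^sub>R ?u"
        by (elim disjE) (rule that[of 1], simp, rule that[of "- 1"], simp add: vec_eq_iff forall_3)
      have "helicoidal_motion ax 0 t q = vector [q $ 1, 0, 0] + (cosh t + sinh t * e) *\<^sub>R ?u + 0 *\<^sub>R ?v" for t
        unfolding motion e by (simp add: algebra_simps)
      from orbit[OF this] have "C = range (\<lambda>t. (A (vector [q $ 1, 0, 0]) + b) + (cosh t + sinh t * e) *\<^sub>R A ?u)"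
        by simp
      then have "collinear C" by (simp only: collinear)
      then show False using C(2) by blast
    qed
    then show thesis
      by (intro hyperbola[OF orbit[OF motion]]; (unfold iso)?) (auto simp: lorentz_inner_def power2_eq_square)
  next
    case Lightlike
    define d where "d = q $ 3 - q $ 1"
    let ?u = "vector [q $ 2, d, q $ 2] :: real ^ 3" and ?v = "vector [d / 2, 0, d / 2] :: real ^ 3"
    have motion: "helicoidal_motion ax 0 t q = q + t *\<^sub>R ?u + t\<^sup>2 *\<^sub>R ?v" for t
      unfolding Lightlike d_def by (simp add: vec_eq_iff forall_3 field_simps)
    have d: "d \<noteq> 0"
    proof
      assume "d = 0"
      then have "?v = 0" by (simp add: vec_eq_iff forall_3)
      then have "A ?v = 0" using A by (simp add: linear_0)
      then have "C = range (\<lambda>t. (A q + b) + t *\<^sub>R A ?u)"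
        using orbit[OF motion] by simp
      then have "collinear C" by (simp only: collinear)
      then show False using C(2) by blast
    qed
    have "lorentz_inner (A ?v) (A (vector [1, 0, 0])) = d / 2"
      unfolding iso by (simp add: lorentz_inner_def)
    then have "A ?v \<noteq> 0" using d by (auto simp: lorentz_inner_def)
    then show thesis
      using d by (intro parabola[OF orbit[OF motion]]; (unfold iso)?)
        (auto simp: lorentz_inner_def not_sum_power2_lt_zero zero_less_mult_iff linorder_neq_iff)
  qed
qed

text \<open>
  The coefficients of a point with respect to \<open>U\<close> and \<open>V\<close> are continuous functions of the point, and the
  branch is cut out by closed conditions on them.
\<close>

lemma closed_hyperbola_branch:
  assumes "m \<noteq> 0" "lorentz_inner U U = m" "lorentz_inner V V = - m" "lorentz_inner U V = 0"
  shows "closed (range (\<lambda>t. c + cosh t *\<^sub>R U + sinh t *\<^sub>R V))"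
proof -
  define \<alpha> \<beta> where "\<alpha> = (\<lambda>p. lorentz_inner (p - c) U / m)" and "\<beta> = (\<lambda>p. lorentz_inner (p - c) V / (- m))"
  have "range (\<lambda>t. c + cosh t *\<^sub>R U + sinh t *\<^sub>R V)
      = {p. p = c + \<alpha> p *\<^sub>R U + \<beta> p *\<^sub>R V \<and> (\<alpha> p)\<^sup>2 = (\<beta> p)\<^sup>2 + 1 \<and> 0 \<le> \<alpha> p}" (is "_ = ?R")
  proof (intro set_eqI iffI)
    fix p assume "p \<in> range (\<lambda>t. c + cosh t *\<^sub>R U + sinh t *\<^sub>R V)"
    then obtain t where p: "p = c + cosh t *\<^sub>R U + sinh t *\<^sub>R V" by blast
    have "\<alpha> p = cosh t" "\<beta> p = sinh t"
      using assms unfolding \<alpha>_def \<beta>_def p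
      by (auto simp: lorentz_inner_simps lorentz_inner_commute[of V U] field_simps)
    then show "p \<in> ?R" using p cosh_square_eq[of t] by simp
  next
    fix p assume p: "p \<in> ?R"
    let ?t = "arsinh (\<beta> p)"
    have "(cosh ?t)\<^sup>2 = (\<alpha> p)\<^sup>2" using p cosh_square_eq[of ?t] by simp
    then have "cosh ?t = \<alpha> p" by (rule power2_eq_imp_eq) (use p in auto)
    then have "p = c + cosh ?t *\<^sub>R U + sinh ?t *\<^sub>R V" using p by simp
    then show "p \<in> range (\<lambda>t. c + cosh t *\<^sub>R U + sinh t *\<^sub>R V)" by blast
  qed
  moreover have cont: "continuous_on UNIV \<alpha>" "continuous_on UNIV \<beta>"
    unfolding \<alpha>_def \<beta>_def lorentz_inner_def by (intro continuous_intros; simp add: assms)+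
  have "closed ?R"
    by (intro closed_Collect_conj closed_Collect_eq closed_Collect_le continuous_intros cont)
  ultimately show ?thesis by simp
qed

section \<open>Circles that meet a plane infinitely often\<close>

lemma quadratic_infinite_roots:
  fixes a b c :: "'a :: idom"
  assumes "infinite S" "\<And>z. z \<in> S \<Longrightarrow> a + b * z + c * z\<^sup>2 = 0"
  shows "a = 0" "b = 0" "c = 0"
proof -
  have "[:a, b, c:] = 0"
    using assms(2) by (intro poly_eqI_on_infinite[OF assms(1)]) (simp add: power2_eq_square algebra_simps)
  then show "a = 0" "b = 0" "c = 0" by (simp_all split: if_splits)
qed

text \<open>
  On the unit circle the equation is a quadratic equation for \<open>z = cis t\<close>, with complex coefficients. Because of
  periodicity it is the set of points \<open>z\<close>, not that of parameters \<open>t\<close>, that has to be infinite.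
\<close>

lemma infinite_zeros_trigonometric:
  fixes \<alpha> \<beta> \<delta> :: real
  assumes inf: "infinite (cis ` Z)" and zero: "\<And>t. t \<in> Z \<Longrightarrow> \<alpha> + \<beta> * cos t + \<delta> * sin t = 0"
  shows "\<alpha> = 0" "\<beta> = 0" "\<delta> = 0"
proof -
  have root: "Complex \<beta> \<delta> + of_real (2 * \<alpha>) * z + Complex \<beta> (- \<delta>) * z\<^sup>2 = 0" if z: "z \<in> cis ` Z" for z
  proof -
    obtain t where t: "t \<in> Z" "z = cis t" using z by blast
    have e: "\<alpha> = - \<beta> * cos t - \<delta> * sin t" using zero[OF t(1)] by simp
    have cs: "cos t * cos t = 1 - sin t * sin t"
      using sin_cos_squared_add[of t] by (simp add: power2_eq_square)
    have cs': "cos t * (cos t * x) = x - sin t * (sin t * x)" for x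
      unfolding mult.assoc[symmetric] cs by (simp add: algebra_simps)
    show ?thesis
      unfolding t(2) complex_eq_iff e
      by (simp add: power2_eq_square algebra_simps cs cs')
  qed
  show "\<alpha> = 0" "\<beta> = 0" "\<delta> = 0"
    using quadratic_infinite_roots[OF inf root] by (auto simp: complex_eq_iff)
qed

text \<open>
  The equation is a quadratic equation for \<open>exp t\<close>.
\<close>

lemma infinite_zeros_hyperbolic:
  fixes \<alpha> \<beta> \<delta> :: real
  assumes inf: "infinite Z" and zero: "\<And>t. t \<in> Z \<Longrightarrow> \<alpha> + \<beta> * cosh t + \<delta> * sinh t = 0"
  shows "\<alpha> = 0" "\<beta> = 0" "\<delta> = 0"
proof -
  have inf: "infinite (exp ` Z)" using inf by (simp add: finite_image_iff inj_on_def)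
  have root: "(\<beta> - \<delta>) + (2 * \<alpha>) * z + (\<beta> + \<delta>) * z\<^sup>2 = 0" if z: "z \<in> exp ` Z" for z
  proof -
    obtain t where t: "t \<in> Z" "z = exp t" using z by blast
    have "(\<beta> - \<delta>) + (2 * \<alpha>) * z + (\<beta> + \<delta>) * z\<^sup>2 = 2 * z * (\<alpha> + \<beta> * cosh t + \<delta> * sinh t)"
      unfolding t(2) cosh_field_def sinh_field_def exp_minus by (simp add: field_simps power2_eq_square)
    then show ?thesis using zero[OF t(1)] by simp
  qed
  show "\<alpha> = 0" "\<beta> = 0" "\<delta> = 0"
    using quadratic_infinite_roots[OF inf root] by auto
qed

fun plane_functional :: "axis_type \<Rightarrow> real ^ 3 \<Rightarrow> real" where
  "plane_functional Timelike p = p $ 2"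
| "plane_functional Spacelike p = p $ 1"
| "plane_functional Lightlike p = p $ 1 - p $ 3"

lemma mem_generating_plane: "p \<in> generating_plane ax \<longleftrightarrow> plane_functional ax p = 0"
  by (cases ax) auto

lemma plane_functional_add: "plane_functional ax (p + q) = plane_functional ax p + plane_functional ax q"
  and plane_functional_scaleR: "plane_functional ax (a *\<^sub>R p) = a * plane_functional ax p"
  by (cases ax; simp add: algebra_simps)+

lemma range_inter_infinite:
  assumes "infinite (range c \<inter> P)"
  shows "infinite (c ` {t. c t \<in> P})"
  using assms by (rule contrapos_nn) (auto elim: finite_subset[rotated])

text \<open>
  The generating planes of timelike and spacelike axes are Lorentzian planes, where the orthogonal complement
  of a spacelike vector is timelike.
\<close>

lemma spacelike_plane_signature:
  assumes "ax \<noteq> Lightlike" "U \<in> generating_plane ax" "V \<in> generating_plane ax"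
    and "lorentz_inner U U > 0" "lorentz_inner U V = 0" "V \<noteq> 0"
  shows "lorentz_inner V V < 0"
proof -
  have key: "a * a - b * b < 0" if h: "c * c - d * d > 0" "c * a = d * b" "a \<noteq> 0 \<or> b \<noteq> 0" for a b c d :: real
  proof -
    have "(c * c) * (a * a - b * b) = (c * a) * (c * a) - (c * c) * (b * b)" by (simp add: algebra_simps)
    also have "\<dots> = - (c * c - d * d) * (b * b)" unfolding h(2) by (simp add: algebra_simps)
    finally have e: "(c * c) * (a * a - b * b) = - (c * c - d * d) * (b * b)" .
    have c: "c * c > 0" using h(1) by (smt (verit) zero_le_square)
    have "b \<noteq> 0" using h(2,3) c by auto
    then have "- (c * c - d * d) * (b * b) < 0" using h(1) by (intro mult_neg_pos) (auto simp: zero_less_mult_iff)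
    then show ?thesis using e c by (metis mult_less_0_iff not_less_iff_gr_or_eq)
  qed
  show ?thesis
  proof (cases ax)
    case Timelike
    then show ?thesis using assms key[of "U $ 1" "U $ 3" "V $ 1" "V $ 3"]
      by (auto simp: lorentz_inner_def vec_eq_iff forall_3)
  next
    case Spacelike
    then show ?thesis using assms key[of "U $ 2" "U $ 3" "V $ 2" "V $ 3"]
      by (auto simp: lorentz_inner_def vec_eq_iff forall_3)
  qed (use assms in auto)
qed

text \<open>
  A linear functional defining the plane vanishes at infinitely many points of the circle, hence on the spanning
  vectors \<open>U\<close> and \<open>V\<close> (and at \<open>c\<close>). The signature of the plane then has to agree with that of
  \<open>U, V\<close>: positive definite for an ellipse, Lorentzian for a hyperbola, degenerate for a parabola.
\<close>

lemma lorentz_circle_in_generating_plane: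
  assumes C: "lorentz_circle C" "\<not> collinear C" and inf: "infinite (C \<inter> generating_plane ax)"
  obtains
    (parabola) f where "ax = Lightlike" "\<And>p. p \<in> C \<Longrightarrow> p $ 1 = poly f (p $ 2)"
  | (hyperbola) c m where "ax \<noteq> Lightlike" "m \<noteq> 0" "closed C" "c \<in> generating_plane ax"
      "C \<subseteq> generating_plane ax" "\<And>p. p \<in> C \<Longrightarrow> lorentz_inner (p - c) (p - c) = m"
proof (rule lorentz_circle_cases[OF C])
  fix c U V
  assume Ceq: "C = range (\<lambda>t. c + cos t *\<^sub>R U + sin t *\<^sub>R V)"
    and UV: "lorentz_inner U U > 0" "lorentz_inner V V > 0" "lorentz_inner U V = 0"
  define Z where "Z = {t. c + cos t *\<^sub>R U + sin t *\<^sub>R V \<in> generating_plane ax}"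
  have "infinite ((\<lambda>t. c + cos t *\<^sub>R U + sin t *\<^sub>R V) ` Z)"
    unfolding Z_def by (rule range_inter_infinite) (use inf Ceq in simp)
  also have "(\<lambda>t. c + cos t *\<^sub>R U + sin t *\<^sub>R V) ` Z = (\<lambda>z. c + Re z *\<^sub>R U + Im z *\<^sub>R V) ` (cis ` Z)"
    by (simp add: image_image)
  finally have "infinite (cis ` Z)" by blast
  moreover have "plane_functional ax c + plane_functional ax U * cos t + plane_functional ax V * sin t = 0" if "t \<in> Z" for t
    using that unfolding Z_def mem_Collect_eq mem_generating_plane plane_functional_add plane_functional_scaleR
    by (simp add: mult.commute)
  ultimately have "plane_functional ax U = 0" "plane_functional ax V = 0"
    using infinite_zeros_trigonometric[of Z "plane_functional ax c" "plane_functional ax U" "plane_functional ax V"] by blast+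
  then have pl: "U \<in> generating_plane ax" "V \<in> generating_plane ax" by (simp_all add: mem_generating_plane)
  have "V \<noteq> 0" using UV by (auto simp: lorentz_inner_def)
  show thesis
  proof (cases "ax = Lightlike")
    case True
    then show thesis using UV pl by (auto simp: lorentz_inner_def)
  next
    case False
    then show thesis using spacelike_plane_signature[OF False pl UV(1,3) \<open>V \<noteq> 0\<close>] UV by auto
  qed
next
  fix c U V m
  assume Ceq: "C = range (\<lambda>t. c + cosh t *\<^sub>R U + sinh t *\<^sub>R V)" and m: "m \<noteq> 0"
    and UV: "lorentz_inner U U = m" "lorentz_inner V V = - m" "lorentz_inner U V = 0"
  define Z where "Z = {t. c + cosh t *\<^sub>R U + sinh t *\<^sub>R V \<in> generating_plane ax}"
  have "infinite ((\<lambda>t. c + cosh t *\<^sub>R U + sinh t *\<^sub>R V) ` Z)"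
    unfolding Z_def by (rule range_inter_infinite) (use inf Ceq in simp)
  then have "infinite Z" by blast
  moreover have "plane_functional ax c + plane_functional ax U * cosh t + plane_functional ax V * sinh t = 0" if "t \<in> Z" for t
    using that unfolding Z_def mem_Collect_eq mem_generating_plane plane_functional_add plane_functional_scaleR
    by (simp add: mult.commute)
  ultimately have "plane_functional ax c = 0" "plane_functional ax U = 0" "plane_functional ax V = 0"
    using infinite_zeros_hyperbolic[of Z "plane_functional ax c" "plane_functional ax U" "plane_functional ax V"] by blast+
  then have pl: "c \<in> generating_plane ax" "U \<in> generating_plane ax" "V \<in> generating_plane ax"
    and sub: "C \<subseteq> generating_plane ax"
    unfolding Ceq by (auto simp: mem_generating_plane plane_functional_add plane_functional_scaleR)
  have on: "lorentz_inner (p - c) (p - c) = m" if pC: "p \<in> C" for p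
  proof -
    obtain t where "p = c + cosh t *\<^sub>R U + sinh t *\<^sub>R V" using pC Ceq by blast
    then have p: "p - c = cosh t *\<^sub>R U + sinh t *\<^sub>R V" by simp
    have "lorentz_inner (p - c) (p - c) = m * ((cosh t)\<^sup>2 - (sinh t)\<^sup>2)"
      unfolding p by (simp add: lorentz_inner_simps UV lorentz_inner_commute[of V U] power2_eq_square algebra_simps)
    then show ?thesis by (simp add: cosh_square_eq)
  qed
  show thesis
  proof (cases "ax = Lightlike")
    case True
    have "(U $ 2)\<^sup>2 = m" "(V $ 2)\<^sup>2 = - m"
      using True UV(1,2) pl by (auto simp: lorentz_inner_def power2_eq_square)
    then have "m = 0" by (metis neg_0_le_iff_le order_antisym zero_le_power2)
    then show thesis using m by simp
  next
    case False
    show thesis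
      by (rule hyperbola[OF False m _ pl(1) sub on])
        (use closed_hyperbola_branch[OF m UV] Ceq in auto)
  qed
next
  fix c U V
  assume Ceq: "C = range (\<lambda>t. c + t *\<^sub>R U + t\<^sup>2 *\<^sub>R V)" and V: "V \<noteq> 0"
    and UV: "lorentz_inner U U > 0" "lorentz_inner V V = 0" "lorentz_inner U V = 0"
  define Z where "Z = {t. c + t *\<^sub>R U + t\<^sup>2 *\<^sub>R V \<in> generating_plane ax}"
  have "infinite ((\<lambda>t. c + t *\<^sub>R U + t\<^sup>2 *\<^sub>R V) ` Z)"
    unfolding Z_def by (rule range_inter_infinite) (use inf Ceq in simp)
  then have "infinite Z" by blast
  moreover have "plane_functional ax c + plane_functional ax U * t + plane_functional ax V * t\<^sup>2 = 0" if "t \<in> Z" for t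
    using that unfolding Z_def mem_Collect_eq mem_generating_plane plane_functional_add plane_functional_scaleR
    by (simp add: mult.commute)
  ultimately have "plane_functional ax c = 0" "plane_functional ax U = 0" "plane_functional ax V = 0"
    using quadratic_infinite_roots[of Z "plane_functional ax c" "plane_functional ax U" "plane_functional ax V"] by blast+
  then have pl: "c \<in> generating_plane ax" "U \<in> generating_plane ax" "V \<in> generating_plane ax"
    by (simp_all add: mem_generating_plane)
  show thesis
  proof (cases "ax = Lightlike")
    case True
    have U2: "U $ 2 \<noteq> 0" and V2: "V $ 2 = 0"
      using UV(1,2) pl True by (auto simp: lorentz_inner_def)
    let ?l = "[:- c $ 2 / U $ 2, 1 / U $ 2:]"
    let ?f = "[:c $ 1:] + smult (U $ 1) ?l + smult (V $ 1) (?l\<^sup>2)"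
    have "p $ 1 = poly ?f (p $ 2)" if pC: "p \<in> C" for p
    proof -
      obtain t where p: "p = c + t *\<^sub>R U + t\<^sup>2 *\<^sub>R V" using pC Ceq by blast
      have "poly ?l (p $ 2) = t" using U2 V2 unfolding p by (simp add: field_simps)
      then show ?thesis unfolding p poly_add poly_smult poly_power by simp
    qed
    then show thesis by (rule parabola[OF True])
  next
    case False
    then show thesis using spacelike_plane_signature[OF False pl(2,3) UV(1,3) V] UV by auto
  qed
qed

section \<open>Hyperbolas as generating curves\<close>

text \<open>
  The tangent \<open>(u', w')\<close> is Lorentz orthogonal to \<open>(u, w)\<close> and hence a multiple of \<open>(w, u)\<close>. The last equation
  needs no derivative of the factor \<open>\<mu>\<close>: it follows from the second derivative of \<open>u\<^sup>2 - w\<^sup>2 = k\<close>.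
\<close>

lemma hyperbola_derivatives:
  fixes u w :: "real \<Rightarrow> real"
  assumes I: "open I" and k: "k \<noteq> 0"
    and hyp: "\<And>s. s \<in> I \<Longrightarrow> (u s)\<^sup>2 - (w s)\<^sup>2 = k"
    and d: "\<And>s. s \<in> I \<Longrightarrow> (u has_real_derivative u' s) (at s)"
    "\<And>s. s \<in> I \<Longrightarrow> (w has_real_derivative w' s) (at s)"
    "\<And>s. s \<in> I \<Longrightarrow> (u' has_real_derivative u'' s) (at s)"
    "\<And>s. s \<in> I \<Longrightarrow> (w' has_real_derivative w'' s) (at s)"
  obtains \<mu> where "\<And>s. s \<in> I \<Longrightarrow> u' s = \<mu> s * w s" "\<And>s. s \<in> I \<Longrightarrow> w' s = \<mu> s * u s"
    "\<And>s. s \<in> I \<Longrightarrow> u' s * w'' s - w' s * u'' s = - k * \<mu> s ^ 3"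
proof
  fix s assume s: "s \<in> I"
  have 1: "u r * u' r = w r * w' r" if r: "r \<in> I" for r
  proof -
    have "((\<lambda>r. (u r)\<^sup>2 - (w r)\<^sup>2) has_real_derivative 2 * u r * u' r - 2 * w r * w' r) (at r)"
      by (auto intro!: derivative_eq_intros d r)
    from has_real_derivative_unique_on_open[OF this I r hyp DERIV_const] show ?thesis by simp
  qed
  have "((\<lambda>r. u r * u' r - w r * w' r) has_real_derivative
      (u' s * u' s + u s * u'' s - (w' s * w' s + w s * w'' s))) (at s)"
    by (auto intro!: derivative_eq_intros d s)
  from has_real_derivative_unique_on_open[OF this I s _ DERIV_const[of 0]]
  have 2: "u s * u'' s - w s * w'' s = w' s * w' s - u' s * u' s"
    using 1 by simp
  define l where "l = (w' s * u s - u' s * w s) / k"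
  have "k * u' s = u s * (u s * u' s) - w s * w s * u' s"
    unfolding hyp[OF s, symmetric] by (simp add: power2_eq_square algebra_simps)
  then have "k * u' s = (w' s * u s - u' s * w s) * w s"
    unfolding 1[OF s] by (simp add: algebra_simps)
  moreover have "k * w' s = u s * u s * w' s - w s * (w s * w' s)"
    unfolding hyp[OF s, symmetric] by (simp add: power2_eq_square algebra_simps)
  then have "k * w' s = (w' s * u s - u' s * w s) * u s"
    unfolding 1[OF s, symmetric] by (simp add: algebra_simps)
  ultimately show u': "u' s = (w' s * u s - u' s * w s) / k * w s"
    and w': "w' s = (w' s * u s - u' s * w s) / k * u s"
    using k by (auto simp: field_simps)
  have ul: "u' s = l * w s" "w' s = l * u s" using u' w' by (simp_all add: l_def)
  have "u' s * w'' s - w' s * u'' s = - l * (u s * u'' s - w s * w'' s)"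
    unfolding ul by (simp add: algebra_simps)
  also have "\<dots> = - (((u s)\<^sup>2 - (w s)\<^sup>2) * l ^ 3)"
    unfolding 2 ul by (simp add: power2_eq_square power3_eq_cube algebra_simps)
  finally show "u' s * w'' s - w' s * u'' s = - k * ((w' s * u s - u' s * w s) / k) ^ 3"
    unfolding hyp[OF s] l_def by simp
qed

text \<open>
  With \<open>u = x - a\<close> the curvature equation becomes a polynomial identity of degree \<open>4\<close> in \<open>u\<close>, which takes infinitely
  many values. If \<open>a \<noteq> 0\<close>, the coefficient of \<open>u\<^sup>3\<close> gives \<open>K (k + h\<^sup>2) = 3 / 4\<close> and then that of
  \<open>u\<^sup>4\<close> gives \<open>K (k + h\<^sup>2) = 1\<close>. If \<open>a = 0\<close>, those of \<open>u\<^sup>2\<close> and \<open>u\<^sup>0\<close> give \<open>K (k + h\<^sup>2) = 1 = K h\<^sup>2\<close>, hence \<open>k = 0\<close>.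
\<close>

lemma timelike_not_hyperbola:
  assumes h: "h \<noteq> 0" and gen: "generating_curve Timelike I \<gamma>"
    and nd: "non_degenerate_on I (helicoidal_param Timelike h \<gamma>)"
    and K: "\<forall>s\<in>I. \<forall>t. has_gauss_curvature (helicoidal_param Timelike h \<gamma>) s t K"
    and k: "k \<noteq> 0" and hyp: "\<And>s. s \<in> I \<Longrightarrow> (\<gamma> s $ 1 - a)\<^sup>2 - (\<gamma> s $ 3 - c)\<^sup>2 = k"
  shows False
proof (rule timelike_profile_equation[OF gen nd K])
  fix x z x' z' x'' z'' :: "real \<Rightarrow> real"
  assume \<gamma>: "\<And>s. s \<in> I \<Longrightarrow> \<gamma> s = vector [x s, 0, z s]"
    and d: "\<And>s. s \<in> I \<Longrightarrow> (x has_real_derivative x' s) (at s)"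
    "\<And>s. s \<in> I \<Longrightarrow> (z has_real_derivative z' s) (at s)"
    "\<And>s. s \<in> I \<Longrightarrow> (x' has_real_derivative x'' s) (at s)"
    "\<And>s. s \<in> I \<Longrightarrow> (z' has_real_derivative z'' s) (at s)"
    and D: "\<And>s. s \<in> I \<Longrightarrow> (x' s)\<^sup>2 * ((x s)\<^sup>2 - h\<^sup>2) - (x s)\<^sup>2 * (z' s)\<^sup>2 \<noteq> 0"
    and eq: "\<And>s. s \<in> I \<Longrightarrow> K * ((x' s)\<^sup>2 * ((x s)\<^sup>2 - h\<^sup>2) - (x s)\<^sup>2 * (z' s)\<^sup>2)\<^sup>2 =
       h\<^sup>2 * x' s ^ 4 - x s ^ 3 * z' s * (x' s * z'' s - z' s * x'' s)"
  have I: "open I" "is_interval I" using gen by (auto simp: generating_curve_def)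
  obtain s0 where s0: "s0 \<in> I" using gen by (auto simp: generating_curve_def)
  define u w where "u = (\<lambda>s. x s - a)" and "w = (\<lambda>s. z s - c)"
  have hyp': "(u s)\<^sup>2 - (w s)\<^sup>2 = k" if "s \<in> I" for s
    using hyp[OF that] \<gamma>[OF that] by (simp add: u_def w_def)
  have d': "(u has_real_derivative x' s) (at s)" "(w has_real_derivative z' s) (at s)" if "s \<in> I" for s
    unfolding u_def w_def using d that by (auto intro!: derivative_eq_intros)
  obtain l where l: "\<And>s. s \<in> I \<Longrightarrow> x' s = l s * w s" "\<And>s. s \<in> I \<Longrightarrow> z' s = l s * u s"
    "\<And>s. s \<in> I \<Longrightarrow> x' s * z'' s - z' s * x'' s = - k * l s ^ 3"
    using hyperbola_derivatives[OF I(1) k hyp' d' d(3,4)] by blast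
  have l0: "l s \<noteq> 0" if "s \<in> I" for s using D[OF that] l[OF that] by auto
  have inf: "infinite (u ` I)"
  proof
    assume "finite (u ` I)"
    then have "x' s = 0" if "s \<in> I" for s
      using deriv_zero_if_finite_image[OF I d'(1)] that by blast
    then have w0: "w s = 0" if "s \<in> I" for s using l(1)[OF that] l0[OF that] that by simp
    have "z' s0 = 0"
      by (rule has_real_derivative_unique_on_open[OF d'(2)[OF s0] I(1) s0 w0 DERIV_const])
    then have "u s0 = 0" using l(2)[OF s0] l0[OF s0] by simp
    then show False using hyp'[OF s0] w0[OF s0] k by simp
  qed
  let ?q0 = "k * a\<^sup>2 - h\<^sup>2 * k" and ?q1 = "2 * a * k" and ?q2 = "k + h\<^sup>2"
  \<comment> \<open>the curvature equation in terms of \<open>u\<close>, after division by \<open>l\<^sup>4\<close>\<close>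
  have "[:K * ?q0\<^sup>2, 2 * K * ?q0 * ?q1, K * (?q1\<^sup>2 + 2 * ?q0 * ?q2), 2 * K * ?q1 * ?q2, K * ?q2\<^sup>2:]
      = [:h\<^sup>2 * k\<^sup>2, k * a ^ 3, 3 * k * a\<^sup>2 - 2 * h\<^sup>2 * k, 3 * k * a, h\<^sup>2 + k:]"
  proof (rule poly_eqI_on_infinite[OF inf])
    fix v assume "v \<in> u ` I"
    then obtain s where s: "s \<in> I" "v = u s" by blast
    define X W L where "X = u s" and "W = w s" and "L = l s"
    have W: "W\<^sup>2 = X\<^sup>2 - k" using hyp'[OF s(1)] by (simp add: X_def W_def)
    have "W ^ 4 = (W\<^sup>2)\<^sup>2" by simp
    then have W4: "W ^ 4 = (X\<^sup>2 - k)\<^sup>2" unfolding W .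
    have xs: "x s = X + a" by (simp add: X_def u_def)
    have "L ^ 4 * (K * (k * (X + a)\<^sup>2 + h\<^sup>2 * (X\<^sup>2 - k))\<^sup>2)
        = K * ((L * W)\<^sup>2 * ((X + a)\<^sup>2 - h\<^sup>2) - (X + a)\<^sup>2 * (L * X)\<^sup>2)\<^sup>2"
      unfolding power_mult_distrib W by (simp add: power2_eq_square power4_eq_xxxx algebra_simps)
    also have "\<dots> = h\<^sup>2 * (L * W) ^ 4 - (X + a) ^ 3 * (L * X) * (- k * L ^ 3)"
      using eq[OF s(1)] unfolding l(3)[OF s(1)] unfolding l(1,2)[OF s(1)] xs
      by (simp add: X_def W_def L_def)
    also have "\<dots> = L ^ 4 * (h\<^sup>2 * (X\<^sup>2 - k)\<^sup>2 + k * (X + a) ^ 3 * X)"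
      unfolding power_mult_distrib W4 by (simp add: power4_eq_xxxx power3_eq_cube algebra_simps)
    finally have main: "K * (k * (X + a)\<^sup>2 + h\<^sup>2 * (X\<^sup>2 - k))\<^sup>2 = h\<^sup>2 * (X\<^sup>2 - k)\<^sup>2 + k * (X + a) ^ 3 * X"
      using l0[OF s(1)] by (simp add: L_def)
    have "poly [:K * ?q0\<^sup>2, 2 * K * ?q0 * ?q1, K * (?q1\<^sup>2 + 2 * ?q0 * ?q2), 2 * K * ?q1 * ?q2, K * ?q2\<^sup>2:] X
        = K * (k * (X + a)\<^sup>2 + h\<^sup>2 * (X\<^sup>2 - k))\<^sup>2"
      by (simp add: power2_eq_square algebra_simps)
    also have "\<dots> = poly [:h\<^sup>2 * k\<^sup>2, k * a ^ 3, 3 * k * a\<^sup>2 - 2 * h\<^sup>2 * k, 3 * k * a, h\<^sup>2 + k:] X"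
      unfolding main by (simp add: power2_eq_square power3_eq_cube algebra_simps)
    finally show "poly [:K * ?q0\<^sup>2, 2 * K * ?q0 * ?q1, K * (?q1\<^sup>2 + 2 * ?q0 * ?q2), 2 * K * ?q1 * ?q2, K * ?q2\<^sup>2:] v
        = poly [:h\<^sup>2 * k\<^sup>2, k * a ^ 3, 3 * k * a\<^sup>2 - 2 * h\<^sup>2 * k, 3 * k * a, h\<^sup>2 + k:] v"
      unfolding s(2) X_def .
  qed
  then have c0: "K * ?q0\<^sup>2 = h\<^sup>2 * k\<^sup>2" and c2: "K * (?q1\<^sup>2 + 2 * ?q0 * ?q2) = 3 * k * a\<^sup>2 - 2 * h\<^sup>2 * k"
    and c3: "2 * K * ?q1 * ?q2 = 3 * k * a" and c4: "K * ?q2\<^sup>2 = h\<^sup>2 + k"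
    unfolding pCons_eq_iff by blast+
  show False
  proof (cases "a = 0")
    case True
    have "(- 2 * h\<^sup>2 * k) * (K * ?q2) = (- 2 * h\<^sup>2 * k) * 1"
      using c2 True by (simp add: algebra_simps)
    then have e: "K * ?q2 = 1" using h k by simp
    have "k\<^sup>2 * h\<^sup>2 * (K * h\<^sup>2) = k\<^sup>2 * h\<^sup>2 * 1"
      using c0 True by (simp add: power2_eq_square algebra_simps)
    then have "K * h\<^sup>2 = 1" using h k by simp
    then have "K * k = 0" using e by (simp add: algebra_simps)
    then show False using k \<open>K * h\<^sup>2 = 1\<close> by auto
  next
    case False
    have "(k * a) * (4 * (K * ?q2)) = (k * a) * 3" using c3 by (simp add: algebra_simps)
    then have e: "4 * (K * ?q2) = 3" using k False mult_left_cancel[of "k * a"] by fastforce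
    then have "?q2 \<noteq> 0" by auto
    moreover have "?q2 * (K * ?q2) = ?q2 * 1" using c4 by (simp add: power2_eq_square algebra_simps)
    ultimately have "K * ?q2 = 1" using mult_left_cancel by blast
    then show False using e by simp
  qed
qed

text \<open>
  Let \<open>u = y - b\<close>, \<open>w = z - c\<close>, \<open>P = b u - c w\<close> and \<open>Q = b w - c u\<close>. The curvature equation becomes
  \<open>K (h\<^sup>2 k + Q\<^sup>2)\<^sup>2 = - h\<^sup>2 k P\<close>. Since \<open>P\<^sup>2 = Q\<^sup>2 + (b\<^sup>2 - c\<^sup>2) k\<close>, its square is a polynomial equation for \<open>Q\<close> with
  sides of degree \<open>8\<close> (or zero) and \<open>2\<close>; so \<open>Q\<close> takes finitely many values and is constant. Each
  of \<open>P\<close> and \<open>Q\<close> is a nonzero function times the derivative of the other, so both vanish, which gives \<open>b = c = 0\<close>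
  because \<open>u\<^sup>2 \<noteq> w\<^sup>2\<close>.
\<close>

lemma spacelike_hyperbola_flat_centered:
  assumes h: "h \<noteq> 0" and gen: "generating_curve Spacelike I \<gamma>"
    and nd: "non_degenerate_on I (helicoidal_param Spacelike h \<gamma>)"
    and K: "\<forall>s\<in>I. \<forall>t. has_gauss_curvature (helicoidal_param Spacelike h \<gamma>) s t K"
    and k: "k \<noteq> 0" and hyp: "\<And>s. s \<in> I \<Longrightarrow> (\<gamma> s $ 2 - b)\<^sup>2 - (\<gamma> s $ 3 - c)\<^sup>2 = k"
  shows "b = 0 \<and> c = 0 \<and> K = 0"
proof (rule spacelike_profile_equation[OF gen nd K])
  fix y z y' z' y'' z'' :: "real \<Rightarrow> real"
  assume \<gamma>: "\<And>s. s \<in> I \<Longrightarrow> \<gamma> s = vector [0, y s, z s]"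
    and d: "\<And>s. s \<in> I \<Longrightarrow> (y has_real_derivative y' s) (at s)"
    "\<And>s. s \<in> I \<Longrightarrow> (z has_real_derivative z' s) (at s)"
    "\<And>s. s \<in> I \<Longrightarrow> (y' has_real_derivative y'' s) (at s)"
    "\<And>s. s \<in> I \<Longrightarrow> (z' has_real_derivative z'' s) (at s)"
    and D: "\<And>s. s \<in> I \<Longrightarrow> h\<^sup>2 * ((y' s)\<^sup>2 - (z' s)\<^sup>2) - (y s * y' s - z s * z' s)\<^sup>2 \<noteq> 0"
    and eq: "\<And>s. s \<in> I \<Longrightarrow> K * (h\<^sup>2 * ((y' s)\<^sup>2 - (z' s)\<^sup>2) - (y s * y' s - z s * z' s)\<^sup>2)\<^sup>2 =
       h\<^sup>2 * (((z' s)\<^sup>2 - (y' s)\<^sup>2)\<^sup>2 - (z' s * y'' s - y' s * z'' s) * (z' s * y s - y' s * z s))"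
  have I: "open I" "is_interval I" using gen by (auto simp: generating_curve_def)
  obtain s0 where s0: "s0 \<in> I" using gen by (auto simp: generating_curve_def)
  define u w where "u = (\<lambda>s. y s - b)" and "w = (\<lambda>s. z s - c)"
  have hyp': "(u s)\<^sup>2 - (w s)\<^sup>2 = k" if "s \<in> I" for s
    using hyp[OF that] \<gamma>[OF that] by (simp add: u_def w_def)
  have d': "(u has_real_derivative y' s) (at s)" "(w has_real_derivative z' s) (at s)" if "s \<in> I" for s
    unfolding u_def w_def using d that by (auto intro!: derivative_eq_intros)
  obtain l where l: "\<And>s. s \<in> I \<Longrightarrow> y' s = l s * w s" "\<And>s. s \<in> I \<Longrightarrow> z' s = l s * u s"
    "\<And>s. s \<in> I \<Longrightarrow> y' s * z'' s - z' s * y'' s = - k * l s ^ 3"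
    using hyperbola_derivatives[OF I(1) k hyp' d' d(3,4)] by blast
  have l0: "l s \<noteq> 0" if "s \<in> I" for s using D[OF that] l[OF that] by auto
  define P Q where "P = (\<lambda>s. b * u s - c * w s)" and "Q = (\<lambda>s. b * w s - c * u s)"
  have PQ: "(P s)\<^sup>2 = (Q s)\<^sup>2 + (b\<^sup>2 - c\<^sup>2) * k" if "s \<in> I" for s
    unfolding P_def Q_def hyp'[OF that, symmetric] by (simp add: power2_eq_square algebra_simps)
  have main: "K * (h\<^sup>2 * k + (Q s)\<^sup>2)\<^sup>2 = - h\<^sup>2 * k * P s" if s: "s \<in> I" for s
  proof -
    define L where "L = l s"
    have ys: "y s = u s + b" "z s = w s + c" by (simp_all add: u_def w_def)
    have e1: "y s * y' s - z s * z' s = L * Q s"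
      unfolding l[OF s] ys Q_def L_def by (simp add: algebra_simps)
    have e2: "(y' s)\<^sup>2 - (z' s)\<^sup>2 = - k * L\<^sup>2"
      unfolding l[OF s] hyp'[OF s, symmetric] L_def by (simp add: power2_eq_square algebra_simps)
    then have e3: "(z' s)\<^sup>2 - (y' s)\<^sup>2 = k * L\<^sup>2" by simp
    have e4: "z' s * y'' s - y' s * z'' s = k * L ^ 3"
      using l(3)[OF s] unfolding L_def by simp
    have e5: "z' s * y s - y' s * z s = L * (k + P s)"
      unfolding l[OF s] hyp'[OF s, symmetric] ys P_def L_def by (simp add: power2_eq_square algebra_simps)
    have "K * (h\<^sup>2 * (- k * L\<^sup>2) - (L * Q s)\<^sup>2)\<^sup>2
        = h\<^sup>2 * ((k * L\<^sup>2)\<^sup>2 - (k * L ^ 3) * (L * (k + P s)))"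
      using eq[OF s] unfolding e1 e2 e3 e4 e5 .
    then have "L ^ 4 * (K * (h\<^sup>2 * k + (Q s)\<^sup>2)\<^sup>2) = L ^ 4 * (- h\<^sup>2 * k * P s)"
      by (simp add: power2_eq_square power3_eq_cube power4_eq_xxxx algebra_simps)
    moreover have "L ^ 4 \<noteq> 0" using l0[OF s] by (simp add: L_def)
    ultimately show ?thesis using mult_left_cancel by blast
  qed
  have dP: "(P has_real_derivative l s * Q s) (at s)" and dQ: "(Q has_real_derivative l s * P s) (at s)"
    if "s \<in> I" for s
    unfolding P_def Q_def using d'[OF that] l(1,2)[OF that]
    by (auto intro!: derivative_eq_intros simp: algebra_simps)
  have "finite (Q ` I)"
  proof (rule ccontr)
    assume "infinite (Q ` I)"
    then have id: "smult (K\<^sup>2) ([:h\<^sup>2 * k, 0, 1:] ^ 4)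
        = [:h ^ 4 * k\<^sup>2 * ((b\<^sup>2 - c\<^sup>2) * k), 0, h ^ 4 * k\<^sup>2:]" (is "?l = ?r")
    proof (rule poly_eqI_on_infinite)
      fix v assume "v \<in> Q ` I"
      then obtain s where s: "s \<in> I" "v = Q s" by blast
      have "poly ?l v = (K * (h\<^sup>2 * k + v\<^sup>2)\<^sup>2)\<^sup>2"
        by (simp add: power2_eq_square power4_eq_xxxx algebra_simps)
      also have "\<dots> = h ^ 4 * k\<^sup>2 * (P s)\<^sup>2"
        unfolding s(2) main[OF s(1)] by (simp add: power2_eq_square power4_eq_xxxx algebra_simps)
      also have "\<dots> = poly ?r v"
        unfolding PQ[OF s(1)] s(2) by (simp add: power2_eq_square algebra_simps)
      finally show "poly ?l v = poly ?r v" .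
    qed
    have "degree ?l = (if K = 0 then 0 else 8)"
      by (subst degree_smult_eq, subst degree_power_eq) auto
    moreover have "degree ?r = 2" using h k by simp
    ultimately show False unfolding id by (auto split: if_splits)
  qed
  then have "l s * P s = 0" if "s \<in> I" for s
    using deriv_zero_if_finite_image[OF I dQ] that by blast
  then have P0: "P s = 0" if "s \<in> I" for s using l0 that by fastforce
  have "l s0 * Q s0 = 0"
    by (rule has_real_derivative_unique_on_open[OF dP[OF s0] I(1) s0 P0 DERIV_const])
  then have Q0: "Q s0 = 0" using l0[OF s0] by simp
  have "b * k = u s0 * P s0 - w s0 * Q s0"
    unfolding P_def Q_def hyp'[OF s0, symmetric] by (simp add: power2_eq_square algebra_simps)
  then have "b = 0" using P0[OF s0] Q0 k by simp
  moreover have "c * k = w s0 * P s0 - u s0 * Q s0"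
    unfolding P_def Q_def hyp'[OF s0, symmetric] by (simp add: power2_eq_square algebra_simps)
  then have "c = 0" using P0[OF s0] Q0 k by simp
  moreover have "K = 0" using main[OF s0] P0[OF s0] Q0 h k by simp
  ultimately show ?thesis by simp
qed

section \<open>Open parts and components of hyperbolic cylinders\<close>

lemma continuous_on_vector3:
  assumes "continuous_on S f" "continuous_on S g" "continuous_on S k"
  shows "continuous_on S (\<lambda>x. vector [f x, g x, k x] :: real ^ 3)"
proof -
  have eq: "(\<lambda>x. vector [f x, g x, k x] :: real ^ 3)
    = (\<lambda>x. f x *\<^sub>R vector [1, 0, 0] + g x *\<^sub>R vector [0, 1, 0] + k x *\<^sub>R vector [0, 0, 1])"
    by (auto simp: vec_eq_iff forall_3)
  show ?thesis unfolding eq by (intro continuous_intros assms)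
qed

lemma continuous_on_spacelike_motion:
  assumes "continuous_on S f" "continuous_on S g"
  shows "continuous_on S (\<lambda>x. helicoidal_motion Spacelike h (f x) (g x))"
  unfolding helicoidal_motion.simps
  by (intro continuous_on_vector3 continuous_intros assms)

lemma spacelike_motion_add:
  "helicoidal_motion Spacelike h s (helicoidal_motion Spacelike h t p) = helicoidal_motion Spacelike h (s + t) p"
  by (simp add: vec_eq_iff forall_3 cosh_add sinh_add algebra_simps)

lemma spacelike_motion_quadric:
  "(helicoidal_motion Spacelike h t p $ 2)\<^sup>2 - (helicoidal_motion Spacelike h t p $ 3)\<^sup>2 = (p $ 2)\<^sup>2 - (p $ 3)\<^sup>2"
proof -
  have "(helicoidal_motion Spacelike h t p $ 2)\<^sup>2 - (helicoidal_motion Spacelike h t p $ 3)\<^sup>2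
      = ((p $ 2)\<^sup>2 - (p $ 3)\<^sup>2) * ((cosh t)\<^sup>2 - (sinh t)\<^sup>2)"
    by (simp add: power2_eq_square algebra_simps)
  then show ?thesis by (simp add: cosh_square_eq)
qed

text \<open>
  Each orbit meets the plane \<open>x = 0\<close> exactly once; the following map sends a point to this
  representative of its orbit.
\<close>

definition spacelike_section :: "real \<Rightarrow> real ^ 3 \<Rightarrow> real ^ 3" where
  "spacelike_section h p = helicoidal_motion Spacelike h (- p $ 1 / h) p"

lemma continuous_on_spacelike_section: "h \<noteq> 0 \<Longrightarrow> continuous_on UNIV (spacelike_section h)"
  unfolding spacelike_section_def[abs_def]
  by (intro continuous_on_spacelike_motion continuous_intros) auto

lemma spacelike_section_1: "h \<noteq> 0 \<Longrightarrow> spacelike_section h p $ 1 = 0"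
  by (simp add: spacelike_section_def)

lemma mem_spacelike_surface:
  assumes h: "h \<noteq> 0" and plane: "\<gamma> ` I \<subseteq> generating_plane Spacelike"
  shows "p \<in> helicoidal_surface Spacelike h \<gamma> I \<longleftrightarrow> spacelike_section h p \<in> \<gamma> ` I"
proof
  assume "p \<in> helicoidal_surface Spacelike h \<gamma> I"
  then obtain s t where s: "s \<in> I" and p: "p = helicoidal_motion Spacelike h t (\<gamma> s)"
    unfolding mem_helicoidal_surface by blast
  have "\<gamma> s $ 1 = 0" using plane s by auto
  then have "p $ 1 / h = t" using h by (simp add: p)
  then have "spacelike_section h p = helicoidal_motion Spacelike h (- t) p"
    by (simp only: spacelike_section_def minus_divide_left[symmetric])
  also have "\<dots> = \<gamma> s" by (simp only: p spacelike_motion_add) simp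
  finally show "spacelike_section h p \<in> \<gamma> ` I" using s by simp
next
  assume "spacelike_section h p \<in> \<gamma> ` I"
  then obtain s where s: "s \<in> I" "spacelike_section h p = \<gamma> s" by blast
  have "helicoidal_motion Spacelike h (p $ 1 / h) (\<gamma> s) = p"
    unfolding s(2)[symmetric] spacelike_section_def spacelike_motion_add
    by (simp del: helicoidal_motion.simps)
  then show "p \<in> helicoidal_surface Spacelike h \<gamma> I" using s(1) mem_helicoidal_surface by metis
qed

text \<open>
  For \<open>q = \<gamma> s\<^sub>0\<close>, the points \<open>p\<close> of the hyperbola near \<open>q\<close> are determined by the coordinate
  \<open>q\<^sub>2 p\<^sub>3 - q\<^sub>3 p\<^sub>2\<close>, which vanishes at \<open>q\<close> and is \<open>k\<close> times the hyperbolic sine of the angle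
  between \<open>q\<close> and \<open>p\<close>. Along the curve its derivative at \<open>s\<^sub>0\<close> does not vanish, so by
  the intermediate value theorem the curve covers a neighbourhood of \<open>q\<close> in the hyperbola.
\<close>

lemma openin_hyperbola_curve:
  assumes I: "open I" and k: "k \<noteq> 0"
    and \<gamma>: "\<And>s. s \<in> I \<Longrightarrow> \<gamma> s = vector [0, y s, z s]"
    and hyp: "\<And>s. s \<in> I \<Longrightarrow> (y s)\<^sup>2 - (z s)\<^sup>2 = k"
    and d: "\<And>s. s \<in> I \<Longrightarrow> (y has_real_derivative l s * z s) (at s)"
      "\<And>s. s \<in> I \<Longrightarrow> (z has_real_derivative l s * y s) (at s)"
    and l: "\<And>s. s \<in> I \<Longrightarrow> l s \<noteq> 0"
  shows "openin (top_of_set {p :: real ^ 3. p $ 1 = 0 \<and> (p $ 2)\<^sup>2 - (p $ 3)\<^sup>2 = k}) (\<gamma> ` I)"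
    (is "openin (top_of_set ?H) _")
proof -
  have sub: "\<gamma> ` I \<subseteq> ?H" using \<gamma> hyp by auto
  have "\<exists>T. open T \<and> \<gamma> s0 \<in> T \<and> ?H \<inter> T \<subseteq> \<gamma> ` I" if s0: "s0 \<in> I" for s0
  proof -
    define b c m where "b = y s0" and "c = z s0" and "m = k * l s0"
    have bc: "b\<^sup>2 - c\<^sup>2 = k" and m: "m \<noteq> 0" using hyp[OF s0] l[OF s0] k by (auto simp: b_def c_def m_def)
    define g e where "g = (\<lambda>(v, w). m * (b * w - c * v))" and "e = (\<lambda>(v, w). k * (b * v - c * w))"
    have dg: "((\<lambda>s. g (y s, z s)) has_real_derivative m * (b * (l s * y s) - c * (l s * z s))) (at s)"
      and ce: "isCont (\<lambda>s. e (y s, z s)) s" if "s \<in> I" for s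
      unfolding g_def e_def using d[OF that] by (auto intro!: derivative_eq_intros continuous_intros DERIV_isCont)
    have "m * (b * (l s0 * y s0) - c * (l s0 * z s0)) = m\<^sup>2"
      unfolding m_def bc[symmetric] b_def c_def by (simp add: power2_eq_square algebra_simps)
    then have pos: "0 < m * (b * (l s0 * y s0) - c * (l s0 * z s0))" using m by simp
    have g0: "g (y s0, z s0) = 0" by (simp add: g_def b_def c_def)
    have "e (y s0, z s0) = k\<^sup>2" unfolding e_def bc[symmetric] b_def c_def
      by (simp add: power2_eq_square)
    then have e0: "e (y s0, z s0) > 0" using k by simp
    obtain r1 where r1: "r1 > 0" "ball s0 r1 \<subseteq> I" using I s0 openE by blast
    have "eventually (\<lambda>s. 0 < e (y s, z s)) (at s0)"
      using ce[OF s0] e0 unfolding isCont_def by (rule order_tendstoD(1))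
    then obtain r2 where r2: "r2 > 0" "\<And>s. s \<noteq> s0 \<Longrightarrow> dist s s0 < r2 \<Longrightarrow> 0 < e (y s, z s)"
      unfolding eventually_at by auto
    obtain r3 where r3: "r3 > 0" "\<And>r. 0 < r \<Longrightarrow> r < r3 \<Longrightarrow> 0 < g (y (s0 + r), z (s0 + r))"
      using DERIV_pos_inc_right[OF dg[OF s0] pos] g0 by auto
    obtain r4 where r4: "r4 > 0" "\<And>r. 0 < r \<Longrightarrow> r < r4 \<Longrightarrow> g (y (s0 - r), z (s0 - r)) < 0"
      using DERIV_pos_inc_left[OF dg[OF s0] pos] g0 by auto
    define r where "r = min (min r1 r2) (min r3 r4) / 2"
    have r: "0 < r" "r < r1" "r < r2" "r < r3" "r < r4"
      using r1(1) r2(1) r3(1) r4(1) unfolding r_def by auto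
    define lo hi where "lo = g (y (s0 - r), z (s0 - r))" and "hi = g (y (s0 + r), z (s0 + r))"
    have lohi: "lo < 0" "0 < hi" using r3(2)[OF r(1,4)] r4(2)[OF r(1,5)] by (auto simp: lo_def hi_def)
    define T where "T = {p :: real ^ 3. lo < g (p $ 2, p $ 3)} \<inter> {p. g (p $ 2, p $ 3) < hi} \<inter> {p. 0 < e (p $ 2, p $ 3)}"
    have "open T"
      unfolding T_def g_def e_def by (intro open_Int open_Collect_less) (auto intro!: continuous_intros)
    moreover have "\<gamma> s0 \<in> T" unfolding T_def using \<gamma>[OF s0] g0 e0 lohi by simp
    moreover have "p \<in> \<gamma> ` I" if p: "p \<in> ?H" "p \<in> T" for p
    proof -
      have inI: "s \<in> I" and es: "0 < e (y s, z s)" if "s0 - r \<le> s" "s \<le> s0 + r" for s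
        using that r r1(2) r2(2)[of s] e0 by (cases "s = s0"; auto simp: dist_real_def subset_iff)+
      have "\<exists>s\<ge>s0 - r. s \<le> s0 + r \<and> g (y s, z s) = g (p $ 2, p $ 3)"
      proof (rule IVT)
        show "\<forall>s. s0 - r \<le> s \<and> s \<le> s0 + r \<longrightarrow> isCont (\<lambda>s. g (y s, z s)) s"
          using dg[OF inI] DERIV_isCont by blast
      qed (use p(2) r in \<open>auto simp: T_def lo_def hi_def\<close>)
      then obtain s where s: "s0 - r \<le> s" "s \<le> s0 + r" "g (y s, z s) = g (p $ 2, p $ 3)" by blast
      have sI: "s \<in> I" using inI s by blast
      define v w where "v = p $ 2" and "w = p $ 3"
      have hv: "v\<^sup>2 - w\<^sup>2 = k" using p(1) by (simp add: v_def w_def)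
      have G: "b * z s - c * y s = b * w - c * v" using s(3) m by (simp add: g_def v_def w_def)
      \<comment> \<open>the other coordinate satisfies \<open>(b v - c w)\<^sup>2 = k\<^sup>2 + (b w - c v)\<^sup>2\<close> and has the sign of \<open>k\<close>\<close>
      have "(b * p - c * q)\<^sup>2 - (b * q - c * p)\<^sup>2 = (b\<^sup>2 - c\<^sup>2) * (p\<^sup>2 - q\<^sup>2)" for p q
        by (simp add: power2_eq_square algebra_simps)
      from this[of "y s" "z s"] this[of v w] have "(b * y s - c * z s)\<^sup>2 = (b * v - c * w)\<^sup>2"
        unfolding hyp[OF sI] hv G by simp
      then have "b * y s - c * z s = b * v - c * w \<or> b * y s - c * z s = - (b * v - c * w)"
        by (simp add: power2_eq_iff)
      moreover have "0 < k * (b * y s - c * z s)" "0 < k * (b * v - c * w)"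
        using es[OF s(1,2)] p(2) by (auto simp: e_def T_def v_def w_def)
      ultimately have E: "b * y s - c * z s = b * v - c * w"
        by (auto simp: zero_less_mult_iff)
      have comb: "k * p = b * (b * p - c * q) + c * (b * q - c * p)"
        "k * q = c * (b * p - c * q) + b * (b * q - c * p)" for p q
        unfolding bc[symmetric] by (simp_all add: power2_eq_square algebra_simps)
      have "k * y s = k * v" "k * z s = k * w"
        using comb[where p = "y s" and q = "z s"] comb[where p = v and q = w] unfolding E G by simp_all
      then have "\<gamma> s = p" using \<gamma>[OF sI] p(1) k by (simp add: vec_eq_iff forall_3 v_def w_def)
      then show ?thesis using sI by blast
    qed
    ultimately show ?thesis by blast
  qed
  then have "\<exists>T. openin (top_of_set ?H) T \<and> p \<in> T \<and> T \<subseteq> \<gamma> ` I" if "p \<in> \<gamma> ` I" for p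
    using that sub openin_open_Int[of _ ?H] by (smt (verit, best) IntI imageE subsetD)
  then show ?thesis by (subst openin_subopen) blast
qed

text \<open>
  The cylinder and the surface are the preimages of the hyperbola and of the generating curve under the section.
\<close>

lemma spacelike_surface_open_part:
  assumes h: "h \<noteq> 0" and plane: "\<gamma> ` I \<subseteq> generating_plane Spacelike"
    and "openin (top_of_set {p :: real ^ 3. p $ 1 = 0 \<and> (p $ 2)\<^sup>2 - (p $ 3)\<^sup>2 = \<sigma> * r\<^sup>2}) (\<gamma> ` I)"
  shows "open_part_of (helicoidal_surface Spacelike h \<gamma> I) (hyperbolic_cylinder \<sigma> r)"
proof -
  let ?H = "{p :: real ^ 3. p $ 1 = 0 \<and> (p $ 2)\<^sup>2 - (p $ 3)\<^sup>2 = \<sigma> * r\<^sup>2}"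
  obtain T where T: "open T" "\<gamma> ` I = ?H \<inter> T" using assms(3) unfolding openin_open by blast
  have "spacelike_section h p \<in> ?H \<longleftrightarrow> p \<in> hyperbolic_cylinder \<sigma> r" for p
    using spacelike_section_1[OF h, of p] spacelike_motion_quadric[of h "- p $ 1 / h" p]
    by (simp del: helicoidal_motion.simps add: hyperbolic_cylinder_def spacelike_section_def)
  then have "helicoidal_surface Spacelike h \<gamma> I = hyperbolic_cylinder \<sigma> r \<inter> spacelike_section h -` T"
    using mem_spacelike_surface[OF h plane] T(2) by blast
  moreover have "open (spacelike_section h -` T)"
    using continuous_on_spacelike_section[OF h] T(1) by (rule open_vimage[rotated])
  ultimately show ?thesis unfolding open_part_of_def openin_open by blast
qed

lemma clopen_connected_in_components:
  assumes "connected S" "S \<noteq> {}" "openin (top_of_set M) S" "closedin (top_of_set M) S"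
  shows "S \<in> components M"
proof -
  have SM: "S \<subseteq> M" using assms(3) openin_imp_subset by blast
  then obtain D where D: "D \<in> components M" "S \<subseteq> D"
    using exists_component_superset[OF SM _ assms(1)] assms(2) by blast
  have "D \<subseteq> M" "connected D" using D(1) in_components_subset in_components_connected by blast+
  moreover have "openin (top_of_set D) S" "closedin (top_of_set D) S"
    using openin_subset_trans[OF assms(3) D(2) \<open>D \<subseteq> M\<close>] closedin_subset_trans[OF assms(4) D(2) \<open>D \<subseteq> M\<close>] .
  ultimately have "S = D" using connected_clopen[of D] assms(2) by blast
  then show ?thesis using D(1) by simp
qed

text \<open>
  The surface is the preimage of the closed set \<open>\<gamma> ` I\<close> under the section, so it is closed as well as open in \<open>M\<close>.
\<close>

lemma spacelike_surface_component:
  assumes h: "h \<noteq> 0" and gen: "generating_curve Spacelike I \<gamma>"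
    and op: "open_part_of (helicoidal_surface Spacelike h \<gamma> I) M" and cl: "closed (\<gamma> ` I)"
  shows "helicoidal_surface Spacelike h \<gamma> I \<in> components M"
proof (rule clopen_connected_in_components)
  let ?S = "helicoidal_surface Spacelike h \<gamma> I"
  have plane: "\<gamma> ` I \<subseteq> generating_plane Spacelike" and "connected I" "I \<noteq> {}"
    using gen by (auto simp: generating_curve_def is_interval_connected)
  obtain \<gamma>' where "\<And>s. s \<in> I \<Longrightarrow> (\<gamma> has_vector_derivative \<gamma>' s) (at s)"
    using gen unfolding generating_curve_def C2_curve_on_def by blast
  then have "continuous_on I \<gamma>"
    by (meson continuous_at_imp_continuous_on has_vector_derivative_continuous)
  then have "continuous_on (I \<times> UNIV) (\<lambda>x. helicoidal_motion Spacelike h (snd x) (\<gamma> (fst x)))"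
    by (intro continuous_on_spacelike_motion continuous_intros) (auto elim: continuous_on_compose2 intro!: continuous_intros)
  moreover have "?S = (\<lambda>x. helicoidal_motion Spacelike h (snd x) (\<gamma> (fst x))) ` (I \<times> UNIV)"
    unfolding helicoidal_surface_def helicoidal_param_def by (simp add: case_prod_beta')
  moreover have "connected (I \<times> (UNIV :: real set))"
    using \<open>connected I\<close> connected_UNIV by (rule connected_Times)
  ultimately show "connected ?S" by (simp only: connected_continuous_image)
  show "?S \<noteq> {}" using \<open>I \<noteq> {}\<close> unfolding helicoidal_surface_def by blast
  show "openin (top_of_set M) ?S" using op by (simp add: open_part_of_def)
  have "?S = spacelike_section h -` (\<gamma> ` I)"
    using mem_spacelike_surface[OF h plane] by blast
  then have "closed ?S" using closed_vimage[OF cl continuous_on_spacelike_section[OF h]] by simp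
  moreover have "?S \<subseteq> M" using op unfolding open_part_of_def by (rule openin_imp_subset)
  ultimately show "closedin (top_of_set M) ?S" by (intro closed_subset)
qed

lemma openin_hyperbola_generating_curve:
  assumes gen: "generating_curve Spacelike I \<gamma>"
    and nd: "non_degenerate_on I (helicoidal_param Spacelike h \<gamma>)"
    and K: "\<forall>s\<in>I. \<forall>t. has_gauss_curvature (helicoidal_param Spacelike h \<gamma>) s t K"
    and k: "k \<noteq> 0" and hyp: "\<And>s. s \<in> I \<Longrightarrow> (\<gamma> s $ 2)\<^sup>2 - (\<gamma> s $ 3)\<^sup>2 = k"
  shows "openin (top_of_set {p :: real ^ 3. p $ 1 = 0 \<and> (p $ 2)\<^sup>2 - (p $ 3)\<^sup>2 = k}) (\<gamma> ` I)"
proof (rule spacelike_profile_equation[OF gen nd K])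
  fix y z y' z' y'' z'' :: "real \<Rightarrow> real"
  assume \<gamma>: "\<And>s. s \<in> I \<Longrightarrow> \<gamma> s = vector [0, y s, z s]"
    and d: "\<And>s. s \<in> I \<Longrightarrow> (y has_real_derivative y' s) (at s)"
    "\<And>s. s \<in> I \<Longrightarrow> (z has_real_derivative z' s) (at s)"
    "\<And>s. s \<in> I \<Longrightarrow> (y' has_real_derivative y'' s) (at s)"
    "\<And>s. s \<in> I \<Longrightarrow> (z' has_real_derivative z'' s) (at s)"
    and D: "\<And>s. s \<in> I \<Longrightarrow> h\<^sup>2 * ((y' s)\<^sup>2 - (z' s)\<^sup>2) - (y s * y' s - z s * z' s)\<^sup>2 \<noteq> 0"
  have I: "open I" using gen by (auto simp: generating_curve_def)
  have hyp': "(y s)\<^sup>2 - (z s)\<^sup>2 = k" if "s \<in> I" for s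
    using hyp[OF that] \<gamma>[OF that] by simp
  obtain l where l: "\<And>s. s \<in> I \<Longrightarrow> y' s = l s * z s" "\<And>s. s \<in> I \<Longrightarrow> z' s = l s * y s"
    by (rule hyperbola_derivatives[OF I k hyp' d]; assumption?) (rule that)
  show ?thesis
  proof (rule openin_hyperbola_curve[OF I k \<gamma> hyp'])
    show "l s \<noteq> 0" if "s \<in> I" for s using D[OF that] l[OF that] by auto
    show "(y has_real_derivative l s * z s) (at s)" if "s \<in> I" for s
      using d(1)[OF that] l(1)[OF that] by simp
    show "(z has_real_derivative l s * y s) (at s)" if "s \<in> I" for s
      using d(2)[OF that] l(2)[OF that] by simp
  qed
qed

section \<open>Constant curvature surfaces generated by polynomials and circles\<close>

text \<open>
  Otherwise \<open>\<gamma>\<close> would be constant, and \<open>\<gamma>' = 0\<close> contradicts non-degeneracy.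
\<close>

lemma infinite_generating_curve:
  assumes gen: "generating_curve ax I \<gamma>" and nd: "non_degenerate_on I (helicoidal_param ax h \<gamma>)"
    and K: "\<forall>s\<in>I. \<forall>t. has_gauss_curvature (helicoidal_param ax h \<gamma>) s t K"
  shows "infinite (\<gamma> ` I)"
proof (rule constant_curvature_profile[OF gen nd K])
  fix \<gamma>' :: "real \<Rightarrow> real ^ 3"
  assume d: "\<And>s. s \<in> I \<Longrightarrow> (\<gamma> has_vector_derivative \<gamma>' s) (at s)"
    and D: "\<And>s. s \<in> I \<Longrightarrow> gram (\<gamma>' s) (helicoidal_velocity ax h (\<gamma> s)) \<noteq> 0"
  have I: "open I" "is_interval I" using gen by (auto simp: generating_curve_def)
  obtain s where s: "s \<in> I" using gen by (auto simp: generating_curve_def)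
  show ?thesis
  proof
    assume fin: "finite (\<gamma> ` I)"
    have "\<gamma>' s $ i = 0" for i
    proof (rule deriv_zero_if_finite_image[OF I _ _ s])
      show "((\<lambda>s. \<gamma> s $ i) has_real_derivative \<gamma>' s $ i) (at s)" if "s \<in> I" for s
        by (rule has_real_derivative_vec_nth[OF d[OF that]])
      show "finite ((\<lambda>s. \<gamma> s $ i) ` I)"
        using finite_imageI[OF fin, of "\<lambda>p. p $ i"] by (simp add: image_image)
    qed
    then have "\<gamma>' s = 0" by (simp add: vec_eq_iff)
    then show False using D[OF s] by (simp add: gram_def lorentz_inner_def)
  qed
qed

lemma polynomial_graph_degree:
  assumes h: "h \<noteq> 0" and gen: "generating_curve ax I \<gamma>"
    and nd: "non_degenerate_on I (helicoidal_param ax h \<gamma>)"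
    and K: "\<forall>s\<in>I. \<forall>t. has_gauss_curvature (helicoidal_param ax h \<gamma>) s t K"
    and graph: "polynomial_graph ax I \<gamma> f"
  shows "degree f \<le> 1"
proof (cases ax)
  case Timelike
  then show ?thesis using timelike_polynomial_graph[OF h] gen nd K graph by fastforce
next
  case Spacelike
  then show ?thesis using spacelike_polynomial_graph[OF h] gen nd K graph by fastforce
next
  case Lightlike
  then have "\<gamma> s $ 1 = poly f (\<gamma> s $ 2)" if "s \<in> I" for s
    using graph that by (simp add: polynomial_graph_def)
  then have False
    by (rule lightlike_not_polynomial_graph[OF h gen[unfolded Lightlike] nd[unfolded Lightlike]
      K[unfolded Lightlike]])
  then show ?thesis ..
qed

lemma timelike_polynomial_surface:
  assumes h: "h \<noteq> 0" and gen: "generating_curve Timelike I \<gamma>"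
    and nd: "non_degenerate_on I (helicoidal_param Timelike h \<gamma>)"
    and K: "\<forall>s\<in>I. \<forall>t. has_gauss_curvature (helicoidal_param Timelike h \<gamma>) s t K"
    and curve: "(\<exists>f. polynomial_graph Timelike I \<gamma> f) \<or> non_graph_line Timelike I \<gamma>"
  shows "(\<exists>r>0. open_part_of (helicoidal_surface Timelike h \<gamma> I) (lorentzian_cylinder r) \<and>
            (I = UNIV \<longrightarrow> helicoidal_surface Timelike h \<gamma> I = lorentzian_cylinder r) \<and> K = 0) \<or>
         (\<exists>\<sigma> a0. \<sigma> \<in> {1, - 1} \<and>
            (\<forall>s\<in>I. \<forall>t. helicoidal_param Timelike h \<gamma> s t =
               vector [s * cos t, s * sin t, \<sigma> * s + a0 + h * t]) \<and> K = 1 / h\<^sup>2)"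
  using curve
proof
  assume "\<exists>f. polynomial_graph Timelike I \<gamma> f"
  then obtain f where f: "polynomial_graph Timelike I \<gamma> f" by blast
  obtain \<sigma> a where \<sigma>: "\<sigma> \<in> {1, - 1}" "f = [:a, \<sigma>:]" and "K = 1 / h\<^sup>2"
    using timelike_polynomial_graph[OF h gen nd K f] by blast
  moreover have "\<forall>s\<in>I. \<forall>t. helicoidal_param Timelike h \<gamma> s t = vector [s * cos t, s * sin t, \<sigma> * s + a + h * t]"
    using f \<sigma>(2) by (auto simp: helicoidal_param_def polynomial_graph_def vec_eq_iff forall_3)
  ultimately show ?thesis by blast
next
  assume "non_graph_line Timelike I \<gamma>"
  then obtain b where b: "b > 0" and line: "\<And>s. s \<in> I \<Longrightarrow> \<gamma> s = vertical_line Timelike b s"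
    unfolding non_graph_line_def by blast
  have "open I" using gen by (simp add: generating_curve_def)
  have "open_part_of (helicoidal_surface Timelike h \<gamma> I) (lorentzian_cylinder b)"
    using timelike_line_open_part[OF b \<open>open I\<close> line] .
  moreover have "helicoidal_surface Timelike h \<gamma> I = lorentzian_cylinder b" if "I = UNIV"
    unfolding that by (rule timelike_line_surface) (use line that in blast)
  moreover have "K = 0" using timelike_line_flat[OF h gen nd K line] .
  ultimately show ?thesis using b by blast
qed

lemma spacelike_polynomial_surface:
  assumes h: "h \<noteq> 0" and gen: "generating_curve Spacelike I \<gamma>"
    and nd: "non_degenerate_on I (helicoidal_param Spacelike h \<gamma>)"
    and K: "\<forall>s\<in>I. \<forall>t. has_gauss_curvature (helicoidal_param Spacelike h \<gamma>) s t K"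
    and curve: "(\<exists>f. polynomial_graph Spacelike I \<gamma> f) \<or> non_graph_line Spacelike I \<gamma>"
  shows "\<exists>\<sigma> a0. \<sigma> \<in> {1, - 1} \<and> a0 \<noteq> 0 \<and>
           (\<forall>s\<in>I. \<forall>t. helicoidal_param Spacelike h \<gamma> s t =
              vector [h * t, (\<sigma> * s + a0) * sinh t + s * cosh t, (\<sigma> * s + a0) * cosh t + s * sinh t]) \<and>
           K = 0"
proof -
  obtain f where f: "polynomial_graph Spacelike I \<gamma> f"
    using curve spacelike_not_line[OF h gen nd K] unfolding non_graph_line_def by blast
  obtain \<sigma> a where \<sigma>: "\<sigma> \<in> {1, - 1}" "a \<noteq> 0" "f = [:a, \<sigma>:]" and "K = 0"
    using spacelike_polynomial_graph[OF h gen nd K f] by blast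
  moreover have "\<forall>s\<in>I. \<forall>t. helicoidal_param Spacelike h \<gamma> s t =
      vector [h * t, (\<sigma> * s + a) * sinh t + s * cosh t, (\<sigma> * s + a) * cosh t + s * sinh t]"
    using f \<sigma>(3) by (auto simp: helicoidal_param_def polynomial_graph_def vec_eq_iff forall_3 algebra_simps)
  ultimately show ?thesis by blast
qed

lemma lightlike_polynomial_surface:
  assumes h: "h \<noteq> 0" and gen: "generating_curve Lightlike I \<gamma>"
    and nd: "non_degenerate_on I (helicoidal_param Lightlike h \<gamma>)"
    and K: "\<forall>s\<in>I. \<forall>t. has_gauss_curvature (helicoidal_param Lightlike h \<gamma>) s t K"
    and curve: "(\<exists>f. polynomial_graph Lightlike I \<gamma> f) \<or> non_graph_line Lightlike I \<gamma>"
  shows "\<exists>b. (\<forall>s\<in>I. \<forall>t. helicoidal_param Lightlike h \<gamma> s t =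
              vector [s + b * t + h * (t ^ 3 / 3 - t), b + h * t\<^sup>2, s + b * t + h * (t ^ 3 / 3 + t)]) \<and>
             K = 0"
  using curve
proof
  assume "\<exists>f. polynomial_graph Lightlike I \<gamma> f"
  then obtain f where "polynomial_graph Lightlike I \<gamma> f" by blast
  then have "\<gamma> s $ 1 = poly f (\<gamma> s $ 2)" if "s \<in> I" for s
    using that by (simp add: polynomial_graph_def)
  then show ?thesis using lightlike_not_polynomial_graph[OF h gen nd K] by blast
next
  assume "non_graph_line Lightlike I \<gamma>"
  then obtain b where line: "\<And>s. s \<in> I \<Longrightarrow> \<gamma> s = vertical_line Lightlike b s"
    unfolding non_graph_line_def by blast
  have "\<forall>s\<in>I. \<forall>t. helicoidal_param Lightlike h \<gamma> s t =
      vector [s + b * t + h * (t ^ 3 / 3 - t), b + h * t\<^sup>2, s + b * t + h * (t ^ 3 / 3 + t)]"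
    using line by (simp add: helicoidal_param_def vec_eq_iff forall_3 algebra_simps)
  then show ?thesis using lightlike_line_flat[OF h gen nd K line] by blast
qed

text \<open>
  With the centre at the origin the generating curve lies on \<open>y\<^sup>2 - z\<^sup>2 = m\<close>; the sign of \<open>m\<close> decides between the
  two hyperbolic cylinders. The whole circle is one branch and closed, which yields the component.
\<close>

lemma circle_surface:
  assumes h: "h \<noteq> 0" and gen: "generating_curve ax I \<gamma>"
    and nd: "non_degenerate_on I (helicoidal_param ax h \<gamma>)"
    and K: "\<forall>s\<in>I. \<forall>t. has_gauss_curvature (helicoidal_param ax h \<gamma>) s t K"
    and C: "lorentz_circle C" "\<not> collinear C" "\<gamma> ` I \<subseteq> C"
  shows "ax = Spacelike \<and> K = 0 \<and>
     (\<exists>c r \<sigma>. r > 0 \<and> \<sigma> \<in> {1, - 1} \<and>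
        C \<subseteq> hyperbola c \<sigma> r \<and> c \<in> axis_line ax \<and>
        open_part_of (helicoidal_surface ax h \<gamma> I) (hyperbolic_cylinder \<sigma> r) \<and>
        (\<gamma> ` I = C \<longrightarrow> helicoidal_surface ax h \<gamma> I \<in> components (hyperbolic_cylinder \<sigma> r)))"
proof -
  have plane: "\<gamma> ` I \<subseteq> generating_plane ax" using gen by (simp add: generating_curve_def)
  then have "infinite (C \<inter> generating_plane ax)"
    using infinite_generating_curve[OF gen nd K] C(3) by (meson Int_greatest infinite_super)
  from C(1,2) this show ?thesis
  proof (cases rule: lorentz_circle_in_generating_plane)
    case (parabola f)
    have "\<gamma> s $ 1 = poly f (\<gamma> s $ 2)" if "s \<in> I" for s using parabola(2) C(3) that by blast
    then have False
      by (rule lightlike_not_polynomial_graph[OF h gen[unfolded parabola(1)] nd[unfolded parabola(1)]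
        K[unfolded parabola(1)]])
    then show ?thesis ..
  next
    case (hyperbola c m)
    show ?thesis
    proof (cases ax)
      case Timelike
      have "(\<gamma> s $ 1 - c $ 1)\<^sup>2 - (\<gamma> s $ 3 - c $ 3)\<^sup>2 = m" if "s \<in> I" for s
      proof -
        have "\<gamma> s \<in> C" "\<gamma> s \<in> generating_plane ax" using C(3) plane that by auto
        then show ?thesis
          using hyperbola(6)[of "\<gamma> s"] hyperbola(4) unfolding Timelike
          by (simp add: lorentz_inner_def power2_eq_square)
      qed
      then have False
        by (rule timelike_not_hyperbola[OF h gen[unfolded Timelike] nd[unfolded Timelike] K[unfolded Timelike]
          hyperbola(2)])
      then show ?thesis ..
    next
      case Spacelike
      note gen = gen[unfolded Spacelike] and nd = nd[unfolded Spacelike] and K = K[unfolded Spacelike]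
      have on: "(p $ 2 - c $ 2)\<^sup>2 - (p $ 3 - c $ 3)\<^sup>2 = m" "p $ 1 = 0" if "p \<in> C" for p
        using hyperbola(6)[OF that] hyperbola(4,5) that unfolding Spacelike
        by (auto simp: lorentz_inner_def power2_eq_square)
      have c0: "c $ 2 = 0 \<and> c $ 3 = 0 \<and> K = 0"
        by (rule spacelike_hyperbola_flat_centered[OF h gen nd K hyperbola(2)]) (use on C(3) in blast)
      define \<sigma> r where "\<sigma> = sgn m" and "r = sqrt \<bar>m\<bar>"
      have \<sigma>: "\<sigma> \<in> {1, - 1}" "r > 0" "\<sigma> * r\<^sup>2 = m"
        using hyperbola(2) by (auto simp: \<sigma>_def r_def sgn_if)
      have on0: "(p $ 2)\<^sup>2 - (p $ 3)\<^sup>2 = m" "p $ 1 = 0" if "p \<in> C" for p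
        using on[OF that] c0 by auto
      have "(\<gamma> s $ 2)\<^sup>2 - (\<gamma> s $ 3)\<^sup>2 = m" if "s \<in> I" for s
        using on0(1) C(3) that by blast
      from openin_hyperbola_generating_curve[OF gen nd K hyperbola(2) this]
      have op: "open_part_of (helicoidal_surface Spacelike h \<gamma> I) (hyperbolic_cylinder \<sigma> r)"
        unfolding \<sigma>(3)[symmetric] by (rule spacelike_surface_open_part[OF h plane[unfolded Spacelike]])
      have "C \<subseteq> Defs.hyperbola 0 \<sigma> r"
        using on0 \<sigma>(3) by (auto simp: hyperbola_def)
      moreover have "0 \<in> axis_line Spacelike" by (simp add: axis_line_def span_zero)
      moreover have "helicoidal_surface Spacelike h \<gamma> I \<in> components (hyperbolic_cylinder \<sigma> r)"
        if "\<gamma> ` I = C"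
        using spacelike_surface_component[OF h gen op] hyperbola(3) that by simp
      ultimately have "\<exists>c r \<sigma>. r > 0 \<and> \<sigma> \<in> {1, - 1} \<and> C \<subseteq> Defs.hyperbola c \<sigma> r \<and> c \<in> axis_line ax \<and>
          open_part_of (helicoidal_surface ax h \<gamma> I) (hyperbolic_cylinder \<sigma> r) \<and>
          (\<gamma> ` I = C \<longrightarrow> helicoidal_surface ax h \<gamma> I \<in> components (hyperbolic_cylinder \<sigma> r))"
        unfolding Spacelike using \<sigma>(1,2) op by (intro exI[of _ 0] exI[of _ r] exI[of _ \<sigma>]) simp
      then show ?thesis using c0 Spacelike by blast
    qed (use hyperbola(1) in simp)
  qed
qed

theorem theorem1p3:
  fixes ax :: axis_type and h K :: real and I :: "real set" and \<gamma> :: "real \<Rightarrow> real ^ 3"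
  assumes "h \<noteq> 0"
    and "generating_curve ax I \<gamma>"
    and "non_degenerate_on I (helicoidal_param ax h \<gamma>)"
    and "\<forall>s\<in>I. \<forall>t. has_gauss_curvature (helicoidal_param ax h \<gamma>) s t K"
  shows "(\<forall>f. polynomial_graph ax I \<gamma> f \<longrightarrow> degree f \<le> 1) \<and>
         ((\<exists>f. polynomial_graph ax I \<gamma> f) \<or> non_graph_line ax I \<gamma> \<longrightarrow>
           (case ax of
              Timelike \<Rightarrow>
                (\<exists>r>0. open_part_of (helicoidal_surface ax h \<gamma> I) (lorentzian_cylinder r) \<and>
                       (I = UNIV \<longrightarrow> helicoidal_surface ax h \<gamma> I = lorentzian_cylinder r) \<and>
                       K = 0) \<or>
                (\<exists>\<sigma> a0. \<sigma> \<in> {1, - 1} \<and>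
                   (\<forall>s\<in>I. \<forall>t. helicoidal_param ax h \<gamma> s t =
                      vector [s * cos t, s * sin t, \<sigma> * s + a0 + h * t]) \<and>
                   K = 1 / h\<^sup>2)
            | Spacelike \<Rightarrow>
                (\<exists>\<sigma> a0. \<sigma> \<in> {1, - 1} \<and> a0 \<noteq> 0 \<and>
                   (\<forall>s\<in>I. \<forall>t. helicoidal_param ax h \<gamma> s t =
                      vector [h * t,
                              (\<sigma> * s + a0) * sinh t + s * cosh t,
                              (\<sigma> * s + a0) * cosh t + s * sinh t]) \<and>
                   K = 0)
            | Lightlike \<Rightarrow>
                (\<exists>b. (\<forall>s\<in>I. \<forall>t. helicoidal_param ax h \<gamma> s t =
                        vector [s + b * t + h * (t ^ 3 / 3 - t),
                                b + h * t\<^sup>2,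
                                s + b * t + h * (t ^ 3 / 3 + t)]) \<and>
                     K = 0))) \<and>
         (\<forall>C. lorentz_circle C \<and> \<not> collinear C \<and> \<gamma> ` I \<subseteq> C \<longrightarrow>
            ax = Spacelike \<and> K = 0 \<and>
            (\<exists>c r \<sigma>. r > 0 \<and> \<sigma> \<in> {1, - 1} \<and>
               C \<subseteq> hyperbola c \<sigma> r \<and> c \<in> axis_line ax \<and>
               open_part_of (helicoidal_surface ax h \<gamma> I) (hyperbolic_cylinder \<sigma> r) \<and>
               (\<gamma> ` I = C \<longrightarrow>
                  helicoidal_surface ax h \<gamma> I \<in> components (hyperbolic_cylinder \<sigma> r))))"
proof (intro conjI impI allI)
  note hyps = assms
  show "degree f \<le> 1" if "polynomial_graph ax I \<gamma> f" for f
    using polynomial_graph_degree[OF hyps that] .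
  show "case ax of
      Timelike \<Rightarrow>
        (\<exists>r>0. open_part_of (helicoidal_surface ax h \<gamma> I) (lorentzian_cylinder r) \<and>
               (I = UNIV \<longrightarrow> helicoidal_surface ax h \<gamma> I = lorentzian_cylinder r) \<and> K = 0) \<or>
        (\<exists>\<sigma> a0. \<sigma> \<in> {1, - 1} \<and>
           (\<forall>s\<in>I. \<forall>t. helicoidal_param ax h \<gamma> s t =
              vector [s * cos t, s * sin t, \<sigma> * s + a0 + h * t]) \<and> K = 1 / h\<^sup>2)
    | Spacelike \<Rightarrow>
        (\<exists>\<sigma> a0. \<sigma> \<in> {1, - 1} \<and> a0 \<noteq> 0 \<and>
           (\<forall>s\<in>I. \<forall>t. helicoidal_param ax h \<gamma> s t =
              vector [h * t, (\<sigma> * s + a0) * sinh t + s * cosh t, (\<sigma> * s + a0) * cosh t + s * sinh t]) \<and>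
           K = 0)
    | Lightlike \<Rightarrow>
        (\<exists>b. (\<forall>s\<in>I. \<forall>t. helicoidal_param ax h \<gamma> s t =
                vector [s + b * t + h * (t ^ 3 / 3 - t), b + h * t\<^sup>2, s + b * t + h * (t ^ 3 / 3 + t)]) \<and>
             K = 0)"
    if "(\<exists>f. polynomial_graph ax I \<gamma> f) \<or> non_graph_line ax I \<gamma>"
    using timelike_polynomial_surface spacelike_polynomial_surface lightlike_polynomial_surface
      hyps that by (cases ax; simp only: axis_type.case)
next
  fix C
  assume "lorentz_circle C \<and> \<not> collinear C \<and> \<gamma> ` I \<subseteq> C"
  then have C: "lorentz_circle C" "\<not> collinear C" "\<gamma> ` I \<subseteq> C" by blast+
  note surface = circle_surface[OF assms C]
  show "ax = Spacelike" "K = 0" using surface by blast+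
  show "\<exists>c r \<sigma>. r > 0 \<and> \<sigma> \<in> {1, - 1} \<and>
      C \<subseteq> hyperbola c \<sigma> r \<and> c \<in> axis_line ax \<and>
      open_part_of (helicoidal_surface ax h \<gamma> I) (hyperbolic_cylinder \<sigma> r) \<and>
      (\<gamma> ` I = C \<longrightarrow> helicoidal_surface ax h \<gamma> I \<in> components (hyperbolic_cylinder \<sigma> r))"
    using surface by blast
qed

end
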